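(* Let $f,g_1,\ldots,g_m\in\mathbb{R}[X]=\mathbb{R}[X_1,\ldots,X_n]$ be symmetric with $\deg g_j\le m$ for $1\le j\le m$ and $\deg f\le 2m$. Assume that the variety $V(g_1,\ldots,g_m)\subseteq\mathbb{C}^n$ has codimension $m$. Put $r:=\max\{2,\lfloor(\deg f)/2\rfloor,\deg g_1,\ldots,\deg g_m\}$, assume $r\le n$, and let $\Omega$ be the set of $r$-partitions of $n$. Then the relaxation sequence $\big(\inf_{\omega\in\Omega}\inf Q_k^\omega\big)_k$ converges to $\inf\{f(x): x\in\mathbb{R}^n,\ g_1(x)=\cdots=g_m(x)=0\}$ in finitely many steps, i.e. there is an $l$ such that $\inf_{\omega\in\Omega}\inf Q_l^\omega$ equals this infimum.
   Context: Symmetric means invariant under all permutations of the variables. An $r$-partition of $n$ is a vector $\omega=(\omega_1,\ldots,\omega_r)$ of positive, non-increasing integers with $\omega_1+\cdots+\omega_r=n$. For $p\in\mathbb{R}[X]$ symmetric, $p^\omega\in\mathbb{R}[T_1,\ldots,T_r]$ is obtained by substituting $T_1$ for $\omega_1$ of the variables, $T_2$ for $\omega_2$ of the variables, ..., $T_r$ for $\omega_r$ of the variables: $p^\omega:=p(T_1,\ldots,T_1,T_2,\ldots,T_2,\ldots,T_r,\ldots,T_r)$. $Q_k^\omega$ is the $k$-th Lasserre relaxation of $\inf\{f^\omega(t): t\in\mathbb{R}^r,\ g_1^\omega(t)=\cdots=g_m^\omega(t)=0\}$ (equality constraints being treated as the pairs $g_j^\omega\ge0$, $-g_j^\omega\ge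 0$), with optimal value $\inf Q_k^\omega$. Here, for a problem $\inf\{F(t):G_1(t)\ge0,\ldots,G_N(t)\ge0\}$ with polynomials in $t\in\mathbb{R}^r$ and $k\ge k_0:=\max\{\lceil\deg F/2\rceil,\lceil\deg G_j/2\rceil\}$, the $k$-th Lasserre relaxation is: minimize $L(F)$ over linear maps $L:\mathbb{R}[T]_{\le 2k}\to\mathbb{R}$ with $L(1)=1$, $L(p^2)\ge0$ for all $p$ with $\deg p\le k$, and $L(p^2G_j)\ge 0$ for all $p$ with $\deg p\le k-\lceil\deg G_j/2\rceil$, $1\le j\le N$. The infimum over an empty set is $+\infty$. *)

theory Defs
  imports Complex_Main
    "HOL-Library.Poly_Mapping"
    "HOL-Library.FuncSet"
    "HOL-Library.Extended_Real"
    "HOL-Combinatorics.Permutations"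
begin

section \<open>Polynomials in finitely many variables\<close>

text \<open>
  A polynomial is a finitely supported map from exponent vectors to coefficients; the ring
  operations are those of \<^theory>\<open>HOL-Library.Poly_Mapping\<close>. The variables are
  numbered from 0, so \<open>poly_ring n\<close> below is the ring in \<open>X 0, \<dots>, X (n - 1)\<close>.
\<close>

type_synonym 'a mpoly = "(nat \<Rightarrow>\<^sub>0 nat) \<Rightarrow>\<^sub>0 'a"

definition Const :: "'a::zero \<Rightarrow> 'a mpoly" where
  "Const c = Poly_Mapping.single 0 c"

definition Var :: "nat \<Rightarrow> 'a::zero_neq_one mpoly" where
  "Var i = Poly_Mapping.single (Poly_Mapping.single i 1) 1"

definition poly_ring :: "nat \<Rightarrow> 'a::zero mpoly set" where
  "poly_ring n = {p. \<forall>\<alpha>\<in>Poly_Mapping.keys p. Poly_Mapping.keys \<alpha> \<subseteq> {..<n}}"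

text \<open>The degree of the zero polynomial is 0 here.\<close>

definition total_degree :: "'a::zero mpoly \<Rightarrow> nat" where
  "total_degree p =
     Max (insert 0 ((\<lambda>\<alpha>. \<Sum>i\<in>Poly_Mapping.keys \<alpha>. Poly_Mapping.lookup \<alpha> i) ` Poly_Mapping.keys p))"

definition poly_ring_le :: "nat \<Rightarrow> nat \<Rightarrow> 'a::zero mpoly set" where
  "poly_ring_le n d = {p \<in> poly_ring n. total_degree p \<le> d}"

text \<open>
  \<open>mpoly_eval h x p\<close> maps the coefficients of \<open>p\<close> through \<open>h\<close> and substitutes \<open>x i\<close> for the
  \<open>i\<close>-th variable. It serves both for evaluation at points and for substituting polynomials.
\<close>

definition mpoly_eval :: "('a::zero \<Rightarrow> 'b::comm_semiring_1) \<Rightarrow> (nat \<Rightarrow> 'b) \<Rightarrow> 'a mpoly \<Rightarrow> 'b" where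
  "mpoly_eval h x p =
     (\<Sum>\<alpha>\<in>Poly_Mapping.keys p. h (Poly_Mapping.lookup p \<alpha>) *
        (\<Prod>i\<in>Poly_Mapping.keys \<alpha>. x i ^ Poly_Mapping.lookup \<alpha> i))"

abbreviation evaluate :: "'a::comm_semiring_1 mpoly \<Rightarrow> (nat \<Rightarrow> 'a) \<Rightarrow> 'a" where
  "evaluate p x \<equiv> mpoly_eval (\<lambda>c. c) x p"

abbreviation substitute :: "'a::comm_semiring_1 mpoly \<Rightarrow> (nat \<Rightarrow> 'a mpoly) \<Rightarrow> 'a mpoly" where
  "substitute p \<sigma> \<equiv> mpoly_eval Const \<sigma> p"

definition symmetric_poly :: "nat \<Rightarrow> 'a::comm_semiring_1 mpoly \<Rightarrow> bool" where
  "symmetric_poly n p \<longleftrightarrow> (\<forall>\<pi>. \<pi> permutes {..<n} \<longrightarrow> substitute p (\<lambda>i. Var (\<pi> i)) = p)"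


section \<open>Partitions and the polynomials \<open>p\<^sup>\<omega>\<close>\<close>

definition r_partitions :: "nat \<Rightarrow> nat \<Rightarrow> nat list set" where
  "r_partitions r n =
     {\<omega>. length \<omega> = r \<and> (\<forall>a\<in>set \<omega>. 0 < a) \<and> sorted_wrt (\<ge>) \<omega> \<and> sum_list \<omega> = n}"

text \<open>
  \<open>blocks \<omega>\<close> is the list \<open>0, \<dots>, 0, 1, \<dots>, 1, \<dots>\<close> of length \<open>sum_list \<omega>\<close> in which \<open>l\<close> occurs
  \<open>\<omega> ! l\<close> times; its \<open>i\<close>-th entry is the index of the variable substituted for \<open>X i\<close>.
\<close>

definition blocks :: "nat list \<Rightarrow> nat list" where
  "blocks \<omega> = concat (map (\<lambda>l. replicate (\<omega> ! l) l) [0..<length \<omega>])"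

definition part_poly :: "nat list \<Rightarrow> 'a::comm_semiring_1 mpoly \<Rightarrow> 'a mpoly" where
  "part_poly \<omega> p = substitute p (\<lambda>i. Var (blocks \<omega> ! i))"


section \<open>Affine space and codimension of complex varieties\<close>

definition affine_space :: "nat \<Rightarrow> (nat \<Rightarrow> 'a) set" where
  "affine_space n = {..<n} \<rightarrow>\<^sub>E UNIV"

definition zero_locus :: "nat \<Rightarrow> 'a::comm_semiring_1 mpoly set \<Rightarrow> (nat \<Rightarrow> 'a) set" where
  "zero_locus n P = {x \<in> affine_space n. \<forall>p\<in>P. evaluate p x = 0}"

definition complex_variety :: "nat \<Rightarrow> real mpoly set \<Rightarrow> (nat \<Rightarrow> complex) set" where
  "complex_variety n P = {z \<in> affine_space n. \<forall>p\<in>P. mpoly_eval complex_of_real z p = 0}"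

definition zariski_closed :: "nat \<Rightarrow> (nat \<Rightarrow> 'a::comm_semiring_1) set \<Rightarrow> bool" where
  "zariski_closed n S \<longleftrightarrow> (\<exists>P \<subseteq> poly_ring n. S = zero_locus n P)"

definition zariski_irreducible :: "nat \<Rightarrow> (nat \<Rightarrow> 'a::comm_semiring_1) set \<Rightarrow> bool" where
  "zariski_irreducible n S \<longleftrightarrow> zariski_closed n S \<and> S \<noteq> {} \<and>
     (\<forall>A B. zariski_closed n A \<longrightarrow> zariski_closed n B \<longrightarrow> S = A \<union> B \<longrightarrow> S = A \<or> S = B)"

text \<open>
  Krull dimension: the supremum of the lengths \<open>d\<close> of chains \<open>Z 0 \<subset> \<dots> \<subset> Z d\<close> of
  irreducible closed subsets. The empty set has dimension \<open>-\<infinity>\<close>, hence codimension \<open>\<infinity>\<close>.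
\<close>

definition zariski_dim :: "nat \<Rightarrow> (nat \<Rightarrow> 'a::comm_semiring_1) set \<Rightarrow> ereal" where
  "zariski_dim n V =
     Sup {ereal (real d) | d. \<exists>Z. (\<forall>i\<le>d. zariski_irreducible n (Z i) \<and> Z i \<subseteq> V) \<and>
                                  (\<forall>i<d. Z i \<subset> Z (Suc i))}"

definition zariski_codim :: "nat \<Rightarrow> (nat \<Rightarrow> 'a::comm_semiring_1) set \<Rightarrow> ereal" where
  "zariski_codim n V = ereal (real n) - zariski_dim n V"


section \<open>Lasserre relaxations\<close>

text \<open>
  The problem is \<open>inf {F t | t. \<forall>G\<in>Gs. G t \<ge> 0}\<close> over points with \<open>r\<close> coordinates, for a finite
  set \<open>Gs\<close> of constraint polynomials.
\<close>

definition half_deg :: "'a::zero mpoly \<Rightarrow> nat" where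
  "half_deg p = nat \<lceil>real (total_degree p) / 2\<rceil>"

definition lasserre_k0 :: "real mpoly \<Rightarrow> real mpoly set \<Rightarrow> nat" where
  "lasserre_k0 F Gs = Max (insert (half_deg F) (half_deg ` Gs))"

text \<open>
  A linear map on the polynomials of degree at most \<open>2 * k\<close> is represented by a total function
  that is required to be linear there; its other values are irrelevant. The subtraction below
  does not truncate as long as \<open>k \<ge> lasserre_k0 F Gs\<close>.
\<close>

definition lasserre_feasible :: "nat \<Rightarrow> real mpoly set \<Rightarrow> nat \<Rightarrow> (real mpoly \<Rightarrow> real) set" where
  "lasserre_feasible r Gs k =
     {L. (\<forall>p\<in>poly_ring_le r (2 * k). \<forall>q\<in>poly_ring_le r (2 * k). L (p + q) = L p + L q) \<and>
         (\<forall>c. \<forall>p\<in>poly_ring_le r (2 * k). L (Const c * p) = c * L p) \<and>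
         L 1 = 1 \<and>
         (\<forall>p\<in>poly_ring_le r k. L (p ^ 2) \<ge> 0) \<and>
         (\<forall>G\<in>Gs. \<forall>p\<in>poly_ring_le r (k - half_deg G). L (p ^ 2 * G) \<ge> 0)}"

definition lasserre_value :: "nat \<Rightarrow> real mpoly \<Rightarrow> real mpoly set \<Rightarrow> nat \<Rightarrow> ereal" where
  "lasserre_value r F Gs k = (INF L\<in>lasserre_feasible r Gs k. ereal (L F))"

text \<open>Constraints of the problem belonging to \<open>\<omega>\<close>: each equation is a pair of inequalities.\<close>

definition part_constraints :: "nat list \<Rightarrow> (nat \<Rightarrow> real mpoly) \<Rightarrow> nat \<Rightarrow> real mpoly set" where
  "part_constraints \<omega> g m = (\<Union>j<m. {part_poly \<omega> (g j), - part_poly \<omega> (g j)})"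

definition Q_k0 :: "nat list \<Rightarrow> real mpoly \<Rightarrow> (nat \<Rightarrow> real mpoly) \<Rightarrow> nat \<Rightarrow> nat" where
  "Q_k0 \<omega> f g m = lasserre_k0 (part_poly \<omega> f) (part_constraints \<omega> g m)"

definition Q_value :: "nat list \<Rightarrow> real mpoly \<Rightarrow> (nat \<Rightarrow> real mpoly) \<Rightarrow> nat \<Rightarrow> nat \<Rightarrow> ereal" where
  "Q_value \<omega> f g m k = lasserre_value (length \<omega>) (part_poly \<omega> f) (part_constraints \<omega> g m) k"

end

(*
  The constraints g j have degree at most m, so they are polynomials in the first m elementary
  symmetric functions. As their zero set has codimension m, these functions take finitely many values
  on it: otherwise the finite quotient map of the symmetric group would allow one to lift a chain of
  irreducible closed sets that is too long. For m >= 2 we have r <= m, hence the weighted power sums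
  of degree up to r are bounded on the complex zero set of the constraints belonging to a partition
  omega; since omega has positive entries, this zero set is itself bounded. By the Nullstellensatz
  each variable is then algebraic modulo the constraint ideal. A functional that is feasible at a high
  level vanishes on the real radical of that ideal, as far as a prescribed finite set of polynomials is
  concerned, so Lagrange interpolation on a finite real grid shows that its value at the objective is
  at least the minimum over the real zero set. Finally, the half-degree principle says that the
  infimum is not changed by restricting to points with at most r distinct coordinates.
*)

theory Submission
  imports Defs "HOL-Analysis.Analysis" "HOL-Computational_Algebra.Fundamental_Theorem_Algebra"
begin

section \<open>Polynomials and polynomial functions\<close>

text \<open>The codimension is used only through \<open>m \<le> n\<close>, the nonemptiness of the
  complex variety, and the absence of chains of irreducible closed subsets with more than
  \<open>n - m\<close> inclusions. The constraints see only the first \<open>m\<close> elementary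
  symmetric functions, so the other \<open>n - m\<close> coordinates of the quotient can be freed
  one at a time; an infinite zero set in the first \<open>m\<close> would supply one inclusion more.
  A Nullstellensatz resting on the uncountability of the complex numbers, together with Zorn's
  lemma, takes the place of dimension theory and chain conditions.

  A functional of level \<open>k\<close> is controlled only in degrees up to \<open>2 * k\<close>,
  whereas ideals need multipliers of every degree. Speaking, by means of a filter, of what holds for
  all feasible functionals of all sufficiently high levels absorbs these bounds.

  The entry 2 in \<open>r\<close> fixes the sum of squares in the half-degree argument and so makes
  it compact. Its price is that \<open>r\<close> exceeds \<open>m\<close> for
  \<open>m \<le> 1\<close>: there the power sums of degree 2 escape control, and explicit
  certificates replace the grid.\<close>

definition monom_val :: "(nat \<Rightarrow> 'b::comm_semiring_1) \<Rightarrow> (nat \<Rightarrow>\<^sub>0 nat) \<Rightarrow> 'b" where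
  "monom_val x \<alpha> = (\<Prod>i\<in>Poly_Mapping.keys \<alpha>. x i ^ Poly_Mapping.lookup \<alpha> i)"

lemma monom_val_superset:
  assumes "finite A" "Poly_Mapping.keys \<alpha> \<subseteq> A"
  shows "monom_val x \<alpha> = (\<Prod>i\<in>A. x i ^ Poly_Mapping.lookup \<alpha> i)"
  unfolding monom_val_def using assms
  by (intro prod.mono_neutral_left) (auto simp: in_keys_iff)

lemma monom_val_0 [simp]: "monom_val x 0 = 1"
  by (simp add: monom_val_def)

lemma monom_val_add: "monom_val x (\<alpha> + \<beta>) = monom_val x \<alpha> * monom_val x \<beta>"
proof -
  let ?A = "Poly_Mapping.keys \<alpha> \<union> Poly_Mapping.keys \<beta>"
  have "monom_val x (\<alpha> + \<beta>) = (\<Prod>i\<in>?A. x i ^ Poly_Mapping.lookup (\<alpha> + \<beta>) i)"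
    by (rule monom_val_superset) (use keys_add[of \<alpha> \<beta>] in auto)
  also have "\<dots> = (\<Prod>i\<in>?A. x i ^ Poly_Mapping.lookup \<alpha> i) * (\<Prod>i\<in>?A. x i ^ Poly_Mapping.lookup \<beta> i)"
    by (simp add: lookup_add power_add prod.distrib)
  also have "\<dots> = monom_val x \<alpha> * monom_val x \<beta>"
    by (subst (1 2) monom_val_superset[of ?A]) auto
  finally show ?thesis .
qed

lemma monom_val_single: "monom_val x (Poly_Mapping.single i k) = x i ^ k"
  by (cases "k = 0") (auto simp: monom_val_def)

text \<open>Real polynomials have to be evaluated at complex points as well, so the evaluation laws
  are proved once for any homomorphism of coefficients.\<close>

locale coeff_hom =
  fixes h :: "'a::comm_semiring_1 \<Rightarrow> 'b::comm_semiring_1"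
  assumes h_0: "h 0 = 0" and h_1: "h 1 = 1"
    and h_add: "h (a + b) = h a + h b" and h_mult: "h (a * b) = h a * h b"
begin

lemma eval_superset:
  assumes "finite A" "Poly_Mapping.keys p \<subseteq> A"
  shows "mpoly_eval h x p = (\<Sum>\<alpha>\<in>A. h (Poly_Mapping.lookup p \<alpha>) * monom_val x \<alpha>)"
  unfolding mpoly_eval_def monom_val_def[symmetric] using assms
  by (intro sum.mono_neutral_left) (auto simp: in_keys_iff h_0)

lemma eval_0 [simp]: "mpoly_eval h x 0 = 0"
  by (simp add: mpoly_eval_def)

lemma eval_add: "mpoly_eval h x (p + q) = mpoly_eval h x p + mpoly_eval h x q"
proof -
  let ?A = "Poly_Mapping.keys p \<union> Poly_Mapping.keys q"
  have "mpoly_eval h x (p + q) = (\<Sum>\<alpha>\<in>?A. h (Poly_Mapping.lookup (p + q) \<alpha>) * monom_val x \<alpha>)"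
    by (rule eval_superset) (use keys_add[of p q] in auto)
  also have "\<dots> = (\<Sum>\<alpha>\<in>?A. h (Poly_Mapping.lookup p \<alpha>) * monom_val x \<alpha>) +
      (\<Sum>\<alpha>\<in>?A. h (Poly_Mapping.lookup q \<alpha>) * monom_val x \<alpha>)"
    by (simp add: lookup_add h_add distrib_right sum.distrib)
  also have "\<dots> = mpoly_eval h x p + mpoly_eval h x q"
    by (subst (1 2) eval_superset[of ?A]) auto
  finally show ?thesis .
qed

lemma eval_sum: "mpoly_eval h x (\<Sum>i\<in>I. P i) = (\<Sum>i\<in>I. mpoly_eval h x (P i))"
  by (induction I rule: infinite_finite_induct) (auto simp: eval_add)

lemma eval_single: "mpoly_eval h x (Poly_Mapping.single \<alpha> c) = h c * monom_val x \<alpha>"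
  by (cases "c = 0") (auto simp: mpoly_eval_def monom_val_def h_0)

end

lemma poly_mapping_sum_single:
  fixes p :: "'k \<Rightarrow>\<^sub>0 'a::comm_monoid_add"
  shows "(\<Sum>\<alpha>\<in>Poly_Mapping.keys p. Poly_Mapping.single \<alpha> (Poly_Mapping.lookup p \<alpha>)) = p"
  by (rule poly_mapping_eqI)
     (auto simp: lookup_sum lookup_single when_def in_keys_iff)

context coeff_hom begin

lemma eval_mult: "mpoly_eval h x (p * q) = mpoly_eval h x p * mpoly_eval h x q"
proof -
  let ?s = "\<lambda>p. (\<Sum>\<alpha>\<in>Poly_Mapping.keys p. Poly_Mapping.single \<alpha> (Poly_Mapping.lookup p \<alpha>))"
  have "mpoly_eval h x (?s p * ?s q) = mpoly_eval h x (?s p) * mpoly_eval h x (?s q)"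
    by (simp add: sum_product eval_sum eval_single mult_single h_mult monom_val_add ac_simps)
  thus ?thesis by (simp add: poly_mapping_sum_single)
qed

lemma eval_1 [simp]: "mpoly_eval h x 1 = 1"
  using eval_single[of x 0 1] by (simp add: h_1)

lemma eval_Const [simp]: "mpoly_eval h x (Const c) = h c"
  by (simp add: Const_def eval_single)

lemma eval_Var [simp]: "mpoly_eval h x (Var i) = x i"
  by (simp add: Var_def eval_single monom_val_single h_1)

lemma eval_prod: "mpoly_eval h x (\<Prod>i\<in>I. P i) = (\<Prod>i\<in>I. mpoly_eval h x (P i))"
  by (induction I rule: infinite_finite_induct) (auto simp: eval_mult)

lemma eval_power: "mpoly_eval h x (p ^ k) = mpoly_eval h x p ^ k"
  by (induction k) (auto simp: eval_mult)

lemma eval_substitute: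
  "mpoly_eval h x (substitute p \<sigma>) = mpoly_eval h (\<lambda>i. mpoly_eval h x (\<sigma> i)) p"
  by (simp add: mpoly_eval_def[of _ _ p] mpoly_eval_def[of Const] eval_sum eval_mult eval_prod eval_power)

lemma eval_symmetric:
  assumes "symmetric_poly n p" "\<pi> permutes {..<n}"
  shows "mpoly_eval h (x \<circ> \<pi>) p = mpoly_eval h x p"
proof -
  have "mpoly_eval h x p = mpoly_eval h x (substitute p (\<lambda>i. Var (\<pi> i)))"
    using assms by (simp add: symmetric_poly_def)
  thus ?thesis by (simp add: eval_substitute o_def)
qed

lemma eval_part_poly:
  "mpoly_eval h t (part_poly \<omega> p) = mpoly_eval h (\<lambda>i. t (blocks \<omega> ! i)) p"
  by (simp add: part_poly_def eval_substitute)

end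

interpretation id_hom: coeff_hom "\<lambda>c::'a::comm_semiring_1. c"
  by (rule coeff_hom.intro) (rule refl)+

interpretation complex_hom: coeff_hom complex_of_real
  by (rule coeff_hom.intro) (rule of_real_0 of_real_1 of_real_add of_real_mult)+

section \<open>Polynomials in the first \<open>n\<close> variables\<close>

lemma eval_cong:
  assumes "p \<in> poly_ring n" "\<And>i. i < n \<Longrightarrow> x i = y i"
  shows "mpoly_eval h x p = mpoly_eval h y p"
  unfolding mpoly_eval_def
proof (intro sum.cong refl arg_cong2[where f = "(*)"] prod.cong)
  fix \<alpha> i assume "\<alpha> \<in> Poly_Mapping.keys p" "i \<in> Poly_Mapping.keys \<alpha>"
  thus "x i ^ Poly_Mapping.lookup \<alpha> i = y i ^ Poly_Mapping.lookup \<alpha> i"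
    using assms(1) by (subst assms(2)) (auto simp: poly_ring_def)
qed

lemma poly_ring_Const [simp]: "Const c \<in> poly_ring n"
  by (cases "c = 0") (auto simp: poly_ring_def Const_def)

lemma poly_ring_0 [simp]: "0 \<in> poly_ring n" and poly_ring_1 [simp]: "1 \<in> poly_ring n"
  by (auto simp: poly_ring_def)

lemma poly_ring_Var [simp]: "i < n \<Longrightarrow> (Var i :: 'a::zero_neq_one mpoly) \<in> poly_ring n"
  by (auto simp: poly_ring_def Var_def)

lemma poly_ring_add [simp]: "p \<in> poly_ring n \<Longrightarrow> q \<in> poly_ring n \<Longrightarrow> p + q \<in> poly_ring n"
  using keys_add[of p q] by (fastforce simp: poly_ring_def)

lemma poly_ring_mult [simp]: "p \<in> poly_ring n \<Longrightarrow> q \<in> poly_ring n \<Longrightarrow> p * q \<in> poly_ring n"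
proof -
  have "i < n" if A: "\<forall>\<alpha>\<in>Poly_Mapping.keys p. Poly_Mapping.keys \<alpha> \<subseteq> {..<n}"
    "\<forall>\<alpha>\<in>Poly_Mapping.keys q. Poly_Mapping.keys \<alpha> \<subseteq> {..<n}"
    "\<gamma> \<in> Poly_Mapping.keys (p * q)" "i \<in> Poly_Mapping.keys \<gamma>" for \<gamma> i
  proof -
    obtain \<alpha> \<beta> where "\<gamma> = \<alpha> + \<beta>" "\<alpha> \<in> Poly_Mapping.keys p" "\<beta> \<in> Poly_Mapping.keys q"
      using A(3) keys_mult[of p q] by blast
    thus "i < n" using A keys_add[of \<alpha> \<beta>] by blast
  qed
  thus "p \<in> poly_ring n \<Longrightarrow> q \<in> poly_ring n \<Longrightarrow> p * q \<in> poly_ring n"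
    unfolding poly_ring_def by blast
qed

lemma poly_ring_uminus [simp]: "(p :: 'a::ab_group_add mpoly) \<in> poly_ring n \<Longrightarrow> - p \<in> poly_ring n"
  by (simp add: poly_ring_def in_keys_iff)

lemma poly_ring_power [simp]: "p \<in> poly_ring n \<Longrightarrow> p ^ k \<in> poly_ring n"
  by (induction k) auto

lemma poly_ring_sum: "(\<And>i. i \<in> I \<Longrightarrow> P i \<in> poly_ring n) \<Longrightarrow> (\<Sum>i\<in>I. P i) \<in> poly_ring n"
  by (induction I rule: infinite_finite_induct) auto

lemma poly_ring_prod: "(\<And>i. i \<in> I \<Longrightarrow> P i \<in> poly_ring n) \<Longrightarrow> (\<Prod>i\<in>I. P i) \<in> poly_ring n"
  by (induction I rule: infinite_finite_induct) auto

lemma poly_ring_substitute: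
  assumes "p \<in> poly_ring n" "\<And>i. i < n \<Longrightarrow> \<sigma> i \<in> poly_ring k"
  shows "substitute p \<sigma> \<in> poly_ring k"
  unfolding mpoly_eval_def
proof (intro poly_ring_sum poly_ring_mult poly_ring_prod poly_ring_power poly_ring_Const)
  fix \<alpha> i assume "\<alpha> \<in> Poly_Mapping.keys p" "i \<in> Poly_Mapping.keys \<alpha>"
  hence "i < n" using assms(1) by (auto simp: poly_ring_def)
  thus "\<sigma> i \<in> poly_ring k" by (rule assms)
qed

text \<open>Most of the development works with functions instead of coefficient maps: ring
  identities become pointwise ones, and induction on how a function is built replaces arguments
  about supports. Over the reals \<open>evaluate_inj\<close> leads back to polynomials.\<close>

inductive polyfun :: "nat \<Rightarrow> ((nat \<Rightarrow> 'a::comm_ring_1) \<Rightarrow> 'a) \<Rightarrow> bool" for n where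
  polyfun_const: "polyfun n (\<lambda>x. c)"
| polyfun_var: "i < n \<Longrightarrow> polyfun n (\<lambda>x. x i)"
| polyfun_add: "polyfun n F \<Longrightarrow> polyfun n G \<Longrightarrow> polyfun n (\<lambda>x. F x + G x)"
| polyfun_mult: "polyfun n F \<Longrightarrow> polyfun n G \<Longrightarrow> polyfun n (\<lambda>x. F x * G x)"

lemma polyfun_uminus: "polyfun n F \<Longrightarrow> polyfun n (\<lambda>x. - F x)"
  using polyfun_mult[OF polyfun_const[of n "-1"], of F] by simp

lemma polyfun_diff: "polyfun n F \<Longrightarrow> polyfun n G \<Longrightarrow> polyfun n (\<lambda>x. F x - G x)"
  using polyfun_add[OF _ polyfun_uminus, of n F G] by simp

lemma polyfun_power: "polyfun n F \<Longrightarrow> polyfun n (\<lambda>x. F x ^ k)"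
  by (induction k) (auto intro: polyfun_const polyfun_mult)

lemma polyfun_sum:
  "(\<And>i. i \<in> I \<Longrightarrow> polyfun n (F i)) \<Longrightarrow> polyfun n (\<lambda>x. \<Sum>i\<in>I. F i x)"
  by (induction I rule: infinite_finite_induct) (auto intro: polyfun_const polyfun_add)

lemma polyfun_prod:
  "(\<And>i. i \<in> I \<Longrightarrow> polyfun n (F i)) \<Longrightarrow> polyfun n (\<lambda>x. \<Prod>i\<in>I. F i x)"
  by (induction I rule: infinite_finite_induct) (auto intro: polyfun_const polyfun_mult)

lemmas polyfun_intros = polyfun_const polyfun_var polyfun_add polyfun_mult polyfun_uminus
  polyfun_diff polyfun_power polyfun_sum polyfun_prod

lemma polyfun_poly: "polyfun n F \<Longrightarrow> polyfun n (\<lambda>x. poly q (F x))"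
  by (induction q) (auto intro!: polyfun_intros)

lemma polyfun_compose:
  assumes "polyfun k F" "\<And>i. i < k \<Longrightarrow> polyfun n (\<lambda>x. G x i)"
  shows "polyfun n (\<lambda>x. F (G x))"
  using assms by (induction) (auto intro!: polyfun_intros)

lemma polyfun_cong:
  assumes "polyfun n F" "\<And>i. i < n \<Longrightarrow> x i = y i"
  shows "F x = F y"
  using assms by induction simp_all

lemma polyfun_mpoly_eval:
  assumes "p \<in> poly_ring n"
  shows "polyfun n (\<lambda>x. mpoly_eval h x p)"
  unfolding mpoly_eval_def using assms
  by (intro polyfun_intros) (auto simp: poly_ring_def)

lemma polyfun_imp_evaluate:
  assumes "polyfun n F"
  shows "\<exists>p\<in>poly_ring n. \<forall>x. evaluate p x = F x"
  using assms
proof induction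
  case (polyfun_const c)
  show ?case by (rule bexI[of _ "Const c"]) auto
next
  case (polyfun_var i)
  thus ?case by (intro bexI[of _ "Var i"]) auto
next
  case (polyfun_add F G)
  then obtain p q where "p \<in> poly_ring n" "q \<in> poly_ring n"
    "\<And>x. evaluate p x = F x" "\<And>x. evaluate q x = G x" by auto
  thus ?case by (intro bexI[of _ "p + q"]) (auto simp: id_hom.eval_add)
next
  case (polyfun_mult F G)
  then obtain p q where "p \<in> poly_ring n" "q \<in> poly_ring n"
    "\<And>x. evaluate p x = F x" "\<And>x. evaluate q x = G x" by auto
  thus ?case by (intro bexI[of _ "p * q"]) (auto simp: id_hom.eval_mult)
qed

text \<open>Kronecker's substitution \<open>x i = s ^ (B ^ i)\<close> reduces to one variable.\<close>

lemma digits_unique: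
  fixes a b :: "nat \<Rightarrow> nat"
  assumes "\<And>i. i < n \<Longrightarrow> a i < B" "\<And>i. i < n \<Longrightarrow> b i < B"
    and "(\<Sum>i<n. a i * B ^ i) = (\<Sum>i<n. b i * B ^ i)" and "i < n"
  shows "a i = b i"
  using assms
proof (induction n arbitrary: i)
  case (Suc n)
  have small: "(\<Sum>i<k. c i * B ^ i) < B ^ k" if "\<And>i. i < k \<Longrightarrow> c i < B" for c k
    using that
  proof (induction k)
    case (Suc k)
    have "(\<Sum>i<Suc k. c i * B ^ i) < B ^ k + c k * B ^ k" using Suc by simp
    also have "\<dots> = Suc (c k) * B ^ k" by simp
    also have "\<dots> \<le> B * B ^ k" using Suc.prems[of k] by (intro mult_right_mono) auto
    finally show ?case by simp
  qed simp
  have "((\<Sum>i<n. c i * B ^ i) + c n * B ^ n) div B ^ n = c n"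
    "((\<Sum>i<n. c i * B ^ i) + c n * B ^ n) mod B ^ n = (\<Sum>i<n. c i * B ^ i)"
    if "\<And>i. i < Suc n \<Longrightarrow> c i < B" for c
  proof -
    have "(\<Sum>i<n. c i * B ^ i) < B ^ n" using small[of n c] that by auto
    moreover from this have "B ^ n \<noteq> 0" by linarith
    ultimately show "((\<Sum>i<n. c i * B ^ i) + c n * B ^ n) div B ^ n = c n"
      "((\<Sum>i<n. c i * B ^ i) + c n * B ^ n) mod B ^ n = (\<Sum>i<n. c i * B ^ i)"
      by auto
  qed
  note * = this(1)[of a, OF Suc.prems(1)] this(1)[of b, OF Suc.prems(2)]
    this(2)[of a, OF Suc.prems(1)] this(2)[of b, OF Suc.prems(2)]
  have E: "(\<Sum>i<n. a i * B ^ i) + a n * B ^ n = (\<Sum>i<n. b i * B ^ i) + b n * B ^ n"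
    using Suc.prems(3) by simp
  have "a n = b n" "(\<Sum>i<n. a i * B ^ i) = (\<Sum>i<n. b i * B ^ i)"
    using * unfolding E by auto
  thus ?case using Suc.IH[of i] Suc.prems by (cases "i = n") auto
qed simp

lemma evaluate_eq_0_imp:
  fixes p :: "real mpoly"
  assumes "p \<in> poly_ring n" "\<And>x. evaluate p x = 0"
  shows "p = 0"
proof -
  let ?K = "Poly_Mapping.keys p"
  \<comment> \<open>\<open>B\<close> exceeds every exponent occurring in \<open>p\<close>, so
    distinct exponent vectors are distinct base-\<open>B\<close> numbers and the substitution merges
    no coefficients.\<close>
  define B where "B = Suc (\<Sum>\<alpha>\<in>?K. \<Sum>i<n. Poly_Mapping.lookup \<alpha> i)"
  have small: "Poly_Mapping.lookup \<alpha> i < B" if "\<alpha> \<in> ?K" "i < n" for \<alpha> i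
  proof -
    have "Poly_Mapping.lookup \<alpha> i \<le> (\<Sum>i<n. Poly_Mapping.lookup \<alpha> i)"
      using that by (intro member_le_sum) auto
    also have "\<dots> \<le> (\<Sum>\<alpha>\<in>?K. \<Sum>i<n. Poly_Mapping.lookup \<alpha> i)"
      using that by (intro member_le_sum[of \<alpha> ?K "\<lambda>\<alpha>. \<Sum>i<n. Poly_Mapping.lookup \<alpha> i"]) auto
    finally show ?thesis by (simp add: B_def)
  qed
  define \<phi> where "\<phi> \<alpha> = (\<Sum>i<n. Poly_Mapping.lookup \<alpha> i * B ^ i)" for \<alpha> :: "nat \<Rightarrow>\<^sub>0 nat"
  have inj: "\<alpha> = \<beta>" if "\<alpha> \<in> ?K" "\<beta> \<in> ?K" "\<phi> \<alpha> = \<phi> \<beta>" for \<alpha> \<beta>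
  proof (rule poly_mapping_eqI)
    fix i
    show "Poly_Mapping.lookup \<alpha> i = Poly_Mapping.lookup \<beta> i"
    proof (cases "i < n")
      case True
      show ?thesis
        by (rule digits_unique[of n _ B]) (use that True small in \<open>auto simp: \<phi>_def\<close>)
    next
      case False
      hence "i \<notin> Poly_Mapping.keys \<alpha>" "i \<notin> Poly_Mapping.keys \<beta>"
        using that assms by (auto simp: poly_ring_def)
      thus ?thesis by (simp add: in_keys_iff)
    qed
  qed
  define P where "P = (\<Sum>\<alpha>\<in>?K. monom (Poly_Mapping.lookup p \<alpha>) (\<phi> \<alpha>))"
  have "poly P s = evaluate p (\<lambda>i. s ^ (B ^ i))" for s
  proof -
    have "monom_val (\<lambda>i. s ^ (B ^ i)) \<alpha> = s ^ \<phi> \<alpha>" if "\<alpha> \<in> ?K" for \<alpha>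
    proof -
      have "monom_val (\<lambda>i. s ^ (B ^ i)) \<alpha> = (\<Prod>i<n. (s ^ (B ^ i)) ^ Poly_Mapping.lookup \<alpha> i)"
        using that assms by (intro monom_val_superset) (auto simp: poly_ring_def)
      thus ?thesis by (simp add: \<phi>_def power_sum mult.commute flip: power_mult)
    qed
    thus ?thesis
      by (simp add: P_def poly_sum poly_monom mpoly_eval_def monom_val_def[symmetric])
  qed
  hence "P = 0" using assms by (simp add: poly_eq_poly_eq_iff[symmetric] fun_eq_iff)
  have "Poly_Mapping.lookup p \<alpha> = 0" if "\<alpha> \<in> ?K" for \<alpha>
  proof -
    have "0 = coeff P (\<phi> \<alpha>)" using \<open>P = 0\<close> by simp
    also have "\<dots> = (\<Sum>\<beta>\<in>?K. if \<beta> = \<alpha> then Poly_Mapping.lookup p \<beta> else 0)"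
      unfolding P_def coeff_sum by (intro sum.cong) (use inj that in auto)
    also have "\<dots> = Poly_Mapping.lookup p \<alpha>" using that by simp
    finally show ?thesis by simp
  qed
  thus ?thesis by (metis lookup_not_eq_zero_eq_in_keys lookup_zero poly_mapping_eqI)
qed

lemma evaluate_inj:
  fixes p q :: "real mpoly"
  assumes "p \<in> poly_ring n" "q \<in> poly_ring n" "\<And>x. evaluate p x = evaluate q x"
  shows "p = q"
proof -
  \<comment> \<open>\<open>coeff_hom\<close> provides semiring laws only; the value of
    \<open>- q\<close> is therefore cancelled through \<open>q + - q\<close>.\<close>
  have "evaluate (p + - q) x = 0" for x
  proof -
    have "evaluate (q + - q) x = 0" by simp
    thus ?thesis using assms(3)[of x] unfolding id_hom.eval_add by simp
  qed
  hence "p + - q = 0"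
    using assms by (intro evaluate_eq_0_imp[of _ n] poly_ring_add poly_ring_uminus)
  thus ?thesis by simp
qed


section \<open>Symmetric polynomials\<close>

text \<open>These are the elementary symmetric functions with sign \<open>(- 1) ^ j\<close>. With
  the sign included they are also the coefficients, read from the top, of the monic polynomial with
  roots \<open>x i\<close>.\<close>

definition signed_esym :: "nat \<Rightarrow> (nat \<Rightarrow> 'a::comm_ring_1) \<Rightarrow> nat \<Rightarrow> 'a" where
  "signed_esym n x j = coeff (\<Prod>i<n. [:1, - x i:]) j"

definition power_sum :: "nat \<Rightarrow> (nat \<Rightarrow> 'a::comm_ring_1) \<Rightarrow> nat \<Rightarrow> 'a" where
  "power_sum n x k = (\<Sum>i<n. x i ^ k)"

lemma signed_esym_0 [simp]: "signed_esym n x 0 = 1"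
  unfolding signed_esym_def by (induction n) (auto simp: coeff_mult)

lemma signed_esym_Suc: "signed_esym (Suc n) x (Suc j) = signed_esym n x (Suc j) - x n * signed_esym n x j"
proof -
  have "coeff (p * [:1, - x n:]) (Suc j) = coeff p (Suc j) - x n * coeff p j" for p
    by (simp add: mult_pCons_right)
  thus ?thesis by (simp add: signed_esym_def)
qed

lemma signed_esym_eq_0: "j > n \<Longrightarrow> signed_esym n x j = 0"
proof (induction n arbitrary: j)
  case 0
  thus ?case by (simp add: signed_esym_def)
next
  case (Suc n)
  thus ?case by (cases j) (auto simp: signed_esym_Suc)
qed

text \<open>Newton's identities by induction on the number of variables: a new variable
  \<open>y\<close> adds \<open>y ^ j\<close> to the power sums and subtracts \<open>y\<close> times
  the preceding coefficient, and the terms in higher powers of \<open>y\<close> telescope.\<close>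

lemma newton_identity:
  "of_nat (Suc k) * signed_esym n x (Suc k) = - (\<Sum>j\<le>k. power_sum n x (Suc j) * signed_esym n x (k - j))"
proof (induction n arbitrary: k)
  case 0
  show ?case by (simp add: signed_esym_eq_0 power_sum_def)
next
  case (Suc n)
  let ?e = "signed_esym n x" and ?p = "power_sum n x" and ?y = "x n"
  \<comment> \<open>The case distinction is there because the coefficient of index 0, reached for
    \<open>j = k\<close>, is constantly 1 and receives no correction.\<close>
  have e: "signed_esym (Suc n) x (k - j) = ?e (k - j) - (if j < k then ?y * ?e (k - 1 - j) else 0)" if "j \<le> k" for j
  proof (cases "j < k")
    case True
    then obtain i where i: "k - j = Suc i" by (metis Suc_diff_Suc)
    hence "k - 1 - j = i" by simp
    thus ?thesis using True by (simp add: i signed_esym_Suc)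
  qed (use that in auto)
  have "(\<Sum>j\<le>k. power_sum (Suc n) x (Suc j) * signed_esym (Suc n) x (k - j))
      = (\<Sum>j\<le>k. (?p (Suc j) + ?y ^ Suc j) * (?e (k - j) - (if j < k then ?y * ?e (k - 1 - j) else 0)))"
    by (intro sum.cong refl) (simp add: e power_sum_def)
  also have "\<dots> = (\<Sum>j\<le>k. ?p (Suc j) * ?e (k - j)) - (\<Sum>j\<le>k. if j < k then ?y * (?p (Suc j) * ?e (k - 1 - j)) else 0)
      + (\<Sum>j\<le>k. ?y ^ Suc j * ?e (k - j)) - (\<Sum>j\<le>k. if j < k then ?y ^ Suc (Suc j) * ?e (k - 1 - j) else 0)"
    unfolding sum.distrib[symmetric] sum_subtractf[symmetric]
    by (intro sum.cong refl) (auto simp: algebra_simps)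
  also have "(\<Sum>j\<le>k. if j < k then ?y * (?p (Suc j) * ?e (k - 1 - j)) else 0) = - ?y * (of_nat k * ?e k)"
  proof (cases k)
    case (Suc k')
    have "(\<Sum>j\<le>k. if j < k then ?y * (?p (Suc j) * ?e (k - 1 - j)) else 0) = ?y * (\<Sum>j\<le>k'. ?p (Suc j) * ?e (k' - j))"
      unfolding sum_distrib_left Suc by (simp add: less_Suc_eq_le)
    also have "(\<Sum>j\<le>k'. ?p (Suc j) * ?e (k' - j)) = - (of_nat k * ?e k)"
      using Suc.IH[of k'] Suc by simp
    finally show ?thesis by simp
  qed simp
  also have "(\<Sum>j\<le>k. ?y ^ Suc j * ?e (k - j)) = ?y * ?e k + (\<Sum>j\<le>k. if j < k then ?y ^ Suc (Suc j) * ?e (k - 1 - j) else 0)"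
  proof (cases k)
    case (Suc k')
    show ?thesis unfolding Suc
      by (subst sum.atMost_Suc_shift) (simp add: less_Suc_eq_le)
  qed simp
  also have "(\<Sum>j\<le>k. ?p (Suc j) * ?e (k - j)) = - (of_nat (Suc k) * ?e (Suc k))"
    using Suc.IH[of k] by simp
  finally show ?case by (simp add: signed_esym_Suc algebra_simps)
qed

text \<open>The unknown \<open>e j\<close> has weight \<open>j\<close>, the weight of the elementary symmetric function it stands for.\<close>

inductive weighted_poly :: "nat \<Rightarrow> ((nat \<Rightarrow> 'a::comm_ring_1) \<Rightarrow> 'a) \<Rightarrow> bool" where
  weighted_const: "weighted_poly d (\<lambda>e. c)"
| weighted_var: "1 \<le> j \<Longrightarrow> j \<le> d \<Longrightarrow> weighted_poly d (\<lambda>e. e j)"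
| weighted_add: "weighted_poly d F \<Longrightarrow> weighted_poly d G \<Longrightarrow> weighted_poly d (\<lambda>e. F e + G e)"
| weighted_mult: "weighted_poly a F \<Longrightarrow> weighted_poly b G \<Longrightarrow> a + b \<le> d \<Longrightarrow> weighted_poly d (\<lambda>e. F e * G e)"

lemma weighted_poly_mono: "weighted_poly d F \<Longrightarrow> d \<le> d' \<Longrightarrow> weighted_poly d' F"
  by (induction rule: weighted_poly.induct) (auto intro: weighted_poly.intros)

lemma weighted_poly_cong:
  assumes "weighted_poly d F" "\<And>j. 1 \<le> j \<Longrightarrow> j \<le> d \<Longrightarrow> e j = e' j"
  shows "F e = F e'"
  using assms by (induction rule: weighted_poly.induct) auto

text \<open>In weighted degree at most \<open>2 * r + 1\<close> no monomial contains two unknowns of weight above \<open>r\<close>.\<close>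

lemma weighted_poly_affine:
  fixes F :: "(nat \<Rightarrow> 'a::comm_ring_1) \<Rightarrow> 'a"
  assumes "weighted_poly d F" "d \<le> 2 * r + 1" "\<And>j. j \<le> r \<Longrightarrow> v j = 0"
  shows "F (\<lambda>j. e j + v j) + F (\<lambda>j. e j - v j) = 2 * F e"
  using assms
proof (induction rule: weighted_poly.induct)
  case (weighted_mult a F b G d)
  have const: "H (\<lambda>j. e j + v j) = H e \<and> H (\<lambda>j. e j - v j) = H e"
    if "weighted_poly c H" "c \<le> r" for c and H :: "(nat \<Rightarrow> 'a) \<Rightarrow> 'a"
    using weighted_poly_cong[OF that(1), of "\<lambda>j. e j + v j" e]
      weighted_poly_cong[OF that(1), of "\<lambda>j. e j - v j" e] that(2) weighted_mult.prems by auto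
  have IH: "F (\<lambda>j. e j + v j) + F (\<lambda>j. e j - v j) = 2 * F e"
    "G (\<lambda>j. e j + v j) + G (\<lambda>j. e j - v j) = 2 * G e"
    using weighted_mult by auto
  \<comment> \<open>Otherwise the product would have weight at least \<open>2 * r + 2\<close>. The
    factor of weight at most \<open>r\<close> does not notice the displacement \<open>v\<close>, and
    the other factor is handled by induction.\<close>
  have "a \<le> r \<or> b \<le> r" using weighted_mult by linarith
  thus ?case
  proof
    assume "a \<le> r"
    hence "F (\<lambda>j. e j + v j) = F e" "F (\<lambda>j. e j - v j) = F e" using const weighted_mult by blast+
    thus ?thesis using IH(2) by (metis distrib_left mult.left_commute)
  next
    assume "b \<le> r"
    hence "G (\<lambda>j. e j + v j) = G e" "G (\<lambda>j. e j - v j) = G e" using const weighted_mult by blast+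
    thus ?thesis using IH(1) by (metis distrib_right mult.assoc)
  qed
qed (auto simp: algebra_simps)

text \<open>Explicit forms in weight 0, 1 and 2, prepared for the exceptional cases
  \<open>m \<le> 1\<close>.\<close>

lemma weighted_poly_0: "weighted_poly d F \<Longrightarrow> d = 0 \<Longrightarrow> \<exists>c. \<forall>e. F e = c"
  using weighted_poly_cong[of d F _ "\<lambda>_. 0"] by (intro exI[of _ "F (\<lambda>_. 0)"]) auto

lemma weighted_poly_1: "weighted_poly d F \<Longrightarrow> d \<le> 1 \<Longrightarrow> \<exists>a b. \<forall>e. F e = a * e 1 + b"
proof (induction rule: weighted_poly.induct)
  case (weighted_const d c)
  thus ?case by (intro exI[of _ 0] exI[of _ c]) auto
next
  case (weighted_var j d)
  hence "j = 1" by simp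
  thus ?case by (intro exI[of _ 1] exI[of _ 0]) auto
next
  case (weighted_add d F G)
  then obtain a b a' b' where "\<And>e. F e = a * e 1 + b" "\<And>e. G e = a' * e 1 + b'" by metis
  thus ?case by (intro exI[of _ "a + a'"] exI[of _ "b + b'"]) (auto simp: algebra_simps)
next
  case (weighted_mult a F b G d)
  then obtain \<alpha> \<beta> \<gamma> \<delta> where *: "\<And>e. F e = \<alpha> * e 1 + \<beta>" "\<And>e. G e = \<gamma> * e 1 + \<delta>" by fastforce
  have "a = 0 \<or> b = 0" using weighted_mult by linarith
  thus ?case
  proof
    assume "a = 0"
    then obtain c where "\<And>e. F e = c" using weighted_poly_0 weighted_mult by metis
    thus ?thesis using * by (intro exI[of _ "c * \<gamma>"] exI[of _ "c * \<delta>"]) (auto simp: algebra_simps)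
  next
    assume "b = 0"
    then obtain c where "\<And>e. G e = c" using weighted_poly_0 weighted_mult by metis
    thus ?thesis using * by (intro exI[of _ "c * \<alpha>"] exI[of _ "c * \<beta>"]) (auto simp: algebra_simps)
  qed
qed

lemma weighted_poly_2:
  "weighted_poly d F \<Longrightarrow> d \<le> 2 \<Longrightarrow> \<exists>\<alpha> \<beta> \<gamma> \<delta>. \<forall>e. F e = \<alpha> * (e 1)\<^sup>2 + \<beta> * e 2 + \<gamma> * e 1 + \<delta>"
proof (induction rule: weighted_poly.induct)
  case (weighted_const d c)
  thus ?case by (intro exI[of _ 0] exI[of _ c]) auto
next
  case (weighted_var j d)
  hence "j = 1 \<or> j = 2" by auto
  thus ?case
  proof
    assume "j = 1"
    thus ?thesis by (intro exI[of _ 0] exI[of _ 0] exI[of _ 1] exI[of _ 0]) auto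
  next
    assume "j = 2"
    thus ?thesis by (intro exI[of _ 0] exI[of _ 1] exI[of _ 0] exI[of _ 0]) auto
  qed
next
  case (weighted_add d F G)
  then obtain a b c c' a' b' f f' where
    "\<And>e. F e = a * (e 1)\<^sup>2 + b * e 2 + c * e 1 + f" "\<And>e. G e = a' * (e 1)\<^sup>2 + b' * e 2 + c' * e 1 + f'" by metis
  thus ?case
    by (intro exI[of _ "a + a'"] exI[of _ "b + b'"] exI[of _ "c + c'"] exI[of _ "f + f'"]) (auto simp: algebra_simps)
next
  case (weighted_mult a F b G d)
  consider "a = 0" | "b = 0" | "a \<le> 1" "b \<le> 1" using weighted_mult by linarith
  thus ?case
  proof cases
    case 1
    then obtain k where k: "\<And>e. F e = k" using weighted_poly_0 weighted_mult by metis
    obtain \<alpha> \<beta> \<gamma> \<delta> where "\<And>e. G e = \<alpha> * (e 1)\<^sup>2 + \<beta> * e 2 + \<gamma> * e 1 + \<delta>" using weighted_mult by auto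
    thus ?thesis
      by (intro exI[of _ "k * \<alpha>"] exI[of _ "k * \<beta>"] exI[of _ "k * \<gamma>"] exI[of _ "k * \<delta>"]) (auto simp: algebra_simps k)
  next
    case 2
    then obtain k where k: "\<And>e. G e = k" using weighted_poly_0 weighted_mult by metis
    obtain \<alpha> \<beta> \<gamma> \<delta> where "\<And>e. F e = \<alpha> * (e 1)\<^sup>2 + \<beta> * e 2 + \<gamma> * e 1 + \<delta>" using weighted_mult by auto
    thus ?thesis
      by (intro exI[of _ "k * \<alpha>"] exI[of _ "k * \<beta>"] exI[of _ "k * \<gamma>"] exI[of _ "k * \<delta>"]) (auto simp: algebra_simps k)
  next
    case 3
    then obtain \<alpha> \<beta> \<gamma> \<delta> where "\<And>e. F e = \<alpha> * e 1 + \<beta>" "\<And>e. G e = \<gamma> * e 1 + \<delta>"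
      using weighted_poly_1 weighted_mult by metis
    thus ?thesis
      by (intro exI[of _ "\<alpha> * \<gamma>"] exI[of _ 0] exI[of _ "\<alpha> * \<delta> + \<beta> * \<gamma>"] exI[of _ "\<beta> * \<delta>"])
        (auto simp: algebra_simps power2_eq_square)
  qed
qed

section \<open>Expressing symmetric functions through the elementary ones\<close>

definition esym_expressible :: "nat \<Rightarrow> nat \<Rightarrow> ((nat \<Rightarrow> 'a::comm_ring_1) \<Rightarrow> 'a) \<Rightarrow> bool" where
  "esym_expressible n d f \<longleftrightarrow> (\<exists>\<Phi>. weighted_poly d \<Phi> \<and> (\<forall>x. f x = \<Phi> (signed_esym n x)))"

lemma esym_expressible_const: "esym_expressible n d (\<lambda>x. c)"
  unfolding esym_expressible_def by (rule exI[of _ "\<lambda>e. c"]) (auto intro: weighted_poly.intros)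

lemma esym_expressible_esym: "j \<le> d \<Longrightarrow> esym_expressible n d (\<lambda>x. signed_esym n x j)"
proof (cases "j = 0")
  case False
  assume "j \<le> d"
  thus ?thesis using False
    unfolding esym_expressible_def by (intro exI[of _ "\<lambda>e. e j"]) (auto intro: weighted_poly.intros)
qed (auto intro: esym_expressible_const)

lemma esym_expressible_add:
  assumes "esym_expressible n d f" "esym_expressible n d g"
  shows "esym_expressible n d (\<lambda>x. f x + g x)"
proof -
  from assms obtain \<Phi> \<Psi> where "weighted_poly d \<Phi>" "weighted_poly d \<Psi>"
    "\<forall>x. f x = \<Phi> (signed_esym n x)" "\<forall>x. g x = \<Psi> (signed_esym n x)" by (auto simp: esym_expressible_def)
  thus ?thesis unfolding esym_expressible_def
    by (intro exI[of _ "\<lambda>e. \<Phi> e + \<Psi> e"]) (auto intro: weighted_poly.intros)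
qed

lemma esym_expressible_mult:
  assumes "esym_expressible n a f" "esym_expressible n b g" "a + b \<le> d"
  shows "esym_expressible n d (\<lambda>x. f x * g x)"
proof -
  from assms obtain \<Phi> \<Psi> where "weighted_poly a \<Phi>" "weighted_poly b \<Psi>"
    "\<forall>x. f x = \<Phi> (signed_esym n x)" "\<forall>x. g x = \<Psi> (signed_esym n x)" by (auto simp: esym_expressible_def)
  thus ?thesis unfolding esym_expressible_def using assms
    by (intro exI[of _ "\<lambda>e. \<Phi> e * \<Psi> e"]) (auto intro: weighted_poly.intros)
qed

lemma esym_expressible_cmult:
  "esym_expressible n d f \<Longrightarrow> esym_expressible n d (\<lambda>x. c * f x)"
  using esym_expressible_mult[OF esym_expressible_const[of n 0 c], of d f d] by simp

lemma esym_expressible_sum: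
  "(\<And>i. i \<in> I \<Longrightarrow> esym_expressible n d (f i)) \<Longrightarrow> esym_expressible n d (\<lambda>x. \<Sum>i\<in>I. f i x)"
  by (induction I rule: infinite_finite_induct) (auto intro: esym_expressible_const esym_expressible_add)

text \<open>Newton's identity is solved for the last power sum, whose cofactor is the coefficient of
  index 0, that is 1; this works over any commutative ring.\<close>

lemma esym_expressible_power_sum:
  "esym_expressible n k (\<lambda>x :: nat \<Rightarrow> 'a::comm_ring_1. power_sum n x k)"
proof (induction k rule: less_induct)
  case (less k)
  show ?case
  proof (cases k)
    case 0
    thus ?thesis by (simp add: power_sum_def esym_expressible_const)
  next
    case (Suc k')
    have "power_sum n x k = (- of_nat k) * signed_esym n x k + (- 1) * (\<Sum>j<k'. power_sum n x (Suc j) * signed_esym n x (k' - j))"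
      for x :: "nat \<Rightarrow> 'a"
    proof -
      have "of_nat k * signed_esym n x k =
          - ((\<Sum>j<k'. power_sum n x (Suc j) * signed_esym n x (k' - j)) + power_sum n x k)"
        using newton_identity[of k' n x] unfolding Suc by (simp add: lessThan_Suc_atMost[symmetric])
      thus ?thesis by (simp only: mult_minus_left) simp
    qed
    moreover have "esym_expressible n k (\<lambda>x :: nat \<Rightarrow> 'a. (- of_nat k) * signed_esym n x k + (- 1) * (\<Sum>j<k'. power_sum n x (Suc j) * signed_esym n x (k' - j)))"
    proof (intro esym_expressible_add esym_expressible_cmult esym_expressible_sum esym_expressible_esym order.refl)
      fix j assume "j \<in> {..<k'}"
      thus "esym_expressible n k (\<lambda>x :: nat \<Rightarrow> 'a. power_sum n x (Suc j) * signed_esym n x (k' - j))"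
        using Suc by (intro esym_expressible_mult[OF less esym_expressible_esym, of "Suc j" "k' - j" "k' - j"]) auto
    qed
    ultimately show ?thesis by simp
  qed
qed

section \<open>Sums of monomials over injections\<close>

abbreviation injections :: "'i set \<Rightarrow> 'j set \<Rightarrow> ('i \<Rightarrow> 'j) set" where
  "injections I J \<equiv> {f \<in> I \<rightarrow>\<^sub>E J. inj_on f I}"

text \<open>An injection on \<open>insert c I\<close> is an injection \<open>f\<close> on
  \<open>I\<close> together with a value at \<open>c\<close> outside the range of \<open>f\<close>.
  The value at \<open>c\<close> is summed over all of \<open>J\<close>, and the coincidences with
  some \<open>f i\<close> are subtracted.\<close>

lemma sum_injections_insert:
  fixes w :: "('i \<Rightarrow> 'j) \<Rightarrow> 'a::comm_ring_1" and u :: "'j \<Rightarrow> 'a"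
  assumes "finite I" "finite J" "c \<notin> I" "\<And>f j. f \<in> injections I J \<Longrightarrow> j \<in> J \<Longrightarrow> w (f(c := j)) = v f * u j"
  shows "(\<Sum>f\<in>injections (insert c I) J. w f) =
    (\<Sum>f\<in>injections I J. v f) * (\<Sum>j\<in>J. u j) - (\<Sum>i\<in>I. \<Sum>f\<in>injections I J. v f * u (f i))"
proof -
  have fin: "finite (injections I J)"
    using assms by (auto intro!: finite_subset[OF _ finite_PiE[of I "\<lambda>_. J"]])
  have "(\<Sum>f\<in>injections (insert c I) J. w f) = (\<Sum>(f, j)\<in>Sigma (injections I J) (\<lambda>f. J - f ` I). v f * u j)"
  proof (rule sum.reindex_bij_witness[of _ "\<lambda>(f, j). f(c := j)" "\<lambda>f. (restrict f I, f c)"], goal_cases)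
    case (1 f)
    thus ?case using assms(3) by (auto simp: fun_eq_iff PiE_def extensional_def restrict_def)
  next
    case (2 f)
    thus ?case using assms(3) by (auto simp: PiE_def inj_on_def)
  next
    case (3 b)
    thus ?case using assms(3) by (auto simp: fun_eq_iff PiE_def extensional_def restrict_def)
  next
    case (4 b)
    then obtain f j where b: "b = (f, j)" "f \<in> I \<rightarrow>\<^sub>E J" "inj_on f I" "j \<in> J" "j \<notin> f ` I" by auto
    have "f(c := j) \<in> insert c I \<rightarrow>\<^sub>E J"
      using b PiE_fun_upd[of j "\<lambda>_. J" c f I] by simp
    moreover have "(f(c := j)) ` I = f ` I" using assms(3) by (intro image_cong) auto
    hence "inj_on (f(c := j)) (insert c I)"
      using b assms(3) by (simp add: inj_on_insert inj_on_fun_updI)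
    ultimately show ?case by (simp add: b)
  next
    case (5 f)
    have "restrict f I \<in> injections I J" "f c \<in> J" using 5 by (auto simp: inj_on_def)
    from assms(4)[OF this] have "w ((restrict f I)(c := f c)) = v (restrict f I) * u (f c)" .
    moreover have "(restrict f I)(c := f c) = f"
      using 5 by (auto simp: fun_eq_iff PiE_def extensional_def restrict_def)
    ultimately show ?case by simp
  qed
  also have "\<dots> = (\<Sum>f\<in>injections I J. \<Sum>j\<in>J - f ` I. v f * u j)"
    using fin assms by (subst sum.Sigma) auto
  also have "\<dots> = (\<Sum>f\<in>injections I J. v f * (\<Sum>j\<in>J. u j) - (\<Sum>i\<in>I. v f * u (f i)))"
  proof (intro sum.cong refl)
    fix f assume f: "f \<in> injections I J"
    hence "f ` I \<subseteq> J" by auto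
    hence "(\<Sum>j\<in>J - f ` I. v f * u j) = (\<Sum>j\<in>J. v f * u j) - (\<Sum>j\<in>f ` I. v f * u j)"
      using assms by (simp add: sum_diff finite_subset)
    also have "(\<Sum>j\<in>f ` I. v f * u j) = (\<Sum>i\<in>I. v f * u (f i))"
      using f by (subst sum.reindex) auto
    finally show "(\<Sum>j\<in>J - f ` I. v f * u j) = v f * (\<Sum>j\<in>J. u j) - (\<Sum>i\<in>I. v f * u (f i))"
      by (simp add: sum_distrib_left)
  qed
  also have "\<dots> = (\<Sum>f\<in>injections I J. v f) * (\<Sum>j\<in>J. u j) - (\<Sum>i\<in>I. \<Sum>f\<in>injections I J. v f * u (f i))"
    unfolding sum_subtractf by (subst (2) sum.swap) (simp add: sum_distrib_right)
  finally show ?thesis .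
qed

text \<open>In the recursion a coincidence of \<open>c\<close> with \<open>i\<close> merges the
  exponent of \<open>c\<close> into that of \<open>i\<close>, so one index disappears while the
  total weight stays the same. Since the exponents change, the induction is over all
  \<open>a\<close>.\<close>

lemma esym_expressible_injections:
  assumes "finite I"
  shows "esym_expressible n (\<Sum>i\<in>I. a i) (\<lambda>x :: nat \<Rightarrow> 'a::comm_ring_1. \<Sum>f\<in>injections I {..<n}. \<Prod>i\<in>I. x (f i) ^ a i)"
  using assms
proof (induction I arbitrary: a)
  case empty
  show ?case by (simp add: esym_expressible_const)
next
  case (insert c I)
  have eq: "(\<Sum>f\<in>injections (insert c I) {..<n}. \<Prod>i\<in>insert c I. x (f i) ^ a i) =
    (\<Sum>f\<in>injections I {..<n}. \<Prod>i\<in>I. x (f i) ^ a i) * power_sum n x (a c) +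
    (- 1) * (\<Sum>i\<in>I. \<Sum>f\<in>injections I {..<n}. \<Prod>k\<in>I. x (f k) ^ (a(i := a i + a c)) k)" for x :: "nat \<Rightarrow> 'a"
  proof -
    have "(\<Sum>f\<in>injections (insert c I) {..<n}. \<Prod>i\<in>insert c I. x (f i) ^ a i) =
      (\<Sum>f\<in>injections I {..<n}. \<Prod>i\<in>I. x (f i) ^ a i) * (\<Sum>j<n. x j ^ a c) -
      (\<Sum>i\<in>I. \<Sum>f\<in>injections I {..<n}. (\<Prod>i\<in>I. x (f i) ^ a i) * x (f i) ^ a c)"
    proof (rule sum_injections_insert)
      fix f j
      have "(\<Prod>i\<in>I. x ((f(c := j)) i) ^ a i) = (\<Prod>i\<in>I. x (f i) ^ a i)"
        using insert by (intro prod.cong) auto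
      thus "(\<Prod>i\<in>insert c I. x ((f(c := j)) i) ^ a i) = (\<Prod>i\<in>I. x (f i) ^ a i) * x j ^ a c"
        using insert by (simp add: mult.commute)
    qed (use insert in auto)
    moreover have "(\<Prod>k\<in>I. x (f k) ^ a k) * x (f i) ^ a c = (\<Prod>k\<in>I. x (f k) ^ (a(i := a i + a c)) k)" if "i \<in> I" for i f
    proof -
      have "(\<Prod>k\<in>I. x (f k) ^ (a(i := a i + a c)) k) = (\<Prod>k\<in>I. x (f k) ^ a k * (if k = i then x (f i) ^ a c else 1))"
        by (intro prod.cong) (auto simp: power_add)
      thus ?thesis using that insert by (simp add: prod.distrib)
    qed
    ultimately show ?thesis by (simp add: power_sum_def)
  qed
  show ?case unfolding eq
  proof (rule esym_expressible_add, goal_cases)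
    case 1
    show ?case
      using insert by (intro esym_expressible_mult[OF insert.IH esym_expressible_power_sum]) auto
  next
    case 2
    show ?case
    proof (rule esym_expressible_cmult, rule esym_expressible_sum)
    fix i assume "i \<in> I"
    hence "(\<Sum>k\<in>I. (a(i := a i + a c)) k) = (\<Sum>k\<in>insert c I. a k)"
      using insert by (simp add: sum.remove[of I i])
    thus "esym_expressible n (\<Sum>i\<in>insert c I. a i)
      (\<lambda>x :: nat \<Rightarrow> 'a. \<Sum>f\<in>injections I {..<n}. \<Prod>k\<in>I. x (f k) ^ (a(i := a i + a c)) k)"
      using insert.IH[of "a(i := a i + a c)"] by simp
    qed
  qed
qed

lemma total_degree_ge:
  assumes "p \<in> poly_ring n" "\<alpha> \<in> Poly_Mapping.keys p"
  shows "(\<Sum>i<n. Poly_Mapping.lookup \<alpha> i) \<le> total_degree p"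
proof -
  have "(\<Sum>i<n. Poly_Mapping.lookup \<alpha> i) = (\<Sum>i\<in>Poly_Mapping.keys \<alpha>. Poly_Mapping.lookup \<alpha> i)"
    using assms by (intro sum.mono_neutral_right) (auto simp: poly_ring_def in_keys_iff)
  thus ?thesis unfolding total_degree_def using assms by (intro Max_ge) auto
qed

text \<open>Averaging over all permutations reduces the claim to sums over injections.\<close>

lemma symmetric_esym_expressible:
  fixes h :: "'a::comm_ring_1 \<Rightarrow> 'b::field_char_0"
  assumes "p \<in> poly_ring n" "total_degree p \<le> d"
    and sym: "\<And>\<pi> x. \<pi> permutes {..<n} \<Longrightarrow> mpoly_eval h (x \<circ> \<pi>) p = mpoly_eval h x p"
  shows "esym_expressible n d (\<lambda>x. mpoly_eval h x p)"
proof -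
  let ?K = "Poly_Mapping.keys p" and ?S = "{\<pi>. \<pi> permutes {..<n}}" and ?l = "Poly_Mapping.lookup"
  have reindex: "(\<Sum>\<pi>\<in>?S. \<Prod>i<n. x (\<pi> i) ^ a i) = (\<Sum>f\<in>injections {..<n} {..<n}. \<Prod>i<n. x (f i) ^ a i)"
    for x :: "nat \<Rightarrow> 'b" and a
  proof (rule sum.reindex_bij_witness[of _ "\<lambda>f i. if i < n then f i else i" "\<lambda>\<pi>. restrict \<pi> {..<n}"], goal_cases)
    case (1 \<pi>)
    thus ?case by (auto simp: fun_eq_iff permutes_def)
  next
    case (2 \<pi>)
    hence "\<pi> permutes {..<n}" by simp
    thus ?case using permutes_in_image[of \<pi> "{..<n}"] by (auto simp: permutes_inj_on)
  next
    case (3 f)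
    thus ?case by (auto simp: fun_eq_iff PiE_def extensional_def)
  next
    case (4 f)
    hence inj: "inj_on f {..<n}" and "f ` {..<n} \<subseteq> {..<n}" by auto
    hence "bij_betw f {..<n} {..<n}" by (simp add: bij_betw_def endo_inj_surj)
    hence "bij_betw (\<lambda>i. if i < n then f i else i) {..<n} {..<n}"
      by (subst bij_betw_cong[of _ _ f]) auto
    thus ?case by (auto intro!: bij_imp_permutes split: if_splits)
  next
    case (5 \<pi>)
    show ?case by (intro prod.cong) auto
  qed
  have eval: "mpoly_eval h x p = (\<Sum>\<alpha>\<in>?K. h (?l p \<alpha>) * (\<Prod>i<n. x i ^ ?l \<alpha> i))" for x
    unfolding mpoly_eval_def monom_val_def[symmetric]
    using assms(1) by (intro sum.cong refl arg_cong2[where f = "(*)"] monom_val_superset) (auto simp: poly_ring_def)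
  have "of_nat (fact n) * mpoly_eval h x p = (\<Sum>\<alpha>\<in>?K. h (?l p \<alpha>) * (\<Sum>f\<in>injections {..<n} {..<n}. \<Prod>i<n. x (f i) ^ ?l \<alpha> i))" for x
  proof -
    have "of_nat (fact n) * mpoly_eval h x p = (\<Sum>\<pi>\<in>?S. mpoly_eval h (x \<circ> \<pi>) p)"
      using sym by (simp add: card_permutations[of _ n])
    also have "\<dots> = (\<Sum>\<alpha>\<in>?K. \<Sum>\<pi>\<in>?S. h (?l p \<alpha>) * (\<Prod>i<n. x (\<pi> i) ^ ?l \<alpha> i))"
      unfolding eval by (subst sum.swap) simp
    also have "\<dots> = (\<Sum>\<alpha>\<in>?K. h (?l p \<alpha>) * (\<Sum>f\<in>injections {..<n} {..<n}. \<Prod>i<n. x (f i) ^ ?l \<alpha> i))"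
      unfolding reindex[symmetric] by (simp add: sum_distrib_left)
    finally show ?thesis .
  qed
  hence eq: "mpoly_eval h x p = inverse (of_nat (fact n)) *
    (\<Sum>\<alpha>\<in>?K. h (?l p \<alpha>) * (\<Sum>f\<in>injections {..<n} {..<n}. \<Prod>i<n. x (f i) ^ ?l \<alpha> i))" for x
    by (simp add: field_simps)
  show ?thesis unfolding eq
  proof (rule esym_expressible_cmult, rule esym_expressible_sum, rule esym_expressible_cmult)
    fix \<alpha> assume "\<alpha> \<in> ?K"
    hence "(\<Sum>i<n. ?l \<alpha> i) \<le> d" using total_degree_ge[OF assms(1)] assms(2) order.trans by blast
    moreover have "esym_expressible n (\<Sum>i<n. ?l \<alpha> i) (\<lambda>x :: nat \<Rightarrow> 'b. \<Sum>f\<in>injections {..<n} {..<n}. \<Prod>i<n. x (f i) ^ ?l \<alpha> i)"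
      by (rule esym_expressible_injections) simp
    ultimately show "esym_expressible n d (\<lambda>x :: nat \<Rightarrow> 'b. \<Sum>f\<in>injections {..<n} {..<n}. \<Prod>i<n. x (f i) ^ ?l \<alpha> i)"
      unfolding esym_expressible_def using weighted_poly_mono by blast
  qed
qed


section \<open>The half-degree principle\<close>

lemma polyfun_mono: "polyfun k F \<Longrightarrow> k \<le> n \<Longrightarrow> polyfun n F"
  by (induction rule: polyfun.induct) (auto intro: polyfun_intros)

lemma polyfun_signed_esym: "polyfun n (\<lambda>x. signed_esym n x j)"
proof (induction n arbitrary: j)
  case 0
  show ?case by (cases j) (auto simp: signed_esym_eq_0 intro: polyfun_intros)
next
  case (Suc n)
  show ?case
    by (cases j) (auto simp: signed_esym_Suc intro!: polyfun_intros intro: polyfun_mono[OF Suc])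
qed

lemma weighted_poly_imp_polyfun:
  assumes "weighted_poly d \<Phi>" "\<And>j. polyfun n (\<lambda>x. G x j)"
  shows "polyfun n (\<lambda>x. \<Phi> (G x))"
  using assms by (induction) (auto intro: polyfun_intros)

lemma continuous_on_polyfun:
  fixes F :: "(nat \<Rightarrow> 'a::real_normed_field) \<Rightarrow> 'a"
  assumes "polyfun n F"
  shows "continuous_on S F"
  using assms
proof induction
  case (polyfun_var i)
  show ?case by (rule continuous_on_subset[OF continuous_on_product_coordinates]) auto
qed (auto intro!: continuous_intros)

text \<open>Points are total functions on the naturals; pinning the coordinates from
  \<open>n\<close> on to 0 makes the box compact by Tychonoff's theorem.\<close>

lemma compact_box:
  "compact {x :: nat \<Rightarrow> 'a::euclidean_space. \<forall>i. x i \<in> (if i < n then cball 0 R else {0})}"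
proof -
  have "compactin (product_topology (\<lambda>i. euclidean) UNIV)
    (PiE UNIV (\<lambda>i. if i < n then cball (0::'a) R else {0}))"
    by (subst compactin_PiE) (auto simp: compactin_euclidean_iff)
  thus ?thesis
    by (simp add: euclidean_product_topology compactin_euclidean_iff PiE_def Pi_def extensional_def)
qed

text \<open>The products of the \<open>[:1, - x i:]\<close> and of the \<open>[:- x i, 1:]\<close>
  are reflections of each other.\<close>

lemma coeff_prod_linear_factors:
  fixes x :: "nat \<Rightarrow> 'a::idom"
  assumes "j \<le> n"
  shows "coeff (\<Prod>i<n. [:- x i, 1:]) (n - j) = signed_esym n x j"
proof -
  let ?P = "\<Prod>i<n. [:- x i, 1:]"
  have deg: "degree ?P = n" by (subst degree_prod_sum_eq) auto
  have "reflect_poly [:- a, 1:] = [:1, - a:]" for a :: 'a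
    by (cases "a = 0") (auto simp: reflect_poly_def)
  hence "(\<Prod>i<n. [:1, - x i:]) = reflect_poly ?P" by (simp add: reflect_poly_prod)
  thus ?thesis using assms by (simp add: signed_esym_def coeff_reflect_poly deg)
qed

lemma monic_prod_linear:
  fixes \<rho> :: "'b \<Rightarrow> 'a::idom"
  assumes "finite D"
  shows "degree (\<Prod>a\<in>D. [:- \<rho> a, 1:]) = card D" "coeff (\<Prod>a\<in>D. [:- \<rho> a, 1:]) (card D) = 1"
proof -
  show deg: "degree (\<Prod>a\<in>D. [:- \<rho> a, 1:]) = card D" by (subst degree_prod_sum_eq) auto
  have "lead_coeff (\<Prod>a\<in>D. [:- \<rho> a, 1:]) = 1" by (simp add: lead_coeff_prod)
  thus "coeff (\<Prod>a\<in>D. [:- \<rho> a, 1:]) (card D) = 1" by (simp add: deg)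
qed

text \<open>Simple real roots are stable: the product changes sign across each point of
  \<open>D\<close>, and a small constant cannot undo this. The intermediate value theorem then gives
  a root in each of \<open>card D\<close> disjoint intervals, which exhausts the degree.\<close>

lemma perturb_distinct_roots:
  fixes D :: "real set"
  assumes D: "finite D" "D \<noteq> {}"
  shows "\<exists>\<delta>>0. \<forall>\<epsilon>. \<bar>\<epsilon>\<bar> < \<delta> \<longrightarrow> (\<exists>\<rho>. (\<Prod>a\<in>D. [:- a, 1:]) + [:\<epsilon>:] = (\<Prod>a\<in>D. [:- \<rho> a, 1:]))"
proof -
  let ?p = "\<Prod>a\<in>D. [:- a, 1:]"
  obtain \<eta> where \<eta>: "\<eta> > 0" "\<And>a b. a \<in> D \<Longrightarrow> b \<in> D \<Longrightarrow> a \<noteq> b \<Longrightarrow> 2 * \<eta> < \<bar>a - b\<bar>"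
  proof -
    \<comment> \<open>The entry 1 keeps the minimum defined when \<open>D\<close> has a single
      point; with \<open>\<eta> = M / 3\<close> the intervals of radius \<open>\<eta>\<close> are
      disjoint.\<close>
    define M where "M = Min (insert 1 ((\<lambda>(a, b). \<bar>a - b\<bar>) ` {(a, b) \<in> D \<times> D. a \<noteq> b}))"
    have fin: "finite ((\<lambda>(a, b). \<bar>a - b\<bar>) ` {(a, b) \<in> D \<times> D. a \<noteq> b})"
      using D by (intro finite_imageI finite_subset[OF _ finite_cartesian_product[of D D]]) auto
    have "M > 0" unfolding M_def using fin by (subst Min_gr_iff) auto
    moreover have "M \<le> \<bar>a - b\<bar>" if "a \<in> D" "b \<in> D" "a \<noteq> b" for a b
      unfolding M_def using fin that by (intro Min_le) auto
    ultimately show ?thesis using that[of "M / 3"] by fastforce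
  qed
  \<comment> \<open>The factors belonging to \<open>b\<close> at the two end points multiply to
    \<open>(a - b)\<^sup>2 - \<eta>\<^sup>2\<close>, which is negative only for
    \<open>b = a\<close>.\<close>
  have sign: "poly ?p (a - \<eta>) * poly ?p (a + \<eta>) < 0" if "a \<in> D" for a
  proof -
    have "poly ?p (a - \<eta>) * poly ?p (a + \<eta>) = (\<Prod>b\<in>D. (a - \<eta> - b) * (a + \<eta> - b))"
      by (simp add: poly_prod prod.distrib)
    also have "\<dots> = (\<Prod>b\<in>D. (a - b)\<^sup>2 - \<eta>\<^sup>2)"
      by (intro prod.cong) (auto simp: algebra_simps power2_eq_square)
    also have "\<dots> = - \<eta>\<^sup>2 * (\<Prod>b\<in>D - {a}. (a - b)\<^sup>2 - \<eta>\<^sup>2)"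
      using D that by (simp add: prod.remove[of D a])
    also have "\<dots> < 0"
    proof -
      have "0 < (a - b)\<^sup>2 - \<eta>\<^sup>2" if "b \<in> D - {a}" for b
      proof -
        have "\<eta> < \<bar>a - b\<bar>" using \<eta>(2)[of a b] \<eta>(1) \<open>a \<in> D\<close> that by auto
        hence "\<eta>\<^sup>2 < \<bar>a - b\<bar>\<^sup>2" using \<eta>(1) by (intro power_strict_mono) auto
        thus ?thesis by simp
      qed
      hence "0 < (\<Prod>b\<in>D - {a}. (a - b)\<^sup>2 - \<eta>\<^sup>2)" by (rule prod_pos)
      thus ?thesis using \<eta>(1) by (simp add: mult_pos_pos)
    qed
    finally show ?thesis .
  qed
  define \<delta> where "\<delta> = Min ((\<lambda>a. min \<bar>poly ?p (a - \<eta>)\<bar> \<bar>poly ?p (a + \<eta>)\<bar>) ` D)"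
  have "\<delta> > 0" unfolding \<delta>_def using D sign by (subst Min_gr_iff) (auto, force+)
  moreover have "\<exists>\<rho>. ?p + [:\<epsilon>:] = (\<Prod>a\<in>D. [:- \<rho> a, 1:])" if \<epsilon>: "\<bar>\<epsilon>\<bar> < \<delta>" for \<epsilon>
  proof -
    have "\<exists>x. a - \<eta> < x \<and> x < a + \<eta> \<and> poly (?p + [:\<epsilon>:]) x = 0" if "a \<in> D" for a
    proof -
      have "\<delta> \<le> min \<bar>poly ?p (a - \<eta>)\<bar> \<bar>poly ?p (a + \<eta>)\<bar>"
        unfolding \<delta>_def using D that by (intro Min_le) auto
      hence "\<bar>\<epsilon>\<bar> < \<bar>poly ?p (a - \<eta>)\<bar>" "\<bar>\<epsilon>\<bar> < \<bar>poly ?p (a + \<eta>)\<bar>" using \<epsilon> by auto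
      hence "(poly ?p (a - \<eta>) + \<epsilon>) * (poly ?p (a + \<eta>) + \<epsilon>) < 0"
        using sign[OF that] by (auto simp: mult_less_0_iff)
      hence "poly (?p + [:\<epsilon>:]) (a - \<eta>) * poly (?p + [:\<epsilon>:]) (a + \<eta>) < 0" by simp
      thus ?thesis using poly_IVT[of "a - \<eta>" "a + \<eta>" "?p + [:\<epsilon>:]"] \<eta>(1) by force
    qed
    then obtain \<rho> where \<rho>: "\<And>a. a \<in> D \<Longrightarrow> a - \<eta> < \<rho> a \<and> \<rho> a < a + \<eta> \<and> poly (?p + [:\<epsilon>:]) (\<rho> a) = 0"
      by metis
    have inj: "inj_on \<rho> D"
    proof
      fix a b assume *: "a \<in> D" "b \<in> D" "\<rho> a = \<rho> b"
      show "a = b"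
      proof (rule ccontr)
        assume "a \<noteq> b"
        thus False using \<eta>(2)[of a b] \<rho>[of a] \<rho>[of b] * by linarith
      qed
    qed
    have "?p + [:\<epsilon>:] = (\<Prod>a\<in>D. [:- \<rho> a, 1:])"
    proof (rule poly_eqI_degree_lead_coeff[of _ "card D" _ "\<rho> ` D"])
      have "card D > 0" using D by (simp add: card_gt_0_iff)
      thus "coeff (?p + [:\<epsilon>:]) (card D) = coeff (\<Prod>a\<in>D. [:- \<rho> a, 1:]) (card D)"
        using monic_prod_linear(2)[OF D(1), of "\<lambda>a. a"] monic_prod_linear(2)[OF D(1), of \<rho>]
        by (simp add: coeff_pCons split: nat.split)
      show "card D \<le> card (\<rho> ` D)" using inj by (simp add: card_image)
      show "degree (?p + [:\<epsilon>:]) \<le> card D"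
        using monic_prod_linear(1)[OF D(1), of "\<lambda>a. a"] by (intro degree_add_le) auto
      show "degree (\<Prod>a\<in>D. [:- \<rho> a, 1:]) \<le> card D" using monic_prod_linear(1)[OF D(1), of \<rho>] by simp
      fix z assume "z \<in> \<rho> ` D"
      then obtain a where "a \<in> D" "z = \<rho> a" by auto
      thus "poly (?p + [:\<epsilon>:]) z = poly (\<Prod>a\<in>D. [:- \<rho> a, 1:]) z"
        using \<rho>[of a] D by (auto simp: poly_prod)
    qed
    thus ?thesis by blast
  qed
  ultimately show ?thesis by blast
qed

text \<open>
  If \<open>z\<close> has more than \<open>r\<close> distinct entries, the points \<open>z'\<close> below realise both ends of a
  segment centred at the vector of coefficients belonging to \<open>z\<close> that fixes the first \<open>r\<close> of them.
\<close>

lemma perturb_esym: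
  fixes z :: "nat \<Rightarrow> real"
  assumes "r < card (z ` {..<n})" "0 < r"
  shows "\<exists>v. (\<forall>j\<le>r. v j = 0) \<and> (\<exists>j\<le>n. v j \<noteq> 0) \<and>
    (\<forall>s\<in>{-1, 1}. \<exists>z'. \<forall>j. signed_esym n z' j = signed_esym n z j + s * v j)"
proof -
  define D where "D = z ` {..<n}"
  have D: "finite D" "r < card D" using assms by (auto simp: D_def)
  hence "D \<noteq> {}" by auto
  have "card D \<le> n" unfolding D_def using card_image_le[of "{..<n}" z] by simp
  obtain \<delta> where \<delta>: "\<delta> > 0" "\<And>\<epsilon>. \<bar>\<epsilon>\<bar> < \<delta> \<Longrightarrow> \<exists>\<rho>. (\<Prod>a\<in>D. [:- a, 1:]) + [:\<epsilon>:] = (\<Prod>a\<in>D. [:- \<rho> a, 1:])"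
    using perturb_distinct_roots[OF D(1) \<open>D \<noteq> {}\<close>] by blast
  \<comment> \<open>One representative index for each distinct value; only these entries of
    \<open>z\<close> will be moved.\<close>
  define \<iota> where "\<iota> a = (SOME i. i < n \<and> z i = a)" for a
  have \<iota>: "\<iota> a < n \<and> z (\<iota> a) = a" if "a \<in> D" for a
    using someI_ex[of "\<lambda>i. i < n \<and> z i = a"] that by (auto simp: D_def \<iota>_def)
  have inj: "inj_on \<iota> D" using \<iota> by (metis inj_onI)
  have sub: "\<iota> ` D \<subseteq> {..<n}" using \<iota> by auto
  define q where "q = (\<Prod>i\<in>{..<n} - \<iota> ` D. [:- z i, 1:])"
  have card_rest: "card ({..<n} - \<iota> ` D) = n - card D"
    using sub inj by (simp add: card_Diff_subset finite_subset card_image)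
  have q: "degree q = n - card D" "coeff q (n - card D) = 1"
    using monic_prod_linear[of "{..<n} - \<iota> ` D" z] by (auto simp: q_def card_rest)
  have split: "(\<Prod>i<n. [:- x i, 1:]) = (\<Prod>a\<in>D. [:- x (\<iota> a), 1:]) * (\<Prod>i\<in>{..<n} - \<iota> ` D. [:- x i, 1:])"
    for x :: "nat \<Rightarrow> real"
    using prod.subset_diff[OF sub, of "\<lambda>i. [:- x i, 1:]"] inj by (simp add: prod.reindex mult.commute)
  have Pz: "(\<Prod>i<n. [:- z i, 1:]) = (\<Prod>a\<in>D. [:- a, 1:]) * q"
    unfolding split[of z] q_def using \<iota> by simp
  \<comment> \<open>Adding the constant \<open>s * (\<delta> / 2)\<close> to the product over
    \<open>D\<close> adds that multiple of \<open>q\<close> to the whole polynomial. As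
    \<open>q\<close> has degree \<open>n - card D\<close>, only coefficients of index at least
    \<open>card D\<close>, hence above \<open>r\<close>, move.\<close>
  define v where "v j = (if j \<le> n then \<delta> / 2 * coeff q (n - j) else 0)" for j
  have "v j = 0" if "j \<le> r" for j
    using that D \<open>card D \<le> n\<close> q(1) by (auto simp: v_def intro!: coeff_eq_0)
  moreover have "v (card D) \<noteq> 0" using \<delta>(1) q(2) \<open>card D \<le> n\<close> by (simp add: v_def)
  moreover have "\<exists>z'. \<forall>j. signed_esym n z' j = signed_esym n z j + s * v j" if "s \<in> {-1, 1}" for s
  proof -
    have "\<bar>s * (\<delta> / 2)\<bar> < \<delta>" using that \<delta>(1) by auto
    then obtain \<rho> where \<rho>: "(\<Prod>a\<in>D. [:- a, 1:]) + [:s * (\<delta> / 2):] = (\<Prod>a\<in>D. [:- \<rho> a, 1:])"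
      using \<delta>(2) by blast
    define z' where "z' i = (if i \<in> \<iota> ` D then \<rho> (z i) else z i)" for i
    have "(\<Prod>i<n. [:- z' i, 1:]) = (\<Prod>a\<in>D. [:- \<rho> a, 1:]) * q"
      unfolding split[of z'] q_def
      by (intro arg_cong2[where f = "(*)"] prod.cong) (auto simp: z'_def \<iota>)
    also have "\<dots> = (\<Prod>i<n. [:- z i, 1:]) + smult (s * (\<delta> / 2)) q"
      unfolding \<rho>[symmetric] Pz by (simp add: distrib_right)
    finally have P: "(\<Prod>i<n. [:- z' i, 1:]) = (\<Prod>i<n. [:- z i, 1:]) + smult (s * (\<delta> / 2)) q" .
    have "signed_esym n z' j = signed_esym n z j + s * v j" for j
    proof (cases "j \<le> n")
      case True
      thus ?thesis unfolding coeff_prod_linear_factors[OF True, symmetric] P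
        by (simp add: v_def)
    qed (simp add: v_def signed_esym_eq_0)
    thus ?thesis by blast
  qed
  ultimately show ?thesis using \<open>card D \<le> n\<close> by blast
qed

text \<open>This bounds every real point with prescribed first \<open>r\<close> coefficients, which
  makes the set of competitors in the half-degree argument compact.\<close>

lemma sum_squares_esym:
  assumes "2 \<le> r" "\<And>j. j \<le> r \<Longrightarrow> signed_esym n x j = signed_esym n y j"
  shows "power_sum n x 2 = (power_sum n y 2 :: 'a::comm_ring_1)"
proof -
  obtain \<Phi> where \<Phi>: "weighted_poly 2 \<Phi>" "\<And>x :: nat \<Rightarrow> 'a. power_sum n x 2 = \<Phi> (signed_esym n x)"
    using esym_expressible_power_sum[of n 2] by (auto simp: esym_expressible_def)
  show ?thesis unfolding \<Phi>(2) by (rule weighted_poly_cong[OF \<Phi>(1)]) (use assms in auto)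
qed

text \<open>
  The half-degree principle. Among the minimizers with prescribed first \<open>r\<close> coefficients take
  one whose coefficient vector has maximal norm: it is not the midpoint of a segment of
  minimizers, whereas the function is affine along the segments of the previous lemma.
\<close>

lemma half_degree_principle:
  fixes y :: "nat \<Rightarrow> real"
  assumes "weighted_poly d \<Phi>" "d \<le> 2 * r + 1" "2 \<le> r"
  shows "\<exists>z. (\<forall>j\<le>r. signed_esym n z j = signed_esym n y j) \<and> card (z ` {..<n}) \<le> r \<and>
    \<Phi> (signed_esym n z) \<le> \<Phi> (signed_esym n y)"
proof -
  define R where "R = sqrt (power_sum n y 2)"
  define B where "B = {x :: nat \<Rightarrow> real. \<forall>i. x i \<in> (if i < n then cball 0 R else {0})}"
  define K where "K = B \<inter> (\<Inter>j\<in>{..r}. {x. signed_esym n x j = signed_esym n y j})"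
  have cont: "continuous_on S (\<lambda>x :: nat \<Rightarrow> real. signed_esym n x j)" for S j
    by (rule continuous_on_polyfun[OF polyfun_signed_esym])
  have cont\<Phi>: "continuous_on S (\<lambda>x :: nat \<Rightarrow> real. \<Phi> (signed_esym n x))" for S
    by (rule continuous_on_polyfun[OF weighted_poly_imp_polyfun[OF assms(1) polyfun_signed_esym]])
  have "closed {x :: nat \<Rightarrow> real. signed_esym n x j = c}" for j c
    by (intro closed_Collect_eq cont continuous_on_const)
  hence "compact K" unfolding K_def
    by (intro compact_Int_closed closed_INT) (auto simp: B_def compact_box)
  \<comment> \<open>Cutting off the coordinates from \<open>n\<close> on changes no symmetric
    function and moves the point into the compact box.\<close>
  have inK: "(\<lambda>i. if i < n then x i else 0) \<in> K" if x: "\<And>j. j \<le> r \<Longrightarrow> signed_esym n x j = signed_esym n y j" for x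
  proof -
    have "\<bar>x i\<bar> \<le> R" if "i < n" for i
    proof -
      have "(x i)\<^sup>2 \<le> power_sum n x 2" unfolding power_sum_def
        using that by (intro member_le_sum) auto
      also have "\<dots> = power_sum n y 2" by (rule sum_squares_esym[OF assms(3) x])
      finally show ?thesis unfolding R_def by (intro real_le_rsqrt) auto
    qed
    moreover have "signed_esym n (\<lambda>i. if i < n then x i else 0) j = signed_esym n x j" for j
      by (simp add: signed_esym_def)
    ultimately show ?thesis using x by (auto simp: K_def B_def)
  qed
  have eq_restrict: "signed_esym n (\<lambda>i. if i < n then x i else 0) = signed_esym n x" for x :: "nat \<Rightarrow> real"
    by (simp add: signed_esym_def fun_eq_iff)
  have "K \<noteq> {}" using inK[of y] by auto
  then obtain w where w: "w \<in> K" "\<And>x. x \<in> K \<Longrightarrow> \<Phi> (signed_esym n w) \<le> \<Phi> (signed_esym n x)"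
    using continuous_attains_inf[OF \<open>compact K\<close> _ cont\<Phi>] by blast
  define M where "M = K \<inter> {x. \<Phi> (signed_esym n x) = \<Phi> (signed_esym n w)}"
  have "compact M" unfolding M_def
    by (intro compact_Int_closed \<open>compact K\<close> closed_Collect_eq cont\<Phi> continuous_on_const)
  define N where "N x = (\<Sum>j\<le>n. (signed_esym n x j)\<^sup>2)" for x :: "nat \<Rightarrow> real"
  have "w \<in> M" using w by (simp add: M_def)
  moreover have "continuous_on M N" unfolding N_def by (intro continuous_intros cont)
  ultimately obtain z where z: "z \<in> M" "\<And>x. x \<in> M \<Longrightarrow> N x \<le> N z"
    using continuous_attains_sup[OF \<open>compact M\<close>] by blast
  have zK: "z \<in> K" "\<And>x. x \<in> K \<Longrightarrow> \<Phi> (signed_esym n z) \<le> \<Phi> (signed_esym n x)"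
    using z w by (auto simp: M_def)
  have zy: "signed_esym n z j = signed_esym n y j" if "j \<le> r" for j
    using zK(1) that by (auto simp: K_def)
  have "card (z ` {..<n}) \<le> r"
  proof (rule ccontr)
    assume "\<not> card (z ` {..<n}) \<le> r"
    hence "r < card (z ` {..<n})" "0 < r" using assms(3) by auto
    from perturb_esym[OF this] obtain v where v: "\<And>j. j \<le> r \<Longrightarrow> v j = 0" "\<exists>j\<le>n. v j \<noteq> 0"
      "\<And>s. s \<in> {-1, 1} \<Longrightarrow> \<exists>z'. \<forall>j. signed_esym n z' j = signed_esym n z j + s * v j"
      by blast
    have "\<exists>z'\<in>K. signed_esym n z' = (\<lambda>j. signed_esym n z j + s * v j)" if s: "s \<in> {-1, 1}" for s
    proof -
      from v(3)[OF s] obtain z' where z': "\<And>j. signed_esym n z' j = signed_esym n z j + s * v j" by blast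
      hence "(\<lambda>i. if i < n then z' i else 0) \<in> K" using v(1) zy by (intro inK) auto
      thus ?thesis using z' by (intro bexI[of _ "\<lambda>i. if i < n then z' i else 0"]) (auto simp: eq_restrict)
    qed
    from this[of 1] this[of "-1"] obtain a b where ab: "a \<in> K" "b \<in> K"
      "signed_esym n a = (\<lambda>j. signed_esym n z j + v j)" "signed_esym n b = (\<lambda>j. signed_esym n z j - v j)"
      by auto
    have "\<Phi> (signed_esym n a) + \<Phi> (signed_esym n b) = 2 * \<Phi> (signed_esym n z)"
      unfolding ab by (rule weighted_poly_affine[OF assms(1,2) v(1)])
    hence "\<Phi> (signed_esym n a) = \<Phi> (signed_esym n z)" "\<Phi> (signed_esym n b) = \<Phi> (signed_esym n z)"
      using zK(2)[OF ab(1)] zK(2)[OF ab(2)] by linarith+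
    hence "a \<in> M" "b \<in> M" using ab z(1) by (auto simp: M_def)
    hence "N a \<le> N z" "N b \<le> N z" using z by auto
    \<comment> \<open>Parallelogram identity: as \<open>v\<close> is nonzero, one end of the segment
      would have a larger norm than \<open>z\<close>.\<close>
    moreover have "N a + N b = 2 * N z + 2 * (\<Sum>j\<le>n. (v j)\<^sup>2)"
      unfolding N_def ab sum.distrib[symmetric] sum_distrib_left
      by (intro sum.cong) (auto simp: power2_eq_square algebra_simps)
    ultimately have "(\<Sum>j\<le>n. (v j)\<^sup>2) \<le> 0" by linarith
    moreover have "(\<Sum>j\<le>n. (v j)\<^sup>2) > 0" using v(2) by (auto intro!: sum_pos2)
    ultimately show False by simp
  qed
  moreover have "\<Phi> (signed_esym n z) \<le> \<Phi> (signed_esym n y)"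
    using zK(2)[OF inK[of y]] by (simp add: eq_restrict)
  ultimately show ?thesis using zy by blast
qed


section \<open>Partitions\<close>

abbreviation expand_blocks :: "('a \<times> nat) list \<Rightarrow> 'a list" where
  "expand_blocks ps \<equiv> concat (map (\<lambda>(v, c). replicate c v) ps)"

text \<open>Induction on the list: the head opens a block of its own while blocks are to spare;
  otherwise the tail already has \<open>r\<close> distinct values including the head, which joins a
  block with its value. Several blocks may carry the same value, so exactly \<open>r\<close> blocks
  can be reached even with fewer values.\<close>

lemma exists_expand_blocks:
  assumes "card (set xs) \<le> r" "r \<le> length xs"
  shows "\<exists>ps. length ps = r \<and> (\<forall>p\<in>set ps. 0 < snd p) \<and> mset (expand_blocks ps) = mset xs"
  using assms
proof (induction xs arbitrary: r)
  case Nil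
  thus ?case by auto
next
  case (Cons x xs)
  show ?case
  proof (cases "r > 0 \<and> card (set xs) \<le> r - 1")
    case True
    moreover have "r - 1 \<le> length xs" using Cons.prems(2) by simp
    ultimately obtain ps where "length ps = r - 1" "\<forall>p\<in>set ps. 0 < snd p" "mset (expand_blocks ps) = mset xs"
      using Cons.IH[of "r - 1"] by blast
    thus ?thesis using True by (intro exI[of _ "(x, 1) # ps"]) auto
  next
    case False
    have "r > 0" using Cons.prems(1) by (auto simp: card_gt_0_iff intro!: gr0I)
    hence "card (set xs) = r" "x \<in> set xs"
      using False Cons.prems(1) by (auto simp: card_insert_if split: if_splits)
    then obtain ps where ps: "length ps = r" "\<forall>p\<in>set ps. 0 < snd p" "mset (expand_blocks ps) = mset xs"
      using Cons.IH[of r] card_length[of xs] by blast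
    have "x \<in> set (expand_blocks ps)" using \<open>x \<in> set xs\<close> ps(3) by (metis set_mset_mset)
    then obtain c where "(x, c) \<in> set ps" by auto
    then obtain us vs where "ps = us @ (x, c) # vs" by (metis split_list)
    thus ?thesis using ps by (intro exI[of _ "us @ (x, Suc c) # vs"]) auto
  qed
qed

lemma length_blocks: "length (blocks \<omega>) = sum_list \<omega>"
  by (simp add: blocks_def length_concat o_def map_nth)

lemma set_blocks: "set (blocks \<omega>) \<subseteq> {..<length \<omega>}"
  by (auto simp: blocks_def)

lemma blocks_less:
  assumes "\<omega> \<in> r_partitions r n" "i < n"
  shows "blocks \<omega> ! i < r"
proof -
  have "blocks \<omega> ! i \<in> set (blocks \<omega>)" using assms by (intro nth_mem) (auto simp: r_partitions_def length_blocks)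
  thus ?thesis using set_blocks[of \<omega>] assms(1) by (auto simp: r_partitions_def)
qed

text \<open>Applied to powers, this turns the power sums of a point that is constant on the blocks
  into weighted power sums in \<open>r\<close> unknowns with positive weights.\<close>

lemma sum_blocks:
  fixes F :: "nat \<Rightarrow> 'a::comm_semiring_1"
  assumes "\<omega> \<in> r_partitions r n"
  shows "(\<Sum>i<n. F (blocks \<omega> ! i)) = (\<Sum>l<r. of_nat (\<omega> ! l) * F l)"
proof -
  have "sum_list (map F (concat (map (\<lambda>l. replicate (c l) l) ls))) = (\<Sum>l\<leftarrow>ls. of_nat (c l) * F l)" for c ls
    by (induction ls) (auto simp: sum_list_replicate)
  hence "sum_list (map F (blocks \<omega>)) = (\<Sum>l\<leftarrow>[0..<length \<omega>]. of_nat (\<omega> ! l) * F l)"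
    by (simp add: blocks_def)
  moreover have "sum_list (map F (blocks \<omega>)) = (\<Sum>i<n. F (blocks \<omega> ! i))"
  proof -
    have "length (blocks \<omega>) = n" using assms by (simp add: length_blocks r_partitions_def)
    thus ?thesis by (simp add: sum_list_sum_nth atLeast0LessThan)
  qed
  ultimately show ?thesis
    using assms by (simp add: interv_sum_list_conv_sum_set_nat r_partitions_def atLeast0LessThan)
qed

lemma finite_r_partitions: "finite (r_partitions r n)"
proof (rule finite_subset)
  show "r_partitions r n \<subseteq> {\<omega>. set \<omega> \<subseteq> {..n} \<and> length \<omega> = r}"
    by (auto simp: r_partitions_def member_le_sum_list)
qed (auto intro: finite_lists_length_eq)

text \<open>The values are cut into exactly \<open>r\<close> blocks and these are sorted by
  decreasing size; equality of multisets then supplies the permutation.\<close>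

lemma few_values_imp_blocks:
  fixes z :: "nat \<Rightarrow> 'a"
  assumes "card (z ` {..<n}) \<le> r" "r \<le> n"
  shows "\<exists>\<omega>\<in>r_partitions r n. \<exists>t \<pi>. \<pi> permutes {..<n} \<and> (\<forall>i<n. z (\<pi> i) = t (blocks \<omega> ! i))"
proof -
  have "set (map z [0..<n]) = z ` {..<n}" by auto
  then obtain ps where ps: "length ps = r" "\<forall>p\<in>set ps. 0 < snd p"
    "mset (expand_blocks ps) = mset (map z [0..<n])"
    using exists_expand_blocks[of "map z [0..<n]" r] assms by auto
  define qs where "qs = rev (sort_key snd ps)"
  have qs: "mset qs = mset ps" "set qs = set ps" by (auto simp: qs_def)
  have flat: "mset (expand_blocks xs) = sum_mset (image_mset (\<lambda>(v, c). replicate_mset c v) (mset xs))"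
    for xs :: "('a \<times> nat) list"
    by (induction xs) auto
  have mset_qs: "mset (expand_blocks qs) = mset (map z [0..<n])"
    unfolding ps(3)[symmetric] flat qs ..
  define \<omega> where "\<omega> = map snd qs"
  define t where "t i = fst (qs ! i)" for i
  have len: "length qs = r" using ps(1) by (simp add: qs_def)
  have "map t (blocks \<omega>) = concat (map (\<lambda>l. replicate (snd (qs ! l)) (fst (qs ! l))) [0..<r])"
    unfolding blocks_def map_concat map_map o_def map_replicate
    by (intro arg_cong[where f = concat]) (auto simp: \<omega>_def t_def len)
  also have "\<dots> = concat (map (\<lambda>(v, c). replicate c v) (map (\<lambda>l. qs ! l) [0..<r]))"
    by (simp add: o_def case_prod_beta)
  also have "map (\<lambda>l. qs ! l) [0..<r] = qs" using map_nth[of qs] len by simp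
  finally have t: "map t (blocks \<omega>) = expand_blocks qs" .
  have "length (blocks \<omega>) = n"
    using arg_cong[OF t, of length] arg_cong[OF mset_qs, of size] by simp
  hence sum: "sum_list \<omega> = n" by (simp add: length_blocks)
  have "sorted (map snd (sort_key snd ps))" by simp
  hence "sorted_wrt (\<ge>) \<omega>" by (simp add: \<omega>_def qs_def rev_map[symmetric] sorted_wrt_rev)
  hence "\<omega> \<in> r_partitions r n"
    using ps(2) qs(2) sum len by (auto simp: r_partitions_def \<omega>_def)
  moreover have "mset (map t (blocks \<omega>)) = mset (map z [0..<n])" using t mset_qs by simp
  from mset_eq_permutation[OF this] obtain \<pi> where
    "\<pi> permutes {..<length (map z [0..<n])}" "permute_list \<pi> (map z [0..<n]) = map t (blocks \<omega>)" .
  hence \<pi>: "\<pi> permutes {..<n}" "permute_list \<pi> (map z [0..<n]) = map t (blocks \<omega>)" by simp_all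
  have "z (\<pi> i) = t (blocks \<omega> ! i)" if "i < n" for i
  proof -
    have "permute_list \<pi> (map z [0..<n]) ! i = z (\<pi> i)"
      using \<pi>(1) that permutes_in_image[OF \<pi>(1), of i] by (simp add: permute_list_def)
    thus ?thesis using \<pi>(2) that \<open>length (blocks \<omega>) = n\<close> by simp
  qed
  ultimately show ?thesis using \<pi>(1) by blast
qed


section \<open>The Nullstellensatz over the complex numbers\<close>

text \<open>Gaussian elimination, one equation \<open>b\<close> at a time: the pivot
  \<open>a0\<close> is eliminated and its coefficient is recovered at the end.\<close>

lemma exists_linear_relation:
  fixes M :: "'a \<Rightarrow> 'b \<Rightarrow> 'k::field"
  assumes "finite F" "finite A" "card F < card A"
  shows "\<exists>c. (\<exists>a\<in>A. c a \<noteq> 0) \<and> (\<forall>b\<in>F. (\<Sum>a\<in>A. c a * M a b) = 0)"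
  using assms
proof (induction F arbitrary: A M rule: finite_induct)
  case empty
  then obtain a where "a \<in> A" by fastforce
  thus ?case by (intro exI[of _ "\<lambda>_. 1"]) auto
next
  case (insert b F)
  show ?case
  proof (cases "\<forall>a\<in>A. M a b = 0")
    case True
    thus ?thesis using insert.IH[of A M] insert by auto
  next
    case False
    then obtain a0 where a0: "a0 \<in> A" "M a0 b \<noteq> 0" by blast
    define M' where "M' a b' = M a b' - M a b / M a0 b * M a0 b'" for a b'
    obtain c where c: "\<exists>a\<in>A - {a0}. c a \<noteq> 0" "\<And>b'. b' \<in> F \<Longrightarrow> (\<Sum>a\<in>A - {a0}. c a * M' a b') = 0"
    proof -
      have "finite (A - {a0})" "card F < card (A - {a0})" using insert a0 by auto
      from insert.IH[OF this, of M'] show ?thesis using that by blast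
    qed
    define d where "d = c(a0 := - (\<Sum>a\<in>A - {a0}. c a * (M a b / M a0 b)))"
    have d: "(\<Sum>a\<in>A. d a * M a b') = (\<Sum>a\<in>A - {a0}. c a * M' a b')" for b'
    proof -
      have "(\<Sum>a\<in>A. d a * M a b') = d a0 * M a0 b' + (\<Sum>a\<in>A - {a0}. c a * M a b')"
        using insert.prems a0 by (simp add: sum.remove[of A a0] d_def)
      also have "d a0 * M a0 b' = - (\<Sum>a\<in>A - {a0}. c a * (M a b / M a0 b) * M a0 b')"
        by (simp add: d_def sum_distrib_right)
      finally show ?thesis by (simp add: M'_def algebra_simps sum_subtractf)
    qed
    have "(\<Sum>a\<in>A. d a * M a b') = 0" if "b' \<in> insert b F" for b'
    proof (cases "b' = b")
      case True
      thus ?thesis unfolding d using a0 by (simp add: M'_def)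
    qed (use that c(2) d in auto)
    moreover have "\<exists>a\<in>A. d a \<noteq> 0" using c(1) by (auto simp: d_def)
    ultimately show ?thesis by blast
  qed
qed

section \<open>Ideals of polynomial functions\<close>

definition fun_ideal :: "nat \<Rightarrow> ((nat \<Rightarrow> 'a::comm_ring_1) \<Rightarrow> 'a) set \<Rightarrow> bool" where
  "fun_ideal n J \<longleftrightarrow> (\<forall>F\<in>J. polyfun n F) \<and> (\<lambda>x. 0) \<in> J \<and>
     (\<forall>F\<in>J. \<forall>G\<in>J. (\<lambda>x. F x + G x) \<in> J) \<and> (\<forall>F\<in>J. \<forall>H. polyfun n H \<longrightarrow> (\<lambda>x. H x * F x) \<in> J)"

lemma fun_idealD:
  assumes "fun_ideal n J"
  shows "F \<in> J \<Longrightarrow> polyfun n F" "(\<lambda>x. 0) \<in> J"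
    "F \<in> J \<Longrightarrow> G \<in> J \<Longrightarrow> (\<lambda>x. F x + G x) \<in> J"
    "F \<in> J \<Longrightarrow> polyfun n H \<Longrightarrow> (\<lambda>x. H x * F x) \<in> J"
  using assms by (auto simp: fun_ideal_def)

lemma fun_ideal_diff:
  assumes "fun_ideal n J" "F \<in> J" "G \<in> J"
  shows "(\<lambda>x. F x - G x) \<in> J"
  using fun_idealD(3)[OF assms(1,2) fun_idealD(4)[OF assms(1,3) polyfun_const[of n "-1"]]] by simp

lemma fun_ideal_sum:
  assumes "fun_ideal n J" "\<And>i. i \<in> I \<Longrightarrow> F i \<in> J"
  shows "(\<lambda>x. \<Sum>i\<in>I. F i x) \<in> J"
  using assms(2) by (induction I rule: infinite_finite_induct) (auto intro: fun_idealD[OF assms(1)])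

definition fun_zeros :: "((nat \<Rightarrow> 'a::zero) \<Rightarrow> 'a) set \<Rightarrow> (nat \<Rightarrow> 'a) set" where
  "fun_zeros J = {x. \<forall>F\<in>J. F x = 0}"

text \<open>Indexing by lists makes countability of the spanning set immediate. That different lists
  can denote the same monomial is harmless, since only spanning matters.\<close>

definition list_monom :: "nat list \<Rightarrow> (nat \<Rightarrow> 'a::comm_ring_1) \<Rightarrow> 'a" where
  "list_monom l x = prod_list (map x l)"

lemma polyfun_monom_expansion:
  fixes F :: "(nat \<Rightarrow> 'a::comm_ring_1) \<Rightarrow> 'a"
  assumes "polyfun n F"
  shows "\<exists>A c. finite A \<and> (\<forall>x. F x = (\<Sum>l\<in>A. c l * list_monom l x))"
  using assms
proof induction
  case (polyfun_const c)
  show ?case by (intro exI[of _ "{[]}"] exI[of _ "\<lambda>_. c"]) (simp add: list_monom_def)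
next
  case (polyfun_var i)
  show ?case by (intro exI[of _ "{[i]}"] exI[of _ "\<lambda>_. 1"]) (simp add: list_monom_def)
next
  case (polyfun_add F G)
  then obtain A B c d where *: "finite A" "finite B" "\<And>x. F x = (\<Sum>l\<in>A. c l * list_monom l x)"
    "\<And>x. G x = (\<Sum>l\<in>B. d l * list_monom l x)" by auto
  define e where "e l = (if l \<in> A then c l else 0) + (if l \<in> B then d l else 0)" for l
  have "F x + G x = (\<Sum>l\<in>A \<union> B. e l * list_monom l x)" for x
  proof -
    have "F x = (\<Sum>l\<in>A \<union> B. (if l \<in> A then c l else 0) * list_monom l x)"
      unfolding * using * by (intro sum.mono_neutral_cong_left) auto
    moreover have "G x = (\<Sum>l\<in>A \<union> B. (if l \<in> B then d l else 0) * list_monom l x)"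
      unfolding * using * by (intro sum.mono_neutral_cong_left) auto
    ultimately show ?thesis by (simp add: e_def sum.distrib distrib_right)
  qed
  thus ?case using * by (intro exI[of _ "A \<union> B"] exI[of _ e]) auto
next
  case (polyfun_mult F G)
  then obtain A B c d where *: "finite A" "finite B" "\<And>x. F x = (\<Sum>l\<in>A. c l * list_monom l x)"
    "\<And>x. G x = (\<Sum>l\<in>B. d l * list_monom l x)" by auto
  define C where "C = (\<lambda>(a, b). a @ b) ` (A \<times> B)"
  define e where "e l = (\<Sum>(a, b)\<in>{(a, b) \<in> A \<times> B. a @ b = l}. c a * d b)" for l
  have "F x * G x = (\<Sum>l\<in>C. e l * list_monom l x)" for x
  proof -
    have "F x * G x = (\<Sum>(a, b)\<in>A \<times> B. (c a * d b) * list_monom (a @ b) x)"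
      by (simp add: * sum_product sum.cartesian_product list_monom_def mult_ac)
    also have "\<dots> = (\<Sum>l\<in>C. \<Sum>p\<in>{p \<in> A \<times> B. (\<lambda>(a, b). a @ b) p = l}. (\<lambda>(a, b). (c a * d b) * list_monom (a @ b) x) p)"
      unfolding C_def using *(1,2) by (intro sum.image_gen) auto
    also have "\<dots> = (\<Sum>l\<in>C. e l * list_monom l x)"
      unfolding e_def sum_distrib_right by (intro sum.cong) auto
    finally show ?thesis .
  qed
  thus ?case using * by (intro exI[of _ C] exI[of _ e]) (auto simp: C_def)
qed

text \<open>
  The ring of polynomials has countable dimension, so uncountably many inverses of \<open>Y - a\<close>
  modulo \<open>J\<close> are linearly dependent; clearing denominators gives a relation for \<open>Y\<close>.
\<close>

lemma uncountably_many_inverses: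
  fixes Y :: "(nat \<Rightarrow> 'a::field) \<Rightarrow> 'a"
  assumes J: "fun_ideal n J" "(\<lambda>x. 1) \<notin> J" and Y: "polyfun n Y" and A: "uncountable A"
    and inv: "\<And>a. a \<in> A \<Longrightarrow> \<exists>u. polyfun n u \<and> (\<lambda>x. u x * (Y x - a) - 1) \<in> J"
  shows "\<exists>q. q \<noteq> 0 \<and> (\<lambda>x. poly q (Y x)) \<in> J"
proof -
  obtain u where u: "\<And>a. a \<in> A \<Longrightarrow> polyfun n (u a)" "\<And>a. a \<in> A \<Longrightarrow> (\<lambda>x. u a x * (Y x - a) - 1) \<in> J"
    using inv by metis
  obtain S M where S: "\<And>a. a \<in> A \<Longrightarrow> finite (S a)"
    "\<And>a x. a \<in> A \<Longrightarrow> u a x = (\<Sum>l\<in>S a. M a l * list_monom l x)"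
    using polyfun_monom_expansion[OF u(1)] by metis
  \<comment> \<open>There are only countably many finite supports, so infinitely many
    \<open>a\<close> share one support \<open>F\<close>; any \<open>card F + 1\<close> of the
    corresponding inverses are linearly dependent.\<close>
  obtain F where F: "infinite {a \<in> A. S a = F}"
  proof (rule ccontr)
    assume "\<not> thesis"
    hence fin: "finite {a \<in> A. S a = F}" for F using that[of F] by argo
    have "A \<subseteq> (\<Union>F\<in>{F. finite F}. {a \<in> A. S a = F})" using S(1) by auto
    moreover have "countable (\<Union>F\<in>{F. finite F}. {a \<in> A. S a = F})"
      by (intro countable_UN countable_Collect_finite countable_finite fin)
    ultimately show False using A countable_subset by blast
  qed
  then obtain B where B: "B \<subseteq> {a \<in> A. S a = F}" "finite B" "card B = Suc (card F)"
    using infinite_arbitrarily_large[OF F, of "Suc (card F)"] by blast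
  have "finite F" using B S(1) by (cases "B = {}") auto
  moreover have "card F < card B" using B by simp
  ultimately obtain c where c: "\<exists>a\<in>B. c a \<noteq> 0" "\<And>l. l \<in> F \<Longrightarrow> (\<Sum>a\<in>B. c a * M a l) = 0"
    using exists_linear_relation[OF _ B(2), of F M] by blast
  have rel: "(\<Sum>a\<in>B. c a * u a x) = 0" for x
  proof -
    have "(\<Sum>a\<in>B. c a * u a x) = (\<Sum>a\<in>B. \<Sum>l\<in>F. c a * M a l * list_monom l x)"
      using B S(2) by (intro sum.cong refl) (auto simp: sum_distrib_left mult.assoc)
    also have "\<dots> = (\<Sum>l\<in>F. (\<Sum>a\<in>B. c a * M a l) * list_monom l x)"
      by (subst sum.swap) (simp add: sum_distrib_right)
    finally show ?thesis using c(2) by simp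
  qed
  \<comment> \<open>The numerator of the sum of the \<open>c a / (Y - a)\<close> over a common
    denominator. Evaluation at \<open>a0\<close> shows that it is nonzero, and modulo
    \<open>J\<close> the relation between the inverses makes it vanish at \<open>Y\<close>.\<close>
  define q where "q = (\<Sum>a\<in>B. smult (c a) (\<Prod>b\<in>B - {a}. [:- b, 1:]))"
  obtain a0 where a0: "a0 \<in> B" "c a0 \<noteq> 0" using c(1) by blast
  have "poly q a0 = c a0 * (\<Prod>b\<in>B - {a0}. a0 - b)"
  proof -
    have "poly q a0 = (\<Sum>a\<in>B. c a * (\<Prod>b\<in>B - {a}. a0 - b))" by (simp add: q_def poly_sum poly_prod)
    also have "\<dots> = (\<Sum>a\<in>{a0}. c a * (\<Prod>b\<in>B - {a}. a0 - b))"
      using a0 B(2) by (intro sum.mono_neutral_right) auto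
    finally show ?thesis by simp
  qed
  moreover have "(\<Prod>b\<in>B - {a0}. a0 - b) \<noteq> 0" using B(2) by (subst prod_zero_iff) auto
  ultimately have "q \<noteq> 0" using a0 by auto
  moreover have "(\<lambda>x. poly q (Y x)) \<in> J"
  proof -
    have "(\<lambda>x. \<Sum>a\<in>B. (- c a * (\<Prod>b\<in>B - {a}. Y x - b)) * (u a x * (Y x - a) - 1)) \<in> J"
      using u(2) B Y by (intro fun_ideal_sum[OF J(1)] fun_idealD(4)[OF J(1)] polyfun_intros) auto
    moreover have "(\<Sum>a\<in>B. (- c a * (\<Prod>b\<in>B - {a}. Y x - b)) * (u a x * (Y x - a) - 1)) = poly q (Y x)" for x
    proof -
      have "(\<Sum>a\<in>B. (- c a * (\<Prod>b\<in>B - {a}. Y x - b)) * (u a x * (Y x - a) - 1)) =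
        (\<Sum>a\<in>B. c a * (\<Prod>b\<in>B - {a}. Y x - b) - c a * u a x * (\<Prod>b\<in>B. Y x - b))"
        using B(2) by (intro sum.cong) (auto simp: prod.remove algebra_simps)
      also have "\<dots> = poly q (Y x) - (\<Sum>a\<in>B. c a * u a x) * (\<Prod>b\<in>B. Y x - b)"
        by (simp add: sum_subtractf sum_distrib_right q_def poly_sum poly_prod)
      finally show ?thesis by (simp add: rel)
    qed
    ultimately show ?thesis by simp
  qed
  ultimately show ?thesis by blast
qed

definition ideal_adjoin ::
    "nat \<Rightarrow> ((nat \<Rightarrow> 'a::comm_ring_1) \<Rightarrow> 'a) set \<Rightarrow> ((nat \<Rightarrow> 'a) \<Rightarrow> 'a) \<Rightarrow> ((nat \<Rightarrow> 'a) \<Rightarrow> 'a) set" where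
  "ideal_adjoin n J F = {P. \<exists>G\<in>J. \<exists>H. polyfun n H \<and> (\<forall>x. P x = G x + H x * F x)}"

lemma ideal_adjoinI:
  "G \<in> J \<Longrightarrow> polyfun n H \<Longrightarrow> (\<And>x. P x = G x + H x * F x) \<Longrightarrow> P \<in> ideal_adjoin n J F"
  unfolding ideal_adjoin_def by blast

lemma ideal_adjoinE:
  assumes "P \<in> ideal_adjoin n J F"
  obtains G H where "G \<in> J" "polyfun n H" "\<And>x. P x = G x + H x * F x"
  using assms unfolding ideal_adjoin_def by blast

lemma subset_ideal_adjoin: "J \<subseteq> ideal_adjoin n J F"
  by (auto intro: ideal_adjoinI[OF _ polyfun_const[of n 0]])

lemma mem_ideal_adjoin: "fun_ideal n J \<Longrightarrow> F \<in> ideal_adjoin n J F"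
  by (rule ideal_adjoinI[OF fun_idealD(2) polyfun_const[of n 1]]) auto

lemma fun_ideal_adjoin:
  assumes J: "fun_ideal n J" and F: "polyfun n F"
  shows "fun_ideal n (ideal_adjoin n J F)"
  unfolding fun_ideal_def
proof (intro conjI ballI allI impI)
  show "polyfun n P" if P: "P \<in> ideal_adjoin n J F" for P
  proof -
    from P obtain G H where GH: "G \<in> J" "polyfun n H" "\<And>x. P x = G x + H x * F x"
      by (rule ideal_adjoinE) blast
    hence "P = (\<lambda>x. G x + H x * F x)" by auto
    thus ?thesis using GH F fun_idealD(1)[OF J] by (auto intro!: polyfun_intros)
  qed
  show "(\<lambda>x. 0) \<in> ideal_adjoin n J F" using fun_idealD(2)[OF J] subset_ideal_adjoin by blast
  show "(\<lambda>x. P x + Q x) \<in> ideal_adjoin n J F"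
    if PQ: "P \<in> ideal_adjoin n J F" "Q \<in> ideal_adjoin n J F" for P Q
  proof -
    from PQ(1) obtain G H where 1: "G \<in> J" "polyfun n H" "\<And>x. P x = G x + H x * F x"
      by (rule ideal_adjoinE) blast
    from PQ(2) obtain G' H' where 2: "G' \<in> J" "polyfun n H'" "\<And>x. Q x = G' x + H' x * F x"
      by (rule ideal_adjoinE) blast
    show ?thesis
      by (rule ideal_adjoinI[OF fun_idealD(3)[OF J 1(1) 2(1)] polyfun_add[OF 1(2) 2(2)]])
        (simp add: 1 2 algebra_simps)
  qed
  show "(\<lambda>x. K x * P x) \<in> ideal_adjoin n J F" if P: "P \<in> ideal_adjoin n J F" "polyfun n K" for P K
  proof -
    from P(1) obtain G H where 1: "G \<in> J" "polyfun n H" "\<And>x. P x = G x + H x * F x"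
      by (rule ideal_adjoinE) blast
    show ?thesis
      by (rule ideal_adjoinI[OF fun_idealD(4)[OF J 1(1) P(2)] polyfun_mult[OF P(2) 1(2)]])
        (simp add: 1 algebra_simps)
  qed
qed

lemma one_mem_ideal_adjoin:
  assumes "fun_ideal n J" "(\<lambda>x. 1) \<in> ideal_adjoin n J F"
  shows "\<exists>u. polyfun n u \<and> (\<lambda>x. u x * F x - 1) \<in> J"
proof -
  from assms(2) obtain G H where GH: "G \<in> J" "polyfun n H" "\<And>x. 1 = G x + H x * F x"
    by (rule ideal_adjoinE) blast
  have "(\<lambda>x. H x * F x - 1) = (\<lambda>x. (- 1) * G x)"
  proof
    fix x show "H x * F x - 1 = (- 1) * G x"
      using arg_cong[OF GH(3)[of x], of "\<lambda>y. H x * F x - y"] by simp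
  qed
  thus ?thesis using GH(2) fun_idealD(4)[OF assms(1) GH(1) polyfun_const] by metis
qed

lemma fun_ideal_Union_chain:
  assumes "C \<noteq> {}" "\<And>J. J \<in> C \<Longrightarrow> fun_ideal n J" "\<And>I J. I \<in> C \<Longrightarrow> J \<in> C \<Longrightarrow> I \<subseteq> J \<or> J \<subseteq> I"
  shows "fun_ideal n (\<Union>C)"
  unfolding fun_ideal_def
proof (intro conjI ballI allI impI)
  show "(\<lambda>x. 0) \<in> \<Union>C" using assms(1,2) fun_idealD(2) by blast
  show "(\<lambda>x. F x + G x) \<in> \<Union>C" if "F \<in> \<Union>C" "G \<in> \<Union>C" for F G
  proof -
    from that obtain I where "I \<in> C" "F \<in> I" "G \<in> I" using assms(3) by blast
    thus ?thesis using fun_idealD(3)[OF assms(2)] by blast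
  qed
qed (use assms(2) fun_idealD(1,4) in blast)+

text \<open>Modulo a maximal proper ideal \<open>M\<close> above \<open>J\<close> everything outside
  \<open>M\<close> is invertible. Uncountability makes each coordinate algebraic modulo
  \<open>M\<close>, algebraic closedness makes it congruent to a number, and these numbers form a
  common zero of \<open>J\<close>.\<close>

lemma weak_nullstellensatz:
  fixes J :: "((nat \<Rightarrow> complex) \<Rightarrow> complex) set"
  assumes "fun_ideal n J" "fun_zeros J = {}"
  shows "(\<lambda>x. 1) \<in> J"
proof (rule ccontr)
  assume J: "(\<lambda>x. 1) \<notin> J"
  define \<A> where "\<A> = {I. fun_ideal n I \<and> J \<subseteq> I \<and> (\<lambda>x. 1) \<notin> I}"
  have "\<exists>M\<in>\<A>. \<forall>I\<in>\<A>. M \<subseteq> I \<longrightarrow> I = M"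
  proof (rule subset_Zorn)
    fix C assume C: "subset.chain \<A> C"
    show "\<exists>U\<in>\<A>. \<forall>I\<in>C. I \<subseteq> U"
    proof (cases "C = {}")
      case True
      thus ?thesis using assms J by (auto simp: \<A>_def)
    next
      case False
      have "fun_ideal n (\<Union>C)"
        using C False by (intro fun_ideal_Union_chain) (auto simp: \<A>_def subset_chain_def)
      thus ?thesis using C False by (intro bexI[of _ "\<Union>C"]) (auto simp: \<A>_def subset_chain_def)
    qed
  qed
  then obtain M where M: "M \<in> \<A>" "\<And>I. I \<in> \<A> \<Longrightarrow> M \<subseteq> I \<Longrightarrow> I = M" by blast
  have id: "fun_ideal n M" and M1: "(\<lambda>x. 1) \<notin> M" and JM: "J \<subseteq> M" using M(1) by (auto simp: \<A>_def)
  have inverse: "\<exists>u. polyfun n u \<and> (\<lambda>x. u x * F x - 1) \<in> M" if F: "polyfun n F" "F \<notin> M" for F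
  proof -
    let ?I = "ideal_adjoin n M F"
    have "?I \<notin> \<A>" using M(2)[of ?I] F(2) subset_ideal_adjoin[of M n F] mem_ideal_adjoin[OF id, of F] by auto
    hence "(\<lambda>x. 1) \<in> ?I"
      using fun_ideal_adjoin[OF id F(1)] subset_ideal_adjoin[of M n F] JM unfolding \<A>_def by blast
    thus ?thesis by (rule one_mem_ideal_adjoin[OF id])
  qed
  have "\<exists>a. (\<lambda>x. x i - a) \<in> M" if i: "i < n" for i
  proof (rule ccontr)
    assume no: "\<nexists>a. (\<lambda>x. x i - a) \<in> M"
    have "\<exists>q. q \<noteq> 0 \<and> (\<lambda>x. poly q (x i)) \<in> M"
    proof (rule uncountably_many_inverses[OF id M1])
      show "uncountable (UNIV :: complex set)" by (rule uncountable_UNIV_complex)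
      fix a show "\<exists>u. polyfun n u \<and> (\<lambda>x. u x * (x i - a) - 1) \<in> M"
        using no i by (intro inverse polyfun_intros) auto
    qed (use i in \<open>auto intro: polyfun_intros\<close>)
    then obtain q where q: "q \<noteq> 0" "(\<lambda>x. poly q (x i)) \<in> M" by blast
    \<comment> \<open>Descent on the degree: a linear factor \<open>x i - a\<close> of
      \<open>poly q (x i)\<close> is invertible modulo \<open>M\<close>, so the cofactor again lies
      in \<open>M\<close>, until a nonzero constant does.\<close>
    have "False" if "q \<noteq> 0" "(\<lambda>x. poly q (x i)) \<in> M" for q
      using that
    proof (induction "degree q" arbitrary: q)
      case 0
      then obtain c where "q = [:c:]" "c \<noteq> 0" by (metis degree_eq_zeroE pCons_0_0)
      hence "(\<lambda>x. (1 / c) * poly q (x i)) = (\<lambda>x. 1)" by simp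
      thus False using fun_idealD(4)[OF id 0(3) polyfun_const[of n "1 / c"]] M1 by metis
    next
      case (Suc k)
      then obtain a where "poly q a = 0" using alg_closed_imp_poly_has_root[of q] by auto
      then obtain q' where q': "q = [:- a, 1:] * q'" by (metis poly_eq_0_iff_dvd dvdE)
      hence "q' \<noteq> 0" using Suc by auto
      hence "degree q = Suc (degree q')" unfolding q' by (subst degree_mult_eq) auto
      hence "degree q' = k" using Suc.hyps(2) by simp
      obtain u where u: "polyfun n u" "(\<lambda>x. u x * (x i - a) - 1) \<in> M"
        using no inverse[OF polyfun_diff[OF polyfun_var[OF i] polyfun_const[of n a]]] by blast
      have "(\<lambda>x. u x * poly q (x i) - poly q' (x i) * (u x * (x i - a) - 1)) \<in> M"
        by (rule fun_ideal_diff[OF id fun_idealD(4)[OF id Suc.prems(2) u(1)]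
            fun_idealD(4)[OF id u(2) polyfun_poly[OF polyfun_var[OF i]]]])
      moreover have "(\<lambda>x. u x * poly q (x i) - poly q' (x i) * (u x * (x i - a) - 1)) = (\<lambda>x. poly q' (x i))"
        by (simp add: q' fun_eq_iff algebra_simps)
      ultimately show False using Suc.hyps(1)[of q'] \<open>degree q' = k\<close> \<open>q' \<noteq> 0\<close> by simp
    qed
    thus False using q by blast
  qed
  then obtain a where a: "\<And>i. i < n \<Longrightarrow> (\<lambda>x. x i - a i) \<in> M" by metis
  have mod: "(\<lambda>x. F x - F a) \<in> M" if "polyfun n F" for F
    using that
  proof induction
    case (polyfun_const c)
    show ?case using fun_idealD(2)[OF id] by simp
  next
    case (polyfun_var i)
    thus ?case by (rule a)
  next
    case (polyfun_add F G)
    thus ?case using fun_idealD(3)[OF id polyfun_add.IH] by (simp add: algebra_simps)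
  next
    case (polyfun_mult F G)
    have "(\<lambda>x. G x * (F x - F a) + F a * (G x - G a)) \<in> M"
      by (rule fun_idealD(3)[OF id fun_idealD(4)[OF id polyfun_mult.IH(1) polyfun_mult.hyps(2)]
            fun_idealD(4)[OF id polyfun_mult.IH(2) polyfun_const]])
    thus ?case by (simp add: algebra_simps)
  qed
  have "F a = 0" if "F \<in> J" for F
  proof (rule ccontr)
    assume "F a \<noteq> 0"
    have "F \<in> M" using that JM by blast
    have "(\<lambda>x. (1 / F a) * (F x - (F x - F a))) \<in> M"
      by (rule fun_idealD(4)[OF id fun_ideal_diff[OF id \<open>F \<in> M\<close> mod[OF fun_idealD(1)[OF id \<open>F \<in> M\<close>]]] polyfun_const])
    thus False using M1 \<open>F a \<noteq> 0\<close> by simp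
  qed
  thus False using assms(2) by (auto simp: fun_zeros_def)
qed

text \<open>If \<open>a\<close> is not a value of \<open>Y\<close> on the zeros of \<open>J\<close>,
  adjoining \<open>Y - a\<close> leaves no zeros, so \<open>Y - a\<close> is invertible modulo
  \<open>J\<close>. Uncountably many such \<open>a\<close> force an algebraic relation.\<close>

lemma algebraic_mod_ideal:
  fixes J :: "((nat \<Rightarrow> complex) \<Rightarrow> complex) set"
  assumes J: "fun_ideal n J" and Y: "polyfun n Y" and "uncountable (- Y ` fun_zeros J)"
  shows "\<exists>q. q \<noteq> 0 \<and> (\<lambda>x. poly q (Y x)) \<in> J"
proof (cases "(\<lambda>x. 1) \<in> J")
  case True
  thus ?thesis by (intro exI[of _ 1]) simp
next
  case False
  show ?thesis
  proof (rule uncountably_many_inverses[OF J False Y assms(3)])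
    fix a assume a: "a \<in> - Y ` fun_zeros J"
    let ?I = "ideal_adjoin n J (\<lambda>x. Y x - a)"
    have I: "fun_ideal n ?I" using Y by (intro fun_ideal_adjoin[OF J] polyfun_intros)
    have "x \<notin> fun_zeros ?I" for x
    proof
      assume x: "x \<in> fun_zeros ?I"
      hence "x \<in> fun_zeros J" using subset_ideal_adjoin[of J n] by (auto simp: fun_zeros_def)
      moreover have "\<forall>F\<in>?I. F x = 0" using x by (simp add: fun_zeros_def)
      from bspec[OF this mem_ideal_adjoin[OF J]] have "Y x - a = 0" .
      ultimately show False using a by auto
    qed
    hence "(\<lambda>x. 1) \<in> ?I" using weak_nullstellensatz[OF I] by blast
    thus "\<exists>u. polyfun n u \<and> (\<lambda>x. u x * (Y x - a) - 1) \<in> J" by (rule one_mem_ideal_adjoin[OF J])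
  qed
qed


section \<open>The quotient by the symmetric group\<close>

text \<open>Zorn's lemma turned upside down by taking complements. It stands in for the descending
  chain condition on closed sets.\<close>

lemma exists_minimal_closed_chain:
  assumes "\<D> \<noteq> {}"
    and "\<And>\<C>. \<C> \<noteq> {} \<Longrightarrow> \<C> \<subseteq> \<D> \<Longrightarrow> (\<And>A B. A \<in> \<C> \<Longrightarrow> B \<in> \<C> \<Longrightarrow> A \<subseteq> B \<or> B \<subseteq> A) \<Longrightarrow> \<Inter>\<C> \<in> \<D>"
  shows "\<exists>M\<in>\<D>. \<forall>X\<in>\<D>. X \<subseteq> M \<longrightarrow> X = M"
proof -
  have "\<exists>M\<in>uminus ` \<D>. \<forall>X\<in>uminus ` \<D>. M \<subseteq> X \<longrightarrow> X = M"
  proof (rule subset_Zorn)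
    fix \<C> assume \<C>: "subset.chain (uminus ` \<D>) \<C>"
    show "\<exists>U\<in>uminus ` \<D>. \<forall>X\<in>\<C>. X \<subseteq> U"
    proof (cases "\<C> = {}")
      case False
      have "\<Inter>(uminus ` \<C>) \<in> \<D>"
      proof (rule assms(2))
        show "uminus ` \<C> \<subseteq> \<D>" using \<C> by (auto simp: subset_chain_def)
        fix A B assume "A \<in> uminus ` \<C>" "B \<in> uminus ` \<C>"
        hence "- A \<in> \<C>" "- B \<in> \<C>" by auto
        hence "- A \<subseteq> - B \<or> - B \<subseteq> - A" using \<C> unfolding subset_chain_def by blast
        thus "A \<subseteq> B \<or> B \<subseteq> A" by auto
      qed (use False in auto)
      hence "- \<Inter>(uminus ` \<C>) \<in> uminus ` \<D>" by (rule imageI)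
      moreover have "\<forall>X\<in>\<C>. X \<subseteq> - \<Inter>(uminus ` \<C>)" by auto
      ultimately show ?thesis by blast
    qed (use assms(1) in auto)
  qed
  thus ?thesis by auto
qed

text \<open>Over an infinite field finitely many proper conditions can be avoided at once: a
  function vanishing at the new point is corrected by \<open>c * G\<close>, with \<open>c\<close>
  outside a finite set.\<close>

lemma exists_nonvanishing:
  fixes I :: "('b \<Rightarrow> 'a::field_char_0) set"
  assumes "finite S" "I \<noteq> {}" "\<And>F G c. F \<in> I \<Longrightarrow> G \<in> I \<Longrightarrow> (\<lambda>x. F x + c * G x) \<in> I"
    and "\<And>s. s \<in> S \<Longrightarrow> \<exists>F\<in>I. F s \<noteq> 0"
  shows "\<exists>F\<in>I. \<forall>s\<in>S. F s \<noteq> 0"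
  using assms(1,4)
proof (induction S)
  case (insert t S)
  hence "\<exists>F\<in>I. \<forall>s\<in>S. F s \<noteq> 0" "\<exists>G\<in>I. G t \<noteq> 0" by auto
  then obtain F G where F: "F \<in> I" "\<And>s. s \<in> S \<Longrightarrow> F s \<noteq> 0" and G: "G \<in> I" "G t \<noteq> 0" by blast
  show ?case
  proof (cases "F t = 0")
    case False
    thus ?thesis using F by auto
  next
    case True
    have "infinite (UNIV - insert 0 ((\<lambda>s. - F s / G s) ` S))"
      using insert.hyps by (intro Diff_infinite_finite infinite_UNIV_char_0) auto
    then obtain c where "c \<in> UNIV - insert 0 ((\<lambda>s. - F s / G s) ` S)" using infinite_imp_nonempty by blast
    hence c: "c \<noteq> 0" "\<And>s. s \<in> S \<Longrightarrow> c \<noteq> - F s / G s" by auto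
    have "F s + c * G s \<noteq> 0" if "s \<in> insert t S" for s
    proof (cases "s = t")
      case True
      thus ?thesis using \<open>F t = 0\<close> G c by simp
    next
      case False
      hence s: "s \<in> S" using that by auto
      show ?thesis
      proof (cases "G s = 0")
        case True
        thus ?thesis using F(2)[OF s] by simp
      next
        case False
        thus ?thesis using c(2)[OF s] by (auto simp: field_simps add_eq_0_iff)
      qed
    qed
    thus ?thesis using assms(3)[OF F(1) G(1)] by (intro bexI[of _ "\<lambda>x. F x + c * G x"]) auto
  qed
qed (use assms(2) in auto)

text \<open>Pointwise separation replaces sets of defining polynomials, so that closedness can be
  shown and used with polynomial functions alone.\<close>

lemma zariski_closed_iff:
  fixes S :: "(nat \<Rightarrow> 'a::comm_ring_1) set"
  shows "zariski_closed n S \<longleftrightarrow> S \<subseteq> affine_space n \<and>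
    (\<forall>x\<in>affine_space n - S. \<exists>F. polyfun n F \<and> (\<forall>y\<in>S. F y = 0) \<and> F x \<noteq> 0)"
proof
  assume "zariski_closed n S"
  then obtain P where P: "P \<subseteq> poly_ring n" "S = zero_locus n P" by (auto simp: zariski_closed_def)
  have "\<exists>F. polyfun n F \<and> (\<forall>y\<in>S. F y = 0) \<and> F x \<noteq> 0" if "x \<in> affine_space n - S" for x
  proof -
    from that obtain p where "p \<in> P" "evaluate p x \<noteq> 0" by (auto simp: P zero_locus_def)
    thus ?thesis using P by (intro exI[of _ "evaluate p"]) (auto simp: zero_locus_def intro: polyfun_mpoly_eval)
  qed
  thus "S \<subseteq> affine_space n \<and> (\<forall>x\<in>affine_space n - S. \<exists>F. polyfun n F \<and> (\<forall>y\<in>S. F y = 0) \<and> F x \<noteq> 0)"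
    by (auto simp: P zero_locus_def)
next
  assume S: "S \<subseteq> affine_space n \<and> (\<forall>x\<in>affine_space n - S. \<exists>F. polyfun n F \<and> (\<forall>y\<in>S. F y = 0) \<and> F x \<noteq> 0)"
  define P where "P = {p \<in> poly_ring n. \<forall>y\<in>S. evaluate p y = 0}"
  have "x \<in> S" if "x \<in> zero_locus n P" for x
  proof (rule ccontr)
    assume "x \<notin> S"
    moreover have "x \<in> affine_space n" using that by (simp add: zero_locus_def)
    ultimately obtain F where F: "polyfun n F" "\<And>y. y \<in> S \<Longrightarrow> F y = 0" "F x \<noteq> 0"
      using S by blast
    obtain p where p: "p \<in> poly_ring n" "\<And>y. evaluate p y = F y" using polyfun_imp_evaluate[OF F(1)] by blast
    hence "p \<in> P" using F by (auto simp: P_def)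
    thus False using that p F(3) by (auto simp: zero_locus_def)
  qed
  moreover have "S \<subseteq> zero_locus n P" using S by (auto simp: zero_locus_def P_def)
  ultimately show "zariski_closed n S" unfolding zariski_closed_def
    by (intro exI[of _ P]) (auto simp: P_def)
qed

lemma zariski_closed_separate:
  fixes S :: "(nat \<Rightarrow> 'a::comm_ring_1) set"
  assumes "zariski_closed n S" "x \<in> affine_space n" "x \<notin> S"
  obtains F where "polyfun n F" "\<And>y. y \<in> S \<Longrightarrow> F y = 0" "F x \<noteq> 0"
  using assms unfolding zariski_closed_iff by blast

lemma zariski_closed_subset: "zariski_closed n (S :: (nat \<Rightarrow> 'a::comm_ring_1) set) \<Longrightarrow> S \<subseteq> affine_space n"
  by (simp add: zariski_closed_iff)

lemma zariski_closed_Collect: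
  fixes F :: "'i \<Rightarrow> (nat \<Rightarrow> 'a::comm_ring_1) \<Rightarrow> 'a"
  assumes "\<And>i. i \<in> I \<Longrightarrow> polyfun n (F i)"
  shows "zariski_closed n {x \<in> affine_space n. \<forall>i\<in>I. F i x = 0}"
  unfolding zariski_closed_iff using assms by blast

lemma zariski_closed_Inter:
  fixes \<C> :: "(nat \<Rightarrow> 'a::comm_ring_1) set set"
  assumes "\<C> \<noteq> {}" "\<And>S. S \<in> \<C> \<Longrightarrow> zariski_closed n S"
  shows "zariski_closed n (\<Inter>\<C>)"
  unfolding zariski_closed_iff
proof (intro conjI ballI)
  show "\<Inter>\<C> \<subseteq> affine_space n" using assms zariski_closed_subset by blast
  fix x assume "x \<in> affine_space n - \<Inter>\<C>"
  then obtain S where S: "S \<in> \<C>" "x \<notin> S" "x \<in> affine_space n" by blast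
  then obtain F where "polyfun n F" "\<And>y. y \<in> S \<Longrightarrow> F y = 0" "F x \<noteq> 0"
    using zariski_closed_separate[OF assms(2)] by blast
  thus "\<exists>F. polyfun n F \<and> (\<forall>y\<in>\<Inter>\<C>. F y = 0) \<and> F x \<noteq> 0" using S(1) by blast
qed

lemma zariski_closed_Int:
  fixes S T :: "(nat \<Rightarrow> 'a::comm_ring_1) set"
  assumes "zariski_closed n S" "zariski_closed n T"
  shows "zariski_closed n (S \<inter> T)"
  using zariski_closed_Inter[of "{S, T}" n] assms by auto

lemma zariski_closed_preimage:
  fixes S :: "(nat \<Rightarrow> 'a::comm_ring_1) set"
  assumes "zariski_closed n S" "\<And>i. i < n \<Longrightarrow> polyfun n (\<lambda>x. \<phi> x i)"
    "\<And>x. x \<in> affine_space n \<Longrightarrow> \<phi> x \<in> affine_space n"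
  shows "zariski_closed n {x \<in> affine_space n. \<phi> x \<in> S}"
  unfolding zariski_closed_iff
proof (intro conjI ballI)
  fix x assume "x \<in> affine_space n - {x \<in> affine_space n. \<phi> x \<in> S}"
  hence "\<phi> x \<in> affine_space n" "\<phi> x \<notin> S" using assms(3) by auto
  then obtain F where "polyfun n F" "\<And>y. y \<in> S \<Longrightarrow> F y = 0" "F (\<phi> x) \<noteq> 0"
    by (rule zariski_closed_separate[OF assms(1)]) blast
  thus "\<exists>F. polyfun n F \<and> (\<forall>y\<in>{x \<in> affine_space n. \<phi> x \<in> S}. F y = 0) \<and> F x \<noteq> 0"
    using polyfun_compose[of n F n \<phi>] assms(2) by (intro exI[of _ "\<lambda>x. F (\<phi> x)"]) auto
qed auto

lemma zariski_irreducibleD: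
  fixes S :: "(nat \<Rightarrow> 'a::comm_ring_1) set"
  assumes "zariski_irreducible n S"
  shows "zariski_closed n S" "S \<noteq> {}"
    "zariski_closed n A \<Longrightarrow> zariski_closed n B \<Longrightarrow> S = A \<union> B \<Longrightarrow> S = A \<or> S = B"
  using assms by (auto simp: zariski_irreducible_def)

text \<open>The quotient map of affine space by the symmetric group. The shift of the index drops
  the coefficient of index 0, which is always 1.\<close>

definition esym_map :: "nat \<Rightarrow> (nat \<Rightarrow> 'a::comm_ring_1) \<Rightarrow> nat \<Rightarrow> 'a" where
  "esym_map n x = (\<lambda>i\<in>{..<n}. signed_esym n x (Suc i))"

lemma esym_map_affine: "esym_map n x \<in> affine_space n"
  by (auto simp: esym_map_def affine_space_def)

lemma polyfun_esym_map: "i < n \<Longrightarrow> polyfun n (\<lambda>x. esym_map n x i)"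
  by (simp add: esym_map_def polyfun_signed_esym)

lemma signed_esym_permute:
  assumes "\<pi> permutes {..<n}"
  shows "signed_esym n (x \<circ> \<pi>) = signed_esym n x"
  unfolding signed_esym_def using prod.permute[OF assms, of "\<lambda>i. [:1, - x i:]"] by (simp add: o_def)

lemma signed_esym_eq_imp_prod_eq:
  fixes x y :: "nat \<Rightarrow> 'a::idom"
  assumes "\<And>j. j \<le> n \<Longrightarrow> signed_esym n x j = signed_esym n y j"
  shows "(\<Prod>i<n. [:- x i, 1:]) = (\<Prod>i<n. [:- y i, 1:])"
proof (rule poly_eqI)
  fix k
  show "coeff (\<Prod>i<n. [:- x i, 1:]) k = coeff (\<Prod>i<n. [:- y i, 1:]) k"
  proof (cases "k \<le> n")
    case True
    hence "k = n - (n - k)" by simp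
    thus ?thesis using assms[of "n - k"] by (metis coeff_prod_linear_factors diff_le_self)
  next
    case False
    thus ?thesis using monic_prod_linear(1)[of "{..<n}" x] monic_prod_linear(1)[of "{..<n}" y]
      by (simp add: coeff_eq_0)
  qed
qed

text \<open>All points of a fibre have their coordinates among the roots of one and the same
  polynomial.\<close>

lemma finite_esym_map_fibre:
  fixes y :: "nat \<Rightarrow> 'a::idom"
  shows "finite {x \<in> affine_space n. esym_map n x = y}"
proof (cases "{x \<in> affine_space n. esym_map n x = y} = {}")
  case False
  then obtain x0 where x0: "esym_map n x0 = y" by blast
  have "x \<in> {..<n} \<rightarrow>\<^sub>E x0 ` {..<n}" if x: "x \<in> affine_space n" "esym_map n x = y" for x
  proof (rule PiE_I)
    fix i assume "i \<in> {..<n}"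
    have "signed_esym n x j = signed_esym n x0 j" if "j \<le> n" for j
    proof (cases j)
      case (Suc k)
      have "esym_map n x k = esym_map n x0 k" using x x0 by simp
      thus ?thesis using that Suc by (simp add: esym_map_def)
    qed simp
    hence "(\<Prod>i<n. [:- x i, 1:]) = (\<Prod>i<n. [:- x0 i, 1:])" by (rule signed_esym_eq_imp_prod_eq)
    hence "poly (\<Prod>k<n. [:- x0 k, 1:]) (x i) = poly (\<Prod>k<n. [:- x k, 1:]) (x i)" by simp
    also have "\<dots> = 0" using \<open>i \<in> {..<n}\<close> by (auto simp: poly_prod)
    finally show "x i \<in> x0 ` {..<n}" by (auto simp: poly_prod)
  qed (use x in \<open>auto simp: affine_space_def\<close>)
  thus ?thesis by (intro finite_subset[OF _ finite_PiE[of "{..<n}" "\<lambda>_. x0 ` {..<n}"]]) auto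
next
  case True
  show ?thesis unfolding True by simp
qed

text \<open>The preimage consists of the roots of the monic polynomial with lower coefficients
  \<open>y\<close>, so algebraic closedness is essential.\<close>

lemma esym_map_surj:
  fixes y :: "nat \<Rightarrow> complex"
  assumes "y \<in> affine_space n"
  shows "\<exists>x\<in>affine_space n. esym_map n x = y"
proof -
  define p where "p = monom 1 n + (\<Sum>j<n. monom (y j) (n - Suc j))"
  have coeff: "coeff p (n - Suc j) = y j" if "j < n" for j
  proof -
    have "coeff p (n - Suc j) = (\<Sum>i<n. if n - Suc i = n - Suc j then y i else 0)"
      using that by (simp add: p_def coeff_sum)
    also have "\<dots> = (\<Sum>i<n. if i = j then y i else 0)" using that by (intro sum.cong) auto
    finally show ?thesis using that by simp
  qed
  have "(\<Sum>j<n. if n - Suc j = n then y j else 0) = 0" by (intro sum.neutral) auto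
  hence top: "coeff p n = 1" by (simp add: p_def coeff_sum)
  have "degree p \<le> n" unfolding p_def
    by (intro degree_add_le degree_monom_le degree_sum_le) (auto intro: order.trans[OF degree_monom_le])
  hence deg: "degree p = n" using top by (intro antisym le_degree) auto
  hence "p \<noteq> 0" using top by auto
  then obtain A where A: "size A = degree p" "p = smult (lead_coeff p) (\<Prod>x\<in>#A. [:-x, 1:])"
    using alg_closed_imp_factorization by blast
  obtain xs where xs: "mset xs = A" using ex_mset by blast
  have len: "length xs = n" using A(1) xs deg by auto
  have "p = (\<Prod>x\<in>#A. [:-x, 1:])" using A(2) deg top by simp
  also have "\<dots> = prod_list (map (\<lambda>x. [:-x, 1:]) xs)" by (simp add: xs[symmetric] prod_mset_prod_list flip: mset_map)
  also have "\<dots> = (\<Prod>i<n. [:- xs ! i, 1:])"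
    by (subst prod.list_conv_set_nth) (simp add: len atLeast0LessThan)
  finally have p: "p = (\<Prod>i<n. [:- xs ! i, 1:])" .
  define x where "x = (\<lambda>i\<in>{..<n}. xs ! i)"
  have "p = (\<Prod>i<n. [:- x i, 1:])" unfolding p x_def by (intro prod.cong) auto
  hence "signed_esym n x (Suc j) = y j" if "j < n" for j
    using coeff_prod_linear_factors[of "Suc j" n x] coeff[OF that] that by simp
  hence "esym_map n x = y" using assms
    by (auto simp: esym_map_def affine_space_def fun_eq_iff PiE_def extensional_def restrict_def)
  thus ?thesis by (intro bexI[of _ x]) (auto simp: x_def affine_space_def)
qed

text \<open>
  A point outside the image is separated from it by the norm, the product over all permutations,
  of a polynomial that vanishes on \<open>D\<close> but nowhere on the fibre of the point.
\<close>

lemma zariski_closed_esym_map_image: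
  fixes D :: "(nat \<Rightarrow> complex) set"
  assumes "zariski_closed n D"
  shows "zariski_closed n (esym_map n ` D)"
  unfolding zariski_closed_iff
proof (intro conjI ballI)
  show "esym_map n ` D \<subseteq> affine_space n" using esym_map_affine by blast
  fix y assume y: "y \<in> affine_space n - esym_map n ` D"
  define \<Phi> where "\<Phi> = {x \<in> affine_space n. esym_map n x = y}"
  let ?I = "{F. polyfun n F \<and> (\<forall>x\<in>D. F x = 0)}"
  have "\<exists>F\<in>?I. \<forall>x\<in>\<Phi>. F x \<noteq> 0"
  proof (rule exists_nonvanishing)
    show "finite \<Phi>" unfolding \<Phi>_def by (rule finite_esym_map_fibre)
    show "?I \<noteq> {}" using polyfun_const[of n 0] by fastforce
    show "\<exists>F\<in>?I. F x \<noteq> 0" if "x \<in> \<Phi>" for x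
      using that y assms by (auto simp: \<Phi>_def zariski_closed_iff)
  qed (auto intro!: polyfun_intros)
  then obtain F where F: "polyfun n F" "\<And>x. x \<in> D \<Longrightarrow> F x = 0" "\<And>x. x \<in> \<Phi> \<Longrightarrow> F x \<noteq> 0" by blast
  let ?S = "{\<pi>. \<pi> permutes {..<n}}"
  define N where "N x = (\<Prod>\<pi>\<in>?S. F (x \<circ> \<pi>))" for x
  have "polyfun n N" unfolding N_def
  proof (rule polyfun_prod)
    fix \<pi> assume "\<pi> \<in> ?S"
    hence "\<pi> i < n" if "i < n" for i using permutes_in_image[of \<pi> "{..<n}" i] that by simp
    thus "polyfun n (\<lambda>x. F (x \<circ> \<pi>))"
      by (intro polyfun_compose[OF F(1)]) (auto intro!: polyfun_var)
  qed
  then obtain p where p: "p \<in> poly_ring n" "\<And>x. evaluate p x = N x" using polyfun_imp_evaluate by blast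
  have "N (x \<circ> \<sigma>) = N x" if "\<sigma> permutes {..<n}" for x \<sigma>
  proof -
    have "N (x \<circ> \<sigma>) = (\<Prod>\<pi>\<in>?S. F (x \<circ> (\<sigma> \<circ> \<pi>)))" by (simp add: N_def o_assoc)
    also have "\<dots> = N x" unfolding N_def
      by (rule prod.reindex_bij_witness[of _ "\<lambda>\<pi>. inv \<sigma> \<circ> \<pi>" "\<lambda>\<pi>. \<sigma> \<circ> \<pi>"])
        (use that in \<open>auto simp: permutes_compose permutes_inv o_assoc permutes_inv_o\<close>)
    finally show ?thesis .
  qed
  hence "esym_expressible n (total_degree p) (evaluate p)"
    using p by (intro symmetric_esym_expressible) auto
  then obtain \<Psi> where \<Psi>: "weighted_poly (total_degree p) \<Psi>" "\<And>x. N x = \<Psi> (signed_esym n x)"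
    using p by (auto simp: esym_expressible_def)
  \<comment> \<open>Rebuilds the whole coefficient sequence from a point of the quotient: 1 at index
    0 and 0 beyond \<open>n\<close>.\<close>
  define G where "G e j = (if j = 0 then 1 else if j \<le> n then e (j - 1) else 0)" for e :: "nat \<Rightarrow> complex" and j :: nat
  have G: "G (esym_map n x) = signed_esym n x" for x
    by (auto simp: G_def fun_eq_iff esym_map_def signed_esym_eq_0)
  have "polyfun n (\<lambda>e. G e j)" for j
    by (cases "j = 0"; cases "j \<le> n") (auto simp: G_def intro: polyfun_intros)
  hence poly: "polyfun n (\<lambda>e. \<Psi> (G e))" by (rule weighted_poly_imp_polyfun[OF \<Psi>(1)])
  have "\<Psi> (G e) = 0" if "e \<in> esym_map n ` D" for e
  proof -
    from that obtain x where x: "x \<in> D" "e = esym_map n x" by blast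
    hence "N x = 0" unfolding N_def using F(2)[OF x(1)]
      by (intro prod_zero bexI[of _ id]) (auto simp: finite_permutations permutes_id)
    thus ?thesis using \<Psi>(2) G x by simp
  qed
  moreover have "\<Psi> (G y) \<noteq> 0"
  proof -
    obtain x where x: "x \<in> affine_space n" "esym_map n x = y" using esym_map_surj y by blast
    have "x \<circ> \<pi> \<in> \<Phi>" if "\<pi> permutes {..<n}" for \<pi>
      using x that by (auto simp: \<Phi>_def esym_map_def signed_esym_permute affine_space_def PiE_def
          extensional_def permutes_not_in)
    hence "N x \<noteq> 0" unfolding N_def using F(3) by (subst prod_zero_iff) (auto simp: finite_permutations)
    thus ?thesis using \<Psi>(2) G x by metis
  qed
  ultimately show "\<exists>F. polyfun n F \<and> (\<forall>y\<in>esym_map n ` D. F y = 0) \<and> F y \<noteq> 0"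
    using poly by blast
qed

text \<open>A minimal closed subset of \<open>C\<close> with image \<open>Y\<close> is irreducible:
  if it is a union of two closed sets, their images are closed and cover \<open>Y\<close>, so one of
  them is \<open>Y\<close>, and minimality applies.\<close>

lemma lift_irreducible:
  fixes C Y :: "(nat \<Rightarrow> complex) set"
  assumes C: "zariski_closed n C" and Y: "zariski_irreducible n Y" "Y \<subseteq> esym_map n ` C"
  shows "\<exists>D\<subseteq>C. zariski_irreducible n D \<and> esym_map n ` D = Y"
proof -
  define \<D> where "\<D> = {D. zariski_closed n D \<and> D \<subseteq> C \<and> esym_map n ` D = Y}"
  have "\<exists>M\<in>\<D>. \<forall>X\<in>\<D>. X \<subseteq> M \<longrightarrow> X = M"
  proof (rule exists_minimal_closed_chain)
    have "zariski_closed n (C \<inter> {x \<in> affine_space n. esym_map n x \<in> Y})"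
      by (intro zariski_closed_Int C zariski_closed_preimage[OF zariski_irreducibleD(1)[OF Y(1)]]
          polyfun_esym_map esym_map_affine)
    hence "C \<inter> {x \<in> affine_space n. esym_map n x \<in> Y} \<in> \<D>"
      using Y(2) zariski_closed_subset[OF C] by (auto simp: \<D>_def)
    thus "\<D> \<noteq> {}" by blast
  next
    fix \<C> assume \<C>: "\<C> \<noteq> {}" "\<C> \<subseteq> \<D>" "\<And>A B. A \<in> \<C> \<Longrightarrow> B \<in> \<C> \<Longrightarrow> A \<subseteq> B \<or> B \<subseteq> A"
    \<comment> \<open>Finite fibres carry surjectivity over to the intersection of a chain: a member
      that meets the fibre in the fewest points shares these points with all other members.\<close>
    have "y \<in> esym_map n ` \<Inter>\<C>" if y: "y \<in> Y" for y
    proof -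
      define \<Phi> where "\<Phi> = {x \<in> affine_space n. esym_map n x = y}"
      have fin: "finite \<Phi>" unfolding \<Phi>_def by (rule finite_esym_map_fibre)
      obtain D where D: "D \<in> \<C>" "\<And>D'. D' \<in> \<C> \<Longrightarrow> card (\<Phi> \<inter> D) \<le> card (\<Phi> \<inter> D')"
        using arg_min_nat_lemma[of "\<lambda>D. D \<in> \<C>" _ "\<lambda>D. card (\<Phi> \<inter> D)"] \<C>(1) by blast
      have "\<Phi> \<inter> D \<subseteq> D'" if D': "D' \<in> \<C>" for D'
      proof (cases "D \<subseteq> D'")
        case False
        hence "\<Phi> \<inter> D' \<subseteq> \<Phi> \<inter> D" using \<C>(3)[OF D(1) D'] by auto
        hence "\<Phi> \<inter> D' = \<Phi> \<inter> D" using D(2)[OF D'] fin by (intro card_seteq) auto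
        thus ?thesis by blast
      qed auto
      moreover have "D \<in> \<D>" using D(1) \<C>(2) by blast
      hence "D \<subseteq> affine_space n" "esym_map n ` D = Y"
        using zariski_closed_subset[of n D] by (simp_all add: \<D>_def)
      hence "\<exists>x. x \<in> \<Phi> \<inter> D" using y by (auto simp: \<Phi>_def)
      ultimately obtain x where "x \<in> \<Phi>" "x \<in> \<Inter>\<C>" by blast
      thus ?thesis by (auto simp: \<Phi>_def)
    qed
    moreover have "esym_map n ` \<Inter>\<C> \<subseteq> Y" using \<C>(1,2) by (auto simp: \<D>_def)
    moreover have "zariski_closed n (\<Inter>\<C>)"
      using \<C>(1,2) by (intro zariski_closed_Inter) (auto simp: \<D>_def)
    moreover have "\<Inter>\<C> \<subseteq> C" using \<C>(1,2) unfolding \<D>_def by blast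
    ultimately show "\<Inter>\<C> \<in> \<D>" unfolding \<D>_def by blast
  qed
  then obtain D where D: "D \<in> \<D>" "\<And>X. X \<in> \<D> \<Longrightarrow> X \<subseteq> D \<Longrightarrow> X = D" by blast
  have "zariski_irreducible n D" unfolding zariski_irreducible_def
  proof (intro conjI allI impI)
    show "zariski_closed n D" using D(1) by (simp add: \<D>_def)
    show "D \<noteq> {}" using D(1) zariski_irreducibleD(2)[OF Y(1)] by (auto simp: \<D>_def)
    fix A B assume AB: "zariski_closed n A" "zariski_closed n B" "D = A \<union> B"
    have "Y = esym_map n ` A \<union> esym_map n ` B" using D(1) AB(3) by (auto simp: \<D>_def)
    hence "Y = esym_map n ` A \<or> Y = esym_map n ` B"
      using AB by (intro zariski_irreducibleD(3)[OF Y(1)] zariski_closed_esym_map_image)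
    hence "A \<in> \<D> \<or> B \<in> \<D>" using AB D(1) by (auto simp: \<D>_def)
    thus "D = A \<or> D = B" using D(2) AB(3) by blast
  qed
  thus ?thesis using D(1) by (auto simp: \<D>_def)
qed

text \<open>Lifting goes from the top down: the largest set is lifted first and the remaining ones
  inside that lift. Strictness is inherited from the images.\<close>

lemma lift_chain:
  fixes C :: "(nat \<Rightarrow> complex) set"
  assumes "zariski_closed n C" "\<And>k. k \<le> d \<Longrightarrow> zariski_irreducible n (Y k)"
    "\<And>k. k < d \<Longrightarrow> Y k \<subset> Y (Suc k)" "Y d \<subseteq> esym_map n ` C"
  shows "\<exists>D. (\<forall>k\<le>d. zariski_irreducible n (D k) \<and> D k \<subseteq> C \<and> esym_map n ` D k = Y k) \<and>
    (\<forall>k<d. D k \<subset> D (Suc k))"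
  using assms
proof (induction d arbitrary: C)
  case 0
  then obtain D where "D \<subseteq> C" "zariski_irreducible n D" "esym_map n ` D = Y 0"
    using lift_irreducible[of n C "Y 0"] by auto
  thus ?case by (intro exI[of _ "\<lambda>_. D"]) auto
next
  case (Suc d)
  obtain T where T: "T \<subseteq> C" "zariski_irreducible n T" "esym_map n ` T = Y (Suc d)"
    using lift_irreducible[OF Suc.prems(1) Suc.prems(2) Suc.prems(4)] by auto
  have "\<exists>D. (\<forall>k\<le>d. zariski_irreducible n (D k) \<and> D k \<subseteq> T \<and> esym_map n ` D k = Y k) \<and>
    (\<forall>k<d. D k \<subset> D (Suc k))"
    using Suc.prems(2,3) T(3) by (intro Suc.IH zariski_irreducibleD(1)[OF T(2)]) auto
  then obtain D where D: "\<And>k. k \<le> d \<Longrightarrow> zariski_irreducible n (D k) \<and> D k \<subseteq> T \<and> esym_map n ` D k = Y k"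
    "\<And>k. k < d \<Longrightarrow> D k \<subset> D (Suc k)"
    by blast
  define D' where "D' k = (if k \<le> d then D k else T)" for k
  have "D d \<subset> T" using D(1)[of d] T(3) Suc.prems(3)[of d] by auto
  hence "D' k \<subset> D' (Suc k)" if "k < Suc d" for k
    using that D(2)[of k] by (cases "k = d") (auto simp: D'_def)
  moreover have "zariski_irreducible n (D' k) \<and> D' k \<subseteq> C \<and> esym_map n ` D' k = Y k" if "k \<le> Suc d" for k
    using that D(1)[of k] T by (cases "k = Suc d") (auto simp: D'_def)
  ultimately show ?case by blast
qed


section \<open>Codimension\<close>

lemma polyfun_along_coordinate:
  fixes F :: "(nat \<Rightarrow> 'a::comm_ring_1) \<Rightarrow> 'a"
  assumes "polyfun n F"
  shows "\<exists>q. \<forall>c. F (y(k := c)) = poly q c"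
  using assms
proof induction
  case (polyfun_const c)
  show ?case by (intro exI[of _ "[:c:]"]) simp
next
  case (polyfun_var i)
  show ?case by (intro exI[of _ "if i = k then [:0, 1:] else [:y i:]"]) simp
next
  case (polyfun_add F G)
  then obtain p q where "\<And>c. F (y(k := c)) = poly p c" "\<And>c. G (y(k := c)) = poly q c" by blast
  thus ?case by (intro exI[of _ "p + q"]) (simp del: fun_upd_apply)
next
  case (polyfun_mult F G)
  then obtain p q where "\<And>c. F (y(k := c)) = poly p c" "\<And>c. G (y(k := c)) = poly q c" by blast
  thus ?case by (intro exI[of _ "p * q"]) (simp del: fun_upd_apply)
qed

lemma affine_space_upd: "y \<in> affine_space n \<Longrightarrow> k < n \<Longrightarrow> y(k := c) \<in> affine_space n"
  by (auto simp: affine_space_def PiE_def extensional_def)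

text \<open>Intended for \<open>S\<close> inside the hyperplane where coordinate \<open>k\<close> is
  0; this coordinate is then set free.\<close>

definition cylinder :: "nat \<Rightarrow> nat \<Rightarrow> (nat \<Rightarrow> 'a::zero) set \<Rightarrow> (nat \<Rightarrow> 'a) set" where
  "cylinder n k S = {y \<in> affine_space n. y(k := 0) \<in> S}"

text \<open>A line not contained in a closed set meets it in finitely many points, so every line
  over \<open>S\<close> lies entirely in \<open>A\<close> or entirely in \<open>B\<close>. The base
  points of either kind, \<open>sl A\<close> and \<open>sl B\<close>, form closed sets, and
  irreducibility of \<open>S\<close> selects one of them.\<close>

lemma zariski_irreducible_cylinder:
  fixes S :: "(nat \<Rightarrow> 'a::field_char_0) set"
  assumes S: "zariski_irreducible n S" and k: "k < n" and S0: "\<And>y. y \<in> S \<Longrightarrow> y k = 0"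
  shows "zariski_irreducible n (cylinder n k S)"
  unfolding zariski_irreducible_def
proof (intro conjI allI impI)
  have upd: "polyfun n (\<lambda>y. (y(k := c)) i)" if "i < n" for i and c :: 'a
    using that by (cases "i = k") (auto intro: polyfun_intros)
  show "zariski_closed n (cylinder n k S)" unfolding cylinder_def
    by (intro zariski_closed_preimage zariski_irreducibleD(1)[OF S] upd affine_space_upd k)
  have SC: "S \<subseteq> cylinder n k S"
  proof
    fix y assume y: "y \<in> S"
    hence "y(k := 0) = y" using S0 by auto
    thus "y \<in> cylinder n k S"
      using y zariski_closed_subset[OF zariski_irreducibleD(1)[OF S]] by (auto simp: cylinder_def)
  qed
  thus "cylinder n k S \<noteq> {}" using zariski_irreducibleD(2)[OF S] by blast
  fix A B assume A: "zariski_closed n A" and B: "zariski_closed n B" and AB: "cylinder n k S = A \<union> B"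
  define sl where "sl T = {y \<in> S. \<forall>c. y(k := c) \<in> T}" for T
  have closed: "zariski_closed n (sl T)" if "zariski_closed n T" for T
  proof -
    have eq: "sl T = S \<inter> (\<Inter>c. {y \<in> affine_space n. y(k := c) \<in> T})"
      using zariski_closed_subset[OF zariski_irreducibleD(1)[OF S]] by (auto simp: sl_def)
    have "zariski_closed n (\<Inter>c. {y \<in> affine_space n. y(k := c) \<in> T})"
      by (rule zariski_closed_Inter) (auto intro!: zariski_closed_preimage that upd affine_space_upd k)
    from zariski_closed_Int[OF zariski_irreducibleD(1)[OF S] this] show ?thesis unfolding eq .
  qed
  have "y \<in> sl A \<or> y \<in> sl B" if y: "y \<in> S" for y
  proof (rule ccontr)
    assume "\<not> (y \<in> sl A \<or> y \<in> sl B)"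
    then obtain a b where ab: "y(k := a) \<notin> A" "y(k := b) \<notin> B" using y by (auto simp: sl_def)
    have "y \<in> affine_space n" using y zariski_closed_subset[OF zariski_irreducibleD(1)[OF S]] by blast
    hence aff: "y(k := c) \<in> affine_space n" for c using k by (rule affine_space_upd)
    obtain F where F: "polyfun n F" "\<And>x. x \<in> A \<Longrightarrow> F x = 0" "F (y(k := a)) \<noteq> 0"
      by (rule zariski_closed_separate[OF A aff ab(1)]) blast
    obtain G where G: "polyfun n G" "\<And>x. x \<in> B \<Longrightarrow> G x = 0" "G (y(k := b)) \<noteq> 0"
      by (rule zariski_closed_separate[OF B aff ab(2)]) blast
    obtain p q where pq: "\<And>c. F (y(k := c)) = poly p c" "\<And>c. G (y(k := c)) = poly q c"
      using polyfun_along_coordinate[OF F(1), of y k] polyfun_along_coordinate[OF G(1), of y k] by blast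
    have "p * q \<noteq> 0" using F(3) G(3) pq by auto
    hence "finite {c. poly (p * q) c = 0}" by (rule poly_roots_finite)
    then obtain c where "poly (p * q) c \<noteq> 0" using ex_new_if_finite[OF infinite_UNIV_char_0] by blast
    hence "F (y(k := c)) \<noteq> 0" "G (y(k := c)) \<noteq> 0" using pq by auto
    hence "y(k := c) \<notin> A \<union> B" using F(2) G(2) by blast
    moreover have "y(k := 0) = y" using S0[OF y] by auto
    hence "y(k := c) \<in> cylinder n k S" using aff y by (simp add: cylinder_def)
    ultimately show False using AB by blast
  qed
  hence "S = sl A \<union> sl B" by (auto simp: sl_def)
  hence or: "S = sl A \<or> S = sl B" using zariski_irreducibleD(3)[OF S closed[OF A] closed[OF B]] by blast
  have sub: "cylinder n k S \<subseteq> T" if "S = sl T" for T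
  proof
    fix y assume "y \<in> cylinder n k S"
    hence "y(k := 0) \<in> sl T" using that by (simp add: cylinder_def)
    hence "(y(k := 0))(k := y k) \<in> T" unfolding sl_def by blast
    thus "y \<in> T" by simp
  qed
  from or show "cylinder n k S = A \<or> cylinder n k S = B"
  proof
    assume "S = sl A"
    thus ?thesis using sub[of A] AB by blast
  next
    assume "S = sl B"
    thus ?thesis using sub[of B] AB by blast
  qed
qed

primrec cylinders :: "nat \<Rightarrow> nat \<Rightarrow> nat \<Rightarrow> (nat \<Rightarrow> 'a::zero) set \<Rightarrow> (nat \<Rightarrow> 'a) set" where
  "cylinders n m 0 S = S"
| "cylinders n m (Suc j) S = cylinder n (m + j) (cylinders n m j S)"

lemma cylinders_mono: "S \<subseteq> T \<Longrightarrow> cylinders n m j S \<subseteq> cylinders n m j T"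
  by (induction j) (auto simp: cylinder_def)

lemma cylinders_base: "y \<in> cylinders n m j S \<Longrightarrow> \<exists>s\<in>S. \<forall>i<m. y i = s i"
proof (induction j arbitrary: y)
  case (Suc j)
  hence "y(m + j := 0) \<in> cylinders n m j S" by (simp add: cylinder_def)
  from Suc.IH[OF this] show ?case by auto
qed auto

lemma cylinders_zero:
  assumes "\<And>s i. s \<in> S \<Longrightarrow> m \<le> i \<Longrightarrow> i < n \<Longrightarrow> s i = 0" "y \<in> cylinders n m j S" "m + j \<le> i" "i < n"
  shows "y i = 0"
  using assms(2-)
proof (induction j arbitrary: y)
  case (Suc j)
  hence "y(m + j := 0) \<in> cylinders n m j S" by (simp add: cylinder_def)
  from Suc.IH[OF this] Suc.prems show ?case by auto
qed (use assms(1) in auto)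

lemma cylinders_irreducible:
  fixes S :: "(nat \<Rightarrow> 'a::field_char_0) set"
  assumes "zariski_irreducible n S" "\<And>s i. s \<in> S \<Longrightarrow> m \<le> i \<Longrightarrow> i < n \<Longrightarrow> s i = 0" "m + j \<le> n"
  shows "zariski_irreducible n (cylinders n m j S)"
  using assms(3)
proof (induction j)
  case (Suc j)
  have "y (m + j) = 0" if "y \<in> cylinders n m j S" for y
    using cylinders_zero[of S m n y j "m + j"] assms(2) that Suc.prems by auto
  thus ?case using Suc by (auto intro!: zariski_irreducible_cylinder)
qed (use assms in simp)

lemma cylinders_strict:
  fixes S :: "(nat \<Rightarrow> 'a::field_char_0) set"
  assumes "zariski_irreducible n S" "\<And>s i. s \<in> S \<Longrightarrow> m \<le> i \<Longrightarrow> i < n \<Longrightarrow> s i = 0" "m + j < n"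
  shows "cylinders n m j S \<subset> cylinders n m (Suc j) S"
proof -
  have irr: "zariski_irreducible n (cylinders n m j S)"
    using assms by (intro cylinders_irreducible) auto
  have aff: "cylinders n m j S \<subseteq> affine_space n"
    by (rule zariski_closed_subset[OF zariski_irreducibleD(1)[OF irr]])
  have zero: "y (m + j) = 0" if "y \<in> cylinders n m j S" for y
    using cylinders_zero[of S m n y j "m + j"] assms(2,3) that by auto
  hence upd: "y(m + j := 0) = y" if "y \<in> cylinders n m j S" for y using that by auto
  obtain y where y: "y \<in> cylinders n m j S" using zariski_irreducibleD(2)[OF irr] by blast
  have "y(m + j := 1) \<in> affine_space n"
    using y aff affine_space_upd[of y n "m + j" 1] assms(3) by blast
  hence "y(m + j := 1) \<in> cylinders n m (Suc j) S"
    using y upd[OF y] by (simp add: cylinder_def)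
  moreover have "y(m + j := 1) \<notin> cylinders n m j S" using zero by force
  ultimately show ?thesis using upd aff by (auto simp: cylinder_def)
qed

text \<open>
  A minimal closed set on which the coordinate takes infinitely many values is irreducible;
  that minimal sets exist follows from the Nullstellensatz, applied to the union of a chain of
  vanishing ideals.
\<close>

lemma exists_irreducible_infinite_coordinate:
  fixes W :: "(nat \<Rightarrow> complex) set"
  assumes W: "zariski_closed n W" and i: "i < n" and inf: "infinite ((\<lambda>y. y i) ` W)"
  shows "\<exists>Z\<subseteq>W. zariski_irreducible n Z \<and> infinite ((\<lambda>y. y i) ` Z)"
proof -
  define \<D> where "\<D> = {D. zariski_closed n D \<and> D \<subseteq> W \<and> infinite ((\<lambda>y. y i) ` D)}"
  have "\<exists>M\<in>\<D>. \<forall>X\<in>\<D>. X \<subseteq> M \<longrightarrow> X = M"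
  proof (rule exists_minimal_closed_chain)
    show "\<D> \<noteq> {}" using W inf by (auto simp: \<D>_def)
    fix \<C> assume \<C>: "\<C> \<noteq> {}" "\<C> \<subseteq> \<D>" "\<And>A B. A \<in> \<C> \<Longrightarrow> B \<in> \<C> \<Longrightarrow> A \<subseteq> B \<or> B \<subseteq> A"
    have closed: "zariski_closed n D" if "D \<in> \<C>" for D using that \<C>(2) by (auto simp: \<D>_def)
    have "infinite ((\<lambda>y. y i) ` \<Inter>\<C>)"
    proof
      assume fin: "finite ((\<lambda>y. y i) ` \<Inter>\<C>)"
      define I where "I D = {F. polyfun n F \<and> (\<forall>y\<in>D. F y = 0)}" for D :: "(nat \<Rightarrow> complex) set"
      have "fun_ideal n (\<Union>(I ` \<C>))"
      proof (rule fun_ideal_Union_chain)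
        show "I ` \<C> \<noteq> {}" using \<C>(1) by simp
        show "fun_ideal n J" if "J \<in> I ` \<C>" for J
          using that by (auto simp: I_def fun_ideal_def intro: polyfun_intros)
        show "A \<subseteq> B \<or> B \<subseteq> A" if "A \<in> I ` \<C>" "B \<in> I ` \<C>" for A B
        proof -
          from that obtain D E where DE: "A = I D" "B = I E" "D \<in> \<C>" "E \<in> \<C>" by blast
          have "D \<subseteq> E \<or> E \<subseteq> D" using \<C>(3) DE by blast
          thus ?thesis unfolding DE I_def by blast
        qed
      qed
      moreover have "(\<lambda>y. y i) ` fun_zeros (\<Union>(I ` \<C>)) \<subseteq> (\<lambda>y. y i) ` \<Inter>\<C>"
      proof
        fix a assume "a \<in> (\<lambda>y. y i) ` fun_zeros (\<Union>(I ` \<C>))"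
        then obtain y where y: "y \<in> fun_zeros (\<Union>(I ` \<C>))" "a = y i" by blast
        define z where "z = restrict y {..<n}"
        have z: "z \<in> affine_space n" "z i = a" using i y(2) by (auto simp: z_def affine_space_def)
        have "z \<in> D" if D: "D \<in> \<C>" for D
        proof (rule ccontr)
          assume "z \<notin> D"
          then obtain F where F: "polyfun n F" "\<And>x. x \<in> D \<Longrightarrow> F x = 0" "F z \<noteq> 0"
            by (rule zariski_closed_separate[OF closed[OF D] z(1)]) blast
          have "F z = F y" by (rule polyfun_cong[OF F(1)]) (simp add: z_def)
          moreover have "F \<in> I D" using F by (simp add: I_def)
          hence "F y = 0" using y(1) D by (auto simp: fun_zeros_def)
          ultimately show False using F(3) by simp
        qed
        thus "a \<in> (\<lambda>y. y i) ` \<Inter>\<C>" using z(2) by blast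
      qed
      hence "finite ((\<lambda>y. y i) ` fun_zeros (\<Union>(I ` \<C>)))" using fin finite_subset by blast
      hence "uncountable (- (\<lambda>y. y i) ` fun_zeros (\<Union>(I ` \<C>)))"
        unfolding Compl_eq_Diff_UNIV
        by (intro uncountable_minus_countable uncountable_UNIV_complex countable_finite)
      \<comment> \<open>The relation lies in the vanishing ideal of a single member \<open>D\<close>
        of the chain, whose coordinate \<open>i\<close> would then take only finitely many
        values.\<close>
      ultimately have "\<exists>q. q \<noteq> 0 \<and> (\<lambda>y. poly q (y i)) \<in> \<Union>(I ` \<C>)"
        using i by (intro algebraic_mod_ideal polyfun_var)
      then obtain q D where q: "q \<noteq> 0" "D \<in> \<C>" "(\<lambda>y. poly q (y i)) \<in> I D" by blast
      have "(\<lambda>y. y i) ` D \<subseteq> {c. poly q c = 0}" using q(3) by (auto simp: I_def)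
      hence "finite ((\<lambda>y. y i) ` D)" using poly_roots_finite[OF q(1)] finite_subset by blast
      thus False using q(2) \<C>(2) by (auto simp: \<D>_def)
    qed
    moreover have "\<Inter>\<C> \<subseteq> W" using \<C>(1,2) unfolding \<D>_def by blast
    ultimately show "\<Inter>\<C> \<in> \<D>" using zariski_closed_Inter[OF \<C>(1) closed] by (simp add: \<D>_def)
  qed
  then obtain Z where Z: "Z \<in> \<D>" "\<And>X. X \<in> \<D> \<Longrightarrow> X \<subseteq> Z \<Longrightarrow> X = Z" by blast
  have "zariski_irreducible n Z" unfolding zariski_irreducible_def
  proof (intro conjI allI impI)
    show "zariski_closed n Z" using Z(1) by (simp add: \<D>_def)
    show "Z \<noteq> {}" using Z(1) by (auto simp: \<D>_def)
    fix A B assume AB: "zariski_closed n A" "zariski_closed n B" "Z = A \<union> B"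
    have "infinite ((\<lambda>y. y i) ` A) \<or> infinite ((\<lambda>y. y i) ` B)"
      using Z(1) AB(3) by (auto simp: \<D>_def image_Un)
    hence "A \<in> \<D> \<or> B \<in> \<D>" using AB Z(1) by (auto simp: \<D>_def)
    thus "Z = A \<or> Z = B" using Z(2) AB(3) by blast
  qed
  thus ?thesis using Z(1) by (auto simp: \<D>_def)
qed

lemma zariski_singleton:
  fixes z :: "nat \<Rightarrow> 'a::comm_ring_1"
  assumes "z \<in> affine_space n"
  shows "zariski_irreducible n {z}"
proof -
  have "{z} = {x \<in> affine_space n. \<forall>i\<in>{..<n}. x i - z i = 0}"
    using assms by (auto simp: affine_space_def intro!: PiE_ext[of _ "{..<n}" "\<lambda>_. UNIV"])
  moreover have "zariski_closed n {x \<in> affine_space n. \<forall>i\<in>{..<n}. x i - z i = 0}"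
    by (rule zariski_closed_Collect) (auto intro!: polyfun_intros)
  ultimately have "zariski_closed n {z}" by simp
  thus ?thesis unfolding zariski_irreducible_def singleton_Un_iff by blast
qed

text \<open>A finite codimension excludes the empty set, whose dimension is
  \<open>-\<infinity>\<close>. So some chain exists, and \<open>n - m\<close> is a nonnegative
  number that bounds the length of every chain.\<close>

lemma zariski_codim_eqD:
  fixes V :: "(nat \<Rightarrow> complex) set"
  assumes "zariski_codim n V = ereal (real m)"
  shows "m \<le> n"
    "\<lbrakk>\<And>k. k \<le> d \<Longrightarrow> zariski_irreducible n (D k) \<and> D k \<subseteq> V; \<And>k. k < d \<Longrightarrow> D k \<subset> D (Suc k)\<rbrakk> \<Longrightarrow> d \<le> n - m"
proof -
  let ?X = "{ereal (real d) | d. \<exists>Z. (\<forall>i\<le>d. zariski_irreducible n (Z i) \<and> Z i \<subseteq> V) \<and> (\<forall>i<d. Z i \<subset> Z (Suc i))}"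
  have dim: "zariski_dim n V = ereal (real n - real m)"
    using assms unfolding zariski_codim_def by (cases "zariski_dim n V") auto
  have "?X \<noteq> {}"
  proof
    assume "?X = {}"
    hence "zariski_dim n V = -\<infinity>" unfolding zariski_dim_def by (simp only: Sup_empty bot_ereal_def)
    thus False using dim by simp
  qed
  then obtain x where x: "x \<in> ?X" by blast
  hence "x \<le> zariski_dim n V" "0 \<le> x" unfolding zariski_dim_def by (auto intro: Sup_upper)
  hence "0 \<le> zariski_dim n V" by (rule order.trans[rotated])
  thus mn: "m \<le> n" unfolding dim by simp
  assume "\<And>k. k \<le> d \<Longrightarrow> zariski_irreducible n (D k) \<and> D k \<subseteq> V" "\<And>k. k < d \<Longrightarrow> D k \<subset> D (Suc k)"
  hence "ereal (real d) \<in> ?X" by blast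
  hence "ereal (real d) \<le> zariski_dim n V" unfolding zariski_dim_def by (rule Sup_upper)
  thus "d \<le> n - m" unfolding dim using mn by simp
qed

text \<open>
  If the zero set of the \<open>\<Gamma> j\<close> in \<open>m\<close>-space were infinite, it would contain an irreducible \<open>Z\<close> that is
  not a point, and its cylinders would lift to a chain of length \<open>n - m + 1\<close> in \<open>V\<close>.
\<close>

lemma codim_imp_finite_esym:
  fixes V :: "(nat \<Rightarrow> complex) set" and \<Gamma> :: "nat \<Rightarrow> (nat \<Rightarrow> complex) \<Rightarrow> complex"
  assumes codim: "zariski_codim n V = ereal (real m)"
    and V: "V = {x \<in> affine_space n. \<forall>j<m. \<Gamma> j (esym_map n x) = 0}"
    and \<Gamma>: "\<And>j. j < m \<Longrightarrow> polyfun m (\<Gamma> j)" and i: "i < m"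
  shows "finite ((\<lambda>x. signed_esym n x (Suc i)) ` V)"
proof (rule ccontr)
  assume inf: "infinite ((\<lambda>x. signed_esym n x (Suc i)) ` V)"
  have mn: "m \<le> n" by (rule zariski_codim_eqD(1)[OF codim])
  have \<Gamma>n: "polyfun n (\<Gamma> j)" if "j < m" for j using \<Gamma>[OF that] mn polyfun_mono by blast
  define W where "W = {y \<in> affine_space n. \<forall>j\<in>{..<m}. \<Gamma> j y = 0} \<inter> {y \<in> affine_space n. \<forall>i\<in>{m..<n}. y i = 0}"
  have W: "zariski_closed n W" unfolding W_def
    by (intro zariski_closed_Int zariski_closed_Collect) (auto intro: \<Gamma>n polyfun_var)
  have "(\<lambda>x. signed_esym n x (Suc i)) ` V \<subseteq> (\<lambda>y. y i) ` W"
  proof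
    fix c assume "c \<in> (\<lambda>x. signed_esym n x (Suc i)) ` V"
    then obtain x where x: "x \<in> V" "c = signed_esym n x (Suc i)" by blast
    \<comment> \<open>Truncation to the first \<open>m\<close> coordinates, which are all that the
      \<open>\<Gamma> j\<close> can see.\<close>
    define y where "y k = (if m \<le> k \<and> k < n then 0 else esym_map n x k)" for k
    have "\<Gamma> j y = 0" if "j < m" for j
    proof -
      have "\<Gamma> j y = \<Gamma> j (esym_map n x)" by (rule polyfun_cong[OF \<Gamma>[OF that]]) (simp add: y_def)
      thus ?thesis using x that by (simp add: V)
    qed
    moreover have "y \<in> affine_space n"
      using esym_map_affine[of n x] by (auto simp: y_def affine_space_def PiE_def extensional_def)
    ultimately have "y \<in> W" by (auto simp: W_def y_def)
    moreover have "c = y i" using x i mn by (simp add: y_def esym_map_def)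
    ultimately show "c \<in> (\<lambda>y. y i) ` W" by blast
  qed
  hence "infinite ((\<lambda>y. y i) ` W)" using inf finite_subset by blast
  then obtain Z where Z: "Z \<subseteq> W" "zariski_irreducible n Z" "infinite ((\<lambda>y. y i) ` Z)"
    using exists_irreducible_infinite_coordinate[OF W, of i] i mn by auto
  obtain z where z: "z \<in> Z" using zariski_irreducibleD(2)[OF Z(2)] by blast
  have zaff: "z \<in> affine_space n" using z Z(1) by (auto simp: W_def)
  have Z0: "s k = 0" if "s \<in> Z" "m \<le> k" "k < n" for s k using that Z(1) by (auto simp: W_def)
  have zirr: "zariski_irreducible n {z}" by (rule zariski_singleton[OF zaff])
  define d where "d = n - m"
  \<comment> \<open>The first \<open>d\<close> inclusions free the coordinates from \<open>m\<close>
    on over the point \<open>z\<close>; the last one passes from \<open>z\<close> to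
    \<open>Z\<close>. This makes \<open>d + 1\<close> inclusions where only \<open>d = n - m\<close>
    are possible.\<close>
  define Y where "Y k = (if k \<le> d then cylinders n m k {z} else cylinders n m d Z)" for k
  have irr: "zariski_irreducible n (Y k)" if "k \<le> Suc d" for k
    using that z Z0 mn Z(2) zirr by (auto simp: Y_def d_def intro!: cylinders_irreducible)
  have strict: "Y k \<subset> Y (Suc k)" if "k < Suc d" for k
  proof (cases "k = d")
    case False
    thus ?thesis using that cylinders_strict[OF zirr, of m k] z Z0 mn by (auto simp: Y_def d_def)
  next
    case True
    obtain s where s: "s \<in> Z" "s \<noteq> z"
    proof (rule ccontr)
      assume "\<not> thesis"
      hence "Z \<subseteq> {z}" using that by blast
      thus False using Z(3) finite_subset[of Z "{z}"] by auto
    qed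
    have "Z \<subseteq> cylinders n m j Z" if "m + j \<le> n" for j
      using that
    proof (induction j)
      case (Suc j)
      have "cylinders n m j Z \<subset> cylinders n m (Suc j) Z"
        using Suc.prems Z0 by (intro cylinders_strict[OF Z(2)]) auto
      thus ?case using Suc by auto
    qed simp
    from this[of d] have "s \<in> cylinders n m d Z" using s(1) mn by (auto simp: d_def)
    moreover have "s \<notin> cylinders n m d {z}"
    proof
      assume "s \<in> cylinders n m d {z}"
      hence "\<forall>i<m. s i = z i" using cylinders_base by fastforce
      moreover have "s k = z k" if "m \<le> k" for k
      proof (cases "k < n")
        case True
        thus ?thesis using Z0[OF s(1) that] Z0[OF z that] by simp
      next
        case False
        moreover have "s \<in> affine_space n" using s(1) Z(1) by (auto simp: W_def)
        ultimately show ?thesis using zaff by (auto simp: affine_space_def PiE_def extensional_def)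
      qed
      ultimately show False using s(2) by (metis ext not_le)
    qed
    moreover have "cylinders n m d {z} \<subseteq> cylinders n m d Z" using z by (intro cylinders_mono) auto
    ultimately show ?thesis using True by (auto simp: Y_def)
  qed
  have Vcl: "zariski_closed n V"
  proof -
    have "V = {x \<in> affine_space n. \<forall>j\<in>{..<m}. \<Gamma> j (esym_map n x) = 0}" by (auto simp: V)
    moreover have "zariski_closed n {x \<in> affine_space n. \<forall>j\<in>{..<m}. \<Gamma> j (esym_map n x) = 0}"
      by (rule zariski_closed_Collect) (auto intro: polyfun_compose[OF \<Gamma>n] polyfun_esym_map)
    ultimately show ?thesis by simp
  qed
  \<comment> \<open>Freeing coordinates from \<open>m\<close> on leaves the
    \<open>\<Gamma> j\<close> at 0, so every preimage of a point of the top cylinder lies in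
    \<open>V\<close>.\<close>
  have "Y (Suc d) \<subseteq> esym_map n ` V"
  proof
    fix y assume y: "y \<in> Y (Suc d)"
    have "y \<in> affine_space n"
      using y zariski_closed_subset[OF zariski_irreducibleD(1)[OF irr[of "Suc d"]]] by auto
    then obtain x where x: "x \<in> affine_space n" "esym_map n x = y" using esym_map_surj by blast
    obtain s where s: "s \<in> Z" "\<And>i. i < m \<Longrightarrow> y i = s i"
      using y cylinders_base[of y n m d Z] by (auto simp: Y_def)
    have "\<Gamma> j y = 0" if "j < m" for j
    proof -
      have "\<Gamma> j y = \<Gamma> j s" by (rule polyfun_cong[OF \<Gamma>[OF that] s(2)])
      thus ?thesis using s(1) Z(1) that by (auto simp: W_def)
    qed
    thus "y \<in> esym_map n ` V" using x by (auto simp: V)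
  qed
  hence "\<exists>D. (\<forall>k\<le>Suc d. zariski_irreducible n (D k) \<and> D k \<subseteq> V \<and> esym_map n ` D k = Y k) \<and>
    (\<forall>k<Suc d. D k \<subset> D (Suc k))"
    using irr strict by (intro lift_chain[OF Vcl])
  then obtain D where D: "\<forall>k\<le>Suc d. zariski_irreducible n (D k) \<and> D k \<subseteq> V \<and> esym_map n ` D k = Y k"
    "\<forall>k<Suc d. D k \<subset> D (Suc k)"
    by blast
  have "Suc d \<le> n - m" by (rule zariski_codim_eqD(2)[OF codim, of _ D]) (use D in auto)
  thus False by (simp add: d_def)
qed


section \<open>Bounded zero sets\<close>

text \<open>\<open>Q\<close> vanishes at 0 and at every value of \<open>t\<close> other than
  \<open>t l\<close>. It has degree at most \<open>r\<close> and no constant term, so the weighted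
  sum of its values is a combination of the vanishing power sums; yet this sum equals
  \<open>poly Q (t l)\<close> times a positive total weight.\<close>

lemma weighted_power_sums_zero:
  fixes t :: "nat \<Rightarrow> complex" and w :: "nat \<Rightarrow> real"
  assumes w: "\<And>l. l < r \<Longrightarrow> 0 < w l"
    and zero: "\<And>k. 1 \<le> k \<Longrightarrow> k \<le> r \<Longrightarrow> (\<Sum>l<r. of_real (w l) * t l ^ k) = 0" and l: "l < r"
  shows "t l = 0"
proof (rule ccontr)
  assume tl: "t l \<noteq> 0"
  define A where "A = t ` {..<r} - {0, t l}"
  define Q where "Q = [:0, 1:] * (\<Prod>a\<in>A. [:- a, 1:])"
  have "finite A" by (simp add: A_def)
  have "insert (t l) A \<subseteq> t ` {..<r}" using l by (auto simp: A_def)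
  hence "card (insert (t l) A) \<le> card (t ` {..<r})" by (intro card_mono) auto
  also have "\<dots> \<le> r" using card_image_le[of "{..<r}" t] by simp
  finally have "Suc (card A) \<le> r" using \<open>finite A\<close> by (auto simp: A_def card_insert_if)
  hence deg: "degree Q \<le> r"
    using monic_prod_linear(1)[OF \<open>finite A\<close>, of "\<lambda>a. a"] unfolding Q_def
    by (intro order.trans[OF degree_mult_le]) simp
  have "(\<Sum>k<r. of_real (w k) * poly Q (t k)) = (\<Sum>k<r. \<Sum>i\<le>r. coeff Q i * (of_real (w k) * t k ^ i))"
  proof (intro sum.cong refl)
    fix k
    have "poly Q (t k) = (\<Sum>i\<le>r. coeff Q i * t k ^ i)"
      unfolding poly_altdef using deg by (intro sum.mono_neutral_left) (auto simp: coeff_eq_0)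
    thus "of_real (w k) * poly Q (t k) = (\<Sum>i\<le>r. coeff Q i * (of_real (w k) * t k ^ i))"
      by (simp add: sum_distrib_left mult_ac)
  qed
  also have "\<dots> = (\<Sum>i\<le>r. coeff Q i * (\<Sum>k<r. of_real (w k) * t k ^ i))"
    by (subst sum.swap) (simp add: sum_distrib_left)
  also have "\<dots> = 0"
  proof (rule sum.neutral, rule ballI)
    fix i assume "i \<in> {..r}"
    thus "coeff Q i * (\<Sum>k<r. of_real (w k) * t k ^ i) = 0"
      using zero[of i] by (cases "i = 0") (auto simp: Q_def)
  qed
  also have "(\<Sum>k<r. of_real (w k) * poly Q (t k)) = (\<Sum>k\<in>{k \<in> {..<r}. t k = t l}. of_real (w k) * poly Q (t l))"
  proof (rule sum.mono_neutral_cong_right)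
    show "\<forall>k\<in>{..<r} - {k \<in> {..<r}. t k = t l}. of_real (w k) * poly Q (t k) = 0"
    proof
      fix k assume "k \<in> {..<r} - {k \<in> {..<r}. t k = t l}"
      hence "t k = 0 \<or> t k \<in> A" by (auto simp: A_def)
      thus "of_real (w k) * poly Q (t k) = 0" using \<open>finite A\<close> by (auto simp: Q_def poly_prod)
    qed
  qed auto
  also have "\<dots> = of_real (\<Sum>k\<in>{k \<in> {..<r}. t k = t l}. w k) * poly Q (t l)"
    by (simp add: sum_distrib_right)
  finally have "of_real (\<Sum>k\<in>{k \<in> {..<r}. t k = t l}. w k) * poly Q (t l) = 0" .
  moreover have "(\<Sum>k\<in>{k \<in> {..<r}. t k = t l}. w k) > 0" using l w by (intro sum_pos) auto
  moreover have "poly Q (t l) \<noteq> 0" using tl \<open>finite A\<close> by (auto simp: Q_def poly_prod A_def)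
  ultimately show False by (simp del: of_real_sum)
qed

text \<open>By compactness the norms of the power sums have a positive minimal total on the unit
  sphere \<open>K\<close> of the maximum norm. Scaling a point by its norm \<open>M \<ge> 1\<close>
  multiplies the power sum of degree \<open>k\<close> by \<open>M ^ k\<close>, which is at least
  \<open>M\<close>.\<close>

lemma weighted_power_sums_bounded:
  fixes w :: "nat \<Rightarrow> real"
  assumes w: "\<And>l. l < r \<Longrightarrow> 0 < w l"
  shows "\<exists>B. \<forall>t :: nat \<Rightarrow> complex. (\<forall>k. 1 \<le> k \<longrightarrow> k \<le> r \<longrightarrow> norm (\<Sum>l<r. of_real (w l) * t l ^ k) \<le> C) \<longrightarrow>
    (\<forall>l<r. norm (t l) \<le> B)"
proof -
  define N where "N t = (\<Sum>k=1..r. norm (\<Sum>l<r. of_real (w l) * t l ^ k))" for t :: "nat \<Rightarrow> complex"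
  define K where "K = {t :: nat \<Rightarrow> complex. \<forall>i. t i \<in> (if i < r then cball 0 1 else {0})} \<inter>
    (\<Union>l\<in>{..<r}. {t. norm (t l) = 1})"
  have coord: "continuous_on S (\<lambda>t :: nat \<Rightarrow> complex. t l)" for S l
    by (rule continuous_on_subset[OF continuous_on_product_coordinates]) auto
  have "compact K" unfolding K_def
    by (intro compact_Int_closed compact_box closed_UN ballI closed_Collect_eq continuous_intros coord) auto
  have cont: "continuous_on K N" unfolding N_def by (intro continuous_intros coord)
  have scale: "\<exists>s\<in>K. \<exists>M\<ge>1. \<forall>l<r. t l = of_real M * s l \<and> norm (t l) \<le> M"
    if "l0 < r" "1 \<le> norm (t l0)" for t :: "nat \<Rightarrow> complex" and l0
  proof -
    define M where "M = Max ((\<lambda>l. norm (t l)) ` {..<r})"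
    have M: "norm (t l) \<le> M" if "l < r" for l unfolding M_def using that by (intro Max_ge) auto
    have "M \<ge> 1" using M[OF that(1)] that(2) by simp
    have "M \<in> (\<lambda>l. norm (t l)) ` {..<r}" unfolding M_def using that by (intro Max_in) auto
    then obtain l1 where l1: "l1 < r" "norm (t l1) = M" by auto
    define s where "s l = (if l < r then t l / of_real M else 0)" for l
    have "s \<in> K" using M \<open>M \<ge> 1\<close> l1 by (auto simp: K_def s_def norm_divide intro!: bexI[of _ l1])
    moreover have "\<forall>l<r. t l = of_real M * s l \<and> norm (t l) \<le> M" using M \<open>M \<ge> 1\<close> by (auto simp: s_def)
    ultimately show ?thesis using \<open>M \<ge> 1\<close> by blast
  qed
  show ?thesis
  proof (cases "K = {}")
    case True
    hence "norm (t l) < 1" if "l < r" for t :: "nat \<Rightarrow> complex" and l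
      using scale[OF that, of t] by (auto simp: not_less[symmetric])
    thus ?thesis by (intro exI[of _ 1]) (auto intro: less_imp_le)
  next
    case False
    then obtain s0 where s0: "s0 \<in> K" "\<And>s. s \<in> K \<Longrightarrow> N s0 \<le> N s"
      using continuous_attains_inf[OF \<open>compact K\<close> _ cont] by blast
    have "N s0 > 0"
    proof (rule ccontr)
      assume "\<not> N s0 > 0"
      moreover have "N s0 \<ge> 0" unfolding N_def by (intro sum_nonneg) auto
      ultimately have "N s0 = 0" by simp
      hence "(\<Sum>l<r. of_real (w l) * s0 l ^ k) = 0" if "1 \<le> k" "k \<le> r" for k
        using that unfolding N_def by (subst (asm) sum_nonneg_eq_0_iff) auto
      hence "s0 l = 0" if "l < r" for l using weighted_power_sums_zero[of r w s0 l] w that by blast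
      thus False using s0(1) by (auto simp: K_def)
    qed
    have "norm (t l) \<le> max 1 (real r * C / N s0)"
      if t: "\<And>k. 1 \<le> k \<Longrightarrow> k \<le> r \<Longrightarrow> norm (\<Sum>l<r. of_real (w l) * t l ^ k) \<le> C" and l: "l < r"
      for t :: "nat \<Rightarrow> complex" and l
    proof (cases "norm (t l) \<ge> 1")
      case True
      obtain s M where s: "s \<in> K" "M \<ge> 1" "\<And>l. l < r \<Longrightarrow> t l = of_real M * s l \<and> norm (t l) \<le> M"
        using scale[of l t, OF l True] by blast
      have "M * norm (\<Sum>l<r. of_real (w l) * s l ^ k) \<le> C" if k: "k \<in> {1..r}" for k
      proof -
        have "(\<Sum>l<r. of_real (w l) * t l ^ k) = of_real (M ^ k) * (\<Sum>l<r. of_real (w l) * s l ^ k)"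
          unfolding sum_distrib_left using s(3) by (intro sum.cong refl) (simp add: power_mult_distrib mult_ac)
        hence "M ^ k * norm (\<Sum>l<r. of_real (w l) * s l ^ k) \<le> C"
          using t[of k] k s(2) by (simp add: norm_mult norm_power)
        moreover have "M ^ 1 \<le> M ^ k" using s(2) k by (intro power_increasing) auto
        hence "M * norm (\<Sum>l<r. of_real (w l) * s l ^ k) \<le> M ^ k * norm (\<Sum>l<r. of_real (w l) * s l ^ k)"
          by (intro mult_right_mono) auto
        ultimately show ?thesis by linarith
      qed
      hence "(\<Sum>k=1..r. M * norm (\<Sum>l<r. of_real (w l) * s l ^ k)) \<le> (\<Sum>k=1..r. C)" by (rule sum_mono)
      hence "M * N s \<le> real r * C" by (simp add: N_def sum_distrib_left)
      moreover have "M * N s0 \<le> M * N s" using s0(2)[OF s(1)] s(2) by (intro mult_left_mono) auto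
      ultimately have "M \<le> real r * C / N s0" using \<open>N s0 > 0\<close> by (simp add: field_simps)
      thus ?thesis using s(3)[OF l] by linarith
    qed auto
    thus ?thesis by blast
  qed
qed

section \<open>Real relations from bounded complex zero sets\<close>

lemma polyfun_Re_Im:
  assumes "polyfun n F"
  shows "\<exists>A B. polyfun n A \<and> polyfun n B \<and> (\<forall>x. F (\<lambda>i. complex_of_real (x i)) = Complex (A x) (B x))"
  using assms
proof induction
  case (polyfun_const c)
  show ?case by (intro exI[of _ "\<lambda>_. Re c"] exI[of _ "\<lambda>_. Im c"]) (auto intro: polyfun_intros)
next
  case (polyfun_var i)
  thus ?case
    by (intro exI[of _ "\<lambda>x. x i"] exI[of _ "\<lambda>_. 0"]) (auto intro: polyfun_intros simp: complex_of_real_def)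
next
  case (polyfun_add F G)
  then obtain A B A' B' where "polyfun n A" "polyfun n B" "polyfun n A'" "polyfun n B'"
    "\<And>x. F (\<lambda>i. complex_of_real (x i)) = Complex (A x) (B x)"
    "\<And>x. G (\<lambda>i. complex_of_real (x i)) = Complex (A' x) (B' x)" by blast
  thus ?case
    by (intro exI[of _ "\<lambda>x. A x + A' x"] exI[of _ "\<lambda>x. B x + B' x"] conjI)
      (auto intro: polyfun_intros simp: complex_eq_iff)
next
  case (polyfun_mult F G)
  then obtain A B A' B' where "polyfun n A" "polyfun n B" "polyfun n A'" "polyfun n B'"
    "\<And>x. F (\<lambda>i. complex_of_real (x i)) = Complex (A x) (B x)"
    "\<And>x. G (\<lambda>i. complex_of_real (x i)) = Complex (A' x) (B' x)" by blast
  thus ?case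
    by (intro exI[of _ "\<lambda>x. A x * A' x - B x * B' x"] exI[of _ "\<lambda>x. A x * B' x + B x * A' x"] conjI)
      (auto intro!: polyfun_intros simp: complex_eq_iff)
qed

lemma poly_Re: "poly (map_poly Re q) x = Re (poly q (complex_of_real x))"
  by (induction q) (auto simp: map_poly_pCons)

lemma poly_Im: "poly (map_poly Im q) x = Im (poly q (complex_of_real x))"
  by (induction q) (auto simp: map_poly_pCons)

lemma mpoly_eval_of_real:
  "mpoly_eval complex_of_real (\<lambda>i. complex_of_real (x i)) p = complex_of_real (evaluate p x)"
  by (simp add: mpoly_eval_def)

text \<open>A bounded coordinate omits uncountably many complex values, so it is algebraic modulo
  the complex ideal of the constraints. At real points the relation splits into real and imaginary
  parts, and one of the two parts of \<open>q\<close> is nonzero.\<close>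

lemma bounded_imp_univariate_in_ideal:
  fixes p :: "nat \<Rightarrow> real mpoly"
  assumes p: "\<And>j. j < m \<Longrightarrow> p j \<in> poly_ring r" and i: "i < r"
    and bounded: "\<And>t. (\<forall>j<m. mpoly_eval complex_of_real t (p j) = 0) \<Longrightarrow> norm (t i) \<le> B"
  shows "\<exists>q H. q \<noteq> 0 \<and> (\<forall>j<m. polyfun r (H j)) \<and>
    (\<forall>x. poly q (x i) = (\<Sum>j<m. H j x * evaluate (p j) x))"
proof -
  let ?G = "\<lambda>j t. mpoly_eval complex_of_real t (p j)"
  define J where "J = {F. \<exists>H. (\<forall>j<m. polyfun r (H j)) \<and> F = (\<lambda>t. \<Sum>j<m. H j t * ?G j t)}"
  have Jid: "fun_ideal r J"
    unfolding fun_ideal_def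
  proof (intro conjI ballI allI impI)
    show "polyfun r F" if "F \<in> J" for F
      using that p by (auto simp: J_def intro!: polyfun_sum polyfun_mult polyfun_mpoly_eval)
    show "(\<lambda>x. 0) \<in> J" unfolding J_def by (auto intro!: exI[of _ "\<lambda>_ _. 0"] polyfun_const)
    show "(\<lambda>x. F x + F' x) \<in> J" if "F \<in> J" "F' \<in> J" for F F'
    proof -
      from that obtain H H' where "\<forall>j<m. polyfun r (H j)" "F = (\<lambda>t. \<Sum>j<m. H j t * ?G j t)"
        "\<forall>j<m. polyfun r (H' j)" "F' = (\<lambda>t. \<Sum>j<m. H' j t * ?G j t)" unfolding J_def by blast
      thus ?thesis unfolding J_def
        by (auto intro!: exI[of _ "\<lambda>j t. H j t + H' j t"] polyfun_add simp: sum.distrib distrib_right)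
    qed
    show "(\<lambda>x. K x * F x) \<in> J" if "F \<in> J" "polyfun r K" for F K
    proof -
      from that obtain H where "\<forall>j<m. polyfun r (H j)" "F = (\<lambda>t. \<Sum>j<m. H j t * ?G j t)"
        unfolding J_def by blast
      thus ?thesis unfolding J_def using that(2)
        by (auto intro!: exI[of _ "\<lambda>j t. K t * H j t"] polyfun_mult simp: sum_distrib_left mult.assoc)
    qed
  qed
  have "norm (t i) \<le> B" if t: "t \<in> fun_zeros J" for t
  proof (rule bounded, intro allI impI)
    fix j assume "j < m"
    \<comment> \<open>Each generator belongs to \<open>J\<close>, with the Kronecker symbol as
      multiplier.\<close>
    have "(\<Sum>k<m. (if k = j then 1 else 0) * ?G k t) = 0"
      using t unfolding fun_zeros_def J_def
      by (auto intro!: polyfun_const dest!: spec[of _ "\<lambda>t. \<Sum>k<m. (if k = j then 1 else 0) * ?G k t"]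
          spec[of _ "\<lambda>k _. if k = j then 1 else 0"])
    thus "?G j t = 0" using \<open>j < m\<close> by (simp add: if_distrib[of "\<lambda>c. c * _"] cong: if_cong)
  qed
  hence "- cball 0 B \<subseteq> - (\<lambda>t. t i) ` fun_zeros J" by auto
  moreover have "uncountable (- cball (0::complex) B)"
  proof
    assume "countable (- cball (0::complex) B)"
    moreover have "ball (of_real (\<bar>B\<bar> + 2)) 1 \<subseteq> - cball (0::complex) B"
    proof
      fix x :: complex assume "x \<in> ball (of_real (\<bar>B\<bar> + 2)) 1"
      hence "norm (of_real (\<bar>B\<bar> + 2) - x) < 1" by (simp add: dist_norm)
      moreover have "norm (complex_of_real (\<bar>B\<bar> + 2)) = \<bar>B\<bar> + 2" by (simp only: norm_of_real)
      ultimately show "x \<in> - cball 0 B"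
        using norm_triangle_ineq2[of "of_real (\<bar>B\<bar> + 2)" x] by auto
    qed
    ultimately show False using uncountable_ball[of 1 "of_real (\<bar>B\<bar> + 2) :: complex"] countable_subset by auto
  qed
  ultimately have "uncountable (- (\<lambda>t. t i) ` fun_zeros J)"
    using countable_subset[of "- cball 0 B" "- (\<lambda>t. t i) ` fun_zeros J"] by iprover
  then obtain q where q: "q \<noteq> 0" "(\<lambda>t. poly q (t i)) \<in> J"
    using algebraic_mod_ideal[OF Jid polyfun_var[OF i]] by blast
  then obtain H where H: "\<And>j. j < m \<Longrightarrow> polyfun r (H j)"
    "(\<lambda>t. poly q (t i)) = (\<lambda>t. \<Sum>j<m. H j t * ?G j t)" unfolding J_def by blast
  obtain A B where AB: "\<And>j. j < m \<Longrightarrow> polyfun r (A j)" "\<And>j. j < m \<Longrightarrow> polyfun r (B j)"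
    "\<And>j x. j < m \<Longrightarrow> H j (\<lambda>i. complex_of_real (x i)) = Complex (A j x) (B j x)"
    using polyfun_Re_Im[OF H(1)] by metis
  have eq: "poly q (complex_of_real (x i)) =
    Complex (\<Sum>j<m. A j x * evaluate (p j) x) (\<Sum>j<m. B j x * evaluate (p j) x)" for x
  proof -
    have "poly q (complex_of_real (x i)) = (\<Sum>j<m. Complex (A j x) (B j x) * complex_of_real (evaluate (p j) x))"
      using fun_cong[OF H(2), of "\<lambda>i. complex_of_real (x i)"] AB(3) by (simp add: mpoly_eval_of_real)
    thus ?thesis by (simp add: complex_eq_iff Re_sum Im_sum)
  qed
  have "map_poly Re q \<noteq> 0 \<or> map_poly Im q \<noteq> 0"
  proof (rule ccontr)
    assume "\<not> ?thesis"
    hence "coeff (map_poly Re q) k = 0" "coeff (map_poly Im q) k = 0" for k by simp_all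
    hence "coeff q k = 0" for k by (simp add: coeff_map_poly complex_eq_iff)
    thus False using q(1) by (simp add: poly_eq_iff)
  qed
  thus ?thesis
  proof
    assume "map_poly Re q \<noteq> 0"
    thus ?thesis using AB(1) eq by (intro exI[of _ "map_poly Re q"] exI[of _ A]) (auto simp: poly_Re)
  next
    assume "map_poly Im q \<noteq> 0"
    thus ?thesis using AB(2) eq by (intro exI[of _ "map_poly Im q"] exI[of _ B]) (auto simp: poly_Im)
  qed
qed


section \<open>Limits of positive functionals\<close>

text \<open>
  \<open>\<F>\<close> stands for the feasible functionals of the \<open>k\<close>-th relaxations as \<open>k\<close> tends to infinity. It may be
  the trivial filter, which is the case of eventual infeasibility.
\<close>

locale moment_filter =
  fixes r m :: nat and G :: "nat \<Rightarrow> (nat \<Rightarrow> real) \<Rightarrow> real"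
    and \<F> :: "(((nat \<Rightarrow> real) \<Rightarrow> real) \<Rightarrow> real) filter"
  assumes ev_add: "polyfun r F \<Longrightarrow> polyfun r H \<Longrightarrow> \<forall>\<^sub>F \<Lambda> in \<F>. \<Lambda> (\<lambda>x. F x + H x) = \<Lambda> F + \<Lambda> H"
    and ev_cmult: "polyfun r F \<Longrightarrow> \<forall>\<^sub>F \<Lambda> in \<F>. \<Lambda> (\<lambda>x. c * F x) = c * \<Lambda> F"
    and ev_one: "\<forall>\<^sub>F \<Lambda> in \<F>. \<Lambda> (\<lambda>x. 1) = 1"
    and ev_square: "polyfun r F \<Longrightarrow> \<forall>\<^sub>F \<Lambda> in \<F>. 0 \<le> \<Lambda> (\<lambda>x. (F x)\<^sup>2)"
    and ev_square_null: "polyfun r F \<Longrightarrow> \<forall>\<^sub>F \<Lambda> in \<F>. \<Lambda> (\<lambda>x. (F x)\<^sup>2) = 0 \<longrightarrow> \<Lambda> F = 0"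
    and polyfun_G: "j < m \<Longrightarrow> polyfun r (G j)"
    and ev_ideal: "j < m \<Longrightarrow> polyfun r H \<Longrightarrow> \<forall>\<^sub>F \<Lambda> in \<F>. \<Lambda> (\<lambda>x. H x * G j x) = 0"
begin

text \<open>Quantifying over all multipliers \<open>H\<close> makes this an ideal; how far out in
  the filter the value becomes 0 may depend on \<open>H\<close>.\<close>

definition null :: "((nat \<Rightarrow> real) \<Rightarrow> real) set" where
  "null = {F. polyfun r F \<and> (\<forall>H. polyfun r H \<longrightarrow> (\<forall>\<^sub>F \<Lambda> in \<F>. \<Lambda> (\<lambda>x. H x * F x) = 0))}"

lemma fun_ideal_null: "fun_ideal r null"
  unfolding fun_ideal_def
proof (intro conjI ballI allI impI)
  show "polyfun r F" if "F \<in> null" for F using that by (simp add: null_def)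
  have "\<forall>\<^sub>F \<Lambda> in \<F>. \<Lambda> (\<lambda>x. 0) = 0" using ev_cmult[of "\<lambda>_. 0" 0] polyfun_const[of r 0] by simp
  thus "(\<lambda>x. 0) \<in> null" by (auto simp: null_def intro: polyfun_const)
  show "(\<lambda>x. F x + K x) \<in> null" if "F \<in> null" "K \<in> null" for F K
    unfolding null_def
  proof (intro CollectI conjI allI impI)
    show "polyfun r (\<lambda>x. F x + K x)" using that by (auto simp: null_def intro: polyfun_intros)
    fix H :: "(nat \<Rightarrow> real) \<Rightarrow> real" assume H: "polyfun r H"
    hence "\<forall>\<^sub>F \<Lambda> in \<F>. \<Lambda> (\<lambda>x. H x * F x) = 0" "\<forall>\<^sub>F \<Lambda> in \<F>. \<Lambda> (\<lambda>x. H x * K x) = 0"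
      using that by (auto simp: null_def)
    moreover have "\<forall>\<^sub>F \<Lambda> in \<F>. \<Lambda> (\<lambda>x. H x * F x + H x * K x) = \<Lambda> (\<lambda>x. H x * F x) + \<Lambda> (\<lambda>x. H x * K x)"
      using that H by (intro ev_add polyfun_mult) (auto simp: null_def)
    ultimately show "\<forall>\<^sub>F \<Lambda> in \<F>. \<Lambda> (\<lambda>x. H x * (F x + K x)) = 0"
      by eventually_elim (simp add: distrib_left)
  qed
  show "(\<lambda>x. K x * F x) \<in> null" if "F \<in> null" "polyfun r K" for F K
    unfolding null_def
  proof (intro CollectI conjI allI impI)
    show "polyfun r (\<lambda>x. K x * F x)" using that by (auto simp: null_def intro: polyfun_intros)
    fix H :: "(nat \<Rightarrow> real) \<Rightarrow> real" assume H: "polyfun r H"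
    have "\<forall>\<^sub>F \<Lambda> in \<F>. \<Lambda> (\<lambda>x. (H x * K x) * F x) = 0"
      using that polyfun_mult[OF H that(2)] unfolding null_def by blast
    thus "\<forall>\<^sub>F \<Lambda> in \<F>. \<Lambda> (\<lambda>x. H x * (K x * F x)) = 0" by (simp add: mult.assoc)
  qed
qed

lemma null_polyfun: "F \<in> null \<Longrightarrow> polyfun r F"
  by (simp add: null_def)

lemma null_mult: "F \<in> null \<Longrightarrow> polyfun r H \<Longrightarrow> (\<lambda>x. H x * F x) \<in> null"
  by (rule fun_idealD(4)[OF fun_ideal_null])

lemma null_G: "j < m \<Longrightarrow> G j \<in> null"
  by (simp add: null_def polyfun_G ev_ideal)

lemma ev_null: "F \<in> null \<Longrightarrow> \<forall>\<^sub>F \<Lambda> in \<F>. \<Lambda> F = 0"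
  unfolding null_def using polyfun_const[of r 1] by fastforce

text \<open>Two eventually nonnegative values with sum 0 both vanish, and
  \<open>ev_square_null\<close> removes the square. Thus \<open>null\<close> behaves like a real
  radical ideal.\<close>

lemma null_sum_of_squares:
  assumes F: "polyfun r F" and K: "polyfun r K" and FK: "(\<lambda>x. (F x)\<^sup>2 + (K x)\<^sup>2) \<in> null"
  shows "F \<in> null"
  unfolding null_def
proof (intro CollectI conjI allI impI F)
  fix H :: "(nat \<Rightarrow> real) \<Rightarrow> real" assume H: "polyfun r H"
  have HF: "polyfun r (\<lambda>x. H x * F x)" and HK: "polyfun r (\<lambda>x. H x * K x)"
    using F K H by (auto intro: polyfun_intros)
  have "\<forall>\<^sub>F \<Lambda> in \<F>. \<Lambda> (\<lambda>x. (H x)\<^sup>2 * ((F x)\<^sup>2 + (K x)\<^sup>2)) = 0"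
    using FK polyfun_power[OF H, of 2] unfolding null_def by blast
  moreover have "\<forall>\<^sub>F \<Lambda> in \<F>. \<Lambda> (\<lambda>x. (H x * F x)\<^sup>2 + (H x * K x)\<^sup>2) =
      \<Lambda> (\<lambda>x. (H x * F x)\<^sup>2) + \<Lambda> (\<lambda>x. (H x * K x)\<^sup>2)"
    by (intro ev_add polyfun_power HF HK)
  moreover note ev_square[OF HF] ev_square[OF HK] ev_square_null[OF HF]
  ultimately show "\<forall>\<^sub>F \<Lambda> in \<F>. \<Lambda> (\<lambda>x. H x * F x) = 0"
    by eventually_elim (simp add: power_mult_distrib distrib_left)
qed

lemma null_square:
  assumes F: "polyfun r F" and "(\<lambda>x. (F x)\<^sup>2) \<in> null"
  shows "F \<in> null"
  using null_sum_of_squares[OF F polyfun_const[of r 0]] assms(2) by simp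

end

section \<open>Reduction to simple real roots\<close>

lemma map_poly_of_real_add:
  "map_poly complex_of_real (p + q) = map_poly complex_of_real p + map_poly complex_of_real q"
  by (rule poly_eqI) (simp add: coeff_map_poly)

lemma map_poly_of_real_mult:
  "map_poly complex_of_real (p * q) = map_poly complex_of_real p * map_poly complex_of_real q"
  by (rule poly_eqI) (simp add: coeff_map_poly coeff_mult)

lemma poly_map_poly_of_real:
  "poly (map_poly complex_of_real p) (complex_of_real a) = complex_of_real (poly p a)"
  by (induction p) (auto simp: map_poly_pCons)

text \<open>The remainder modulo the real quadratic polynomial of \<open>z\<close> has real
  coefficients and degree at most 1, and vanishes at the non-real \<open>z\<close>; hence it is
  0.\<close>

lemma complex_root_imp_quadratic_factor:
  fixes u :: "real poly"
  assumes root: "poly (map_poly complex_of_real u) z = 0" and z: "Im z \<noteq> 0"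
  shows "[:(Re z)\<^sup>2 + (Im z)\<^sup>2, - 2 * Re z, 1:] dvd u"
proof -
  let ?d = "[:(Re z)\<^sup>2 + (Im z)\<^sup>2, - 2 * Re z, 1:]"
  let ?e = "u mod ?d"
  have d0: "poly (map_poly complex_of_real ?d) z = 0"
    by (simp add: map_poly_pCons complex_eq_iff power2_eq_square algebra_simps)
  have "u = ?d * (u div ?d) + ?e" by (rule mult_div_mod_eq[symmetric])
  hence "poly (map_poly complex_of_real u) z =
    poly (map_poly complex_of_real (?d * (u div ?d) + ?e)) z" by simp
  also have "\<dots> = poly (map_poly complex_of_real ?e) z"
    unfolding map_poly_of_real_add map_poly_of_real_mult poly_add poly_mult d0 by simp
  finally have e: "poly (map_poly complex_of_real ?e) z = 0" using root by simp
  have "degree ?e < 2 \<or> ?e = 0" using degree_mod_less[of ?d u] by auto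
  hence deg: "degree ?e \<le> 1" by auto
  define a b where "a = coeff ?e 0" and "b = coeff ?e 1"
  have "coeff ?e k = coeff [:a, b:] k" for k
  proof (cases "k \<le> 1")
    case True
    hence "k = 0 \<or> k = 1" by auto
    thus ?thesis by (auto simp: a_def b_def)
  next
    case False
    thus ?thesis using deg by (auto simp: coeff_eq_0)
  qed
  hence ab: "?e = [:a, b:]" by (rule poly_eqI)
  have "complex_of_real a + z * complex_of_real b = 0"
    using e unfolding ab by (cases "b = 0"; cases "a = 0") (simp_all add: map_poly_pCons)
  hence "b = 0" "a = 0" using z by (auto simp: complex_eq_iff)
  hence "?e = 0" using ab by simp
  thus ?thesis by (simp add: mod_eq_0_iff_dvd)
qed

context moment_filter begin

text \<open>The roots of \<open>u\<close> are stripped off one by one. A new real root moves to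
  \<open>S\<close>, a real root already in \<open>S\<close> is a repetition removed by
  \<open>null_square\<close>, and a pair of non-real roots is a sum of two squares removed by
  \<open>null_sum_of_squares\<close>.\<close>

lemma univariate_null_real_rooted_aux:
  assumes i: "i < r" and "finite S" "u \<noteq> 0" "(\<lambda>x. (\<Prod>a\<in>S. x i - a) * poly u (x i)) \<in> null"
  shows "\<exists>S. finite S \<and> (\<lambda>x. \<Prod>a\<in>S. x i - a) \<in> null"
  using assms(2-)
proof (induction "degree u" arbitrary: u S rule: less_induct)
  case less
  have pf: "polyfun r (\<lambda>x. (\<Prod>a\<in>S. x i - a) * poly v (x i))" for S :: "real set" and v
    using i by (intro polyfun_intros polyfun_poly)
  show ?case
  proof (cases "degree u = 0")
    case True
    then obtain c where c: "u = [:c:]" "c \<noteq> 0" using less.prems(2) by (metis degree_eq_zeroE pCons_0_0)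
    have "(\<lambda>x. 1 / c * ((\<Prod>a\<in>S. x i - a) * poly u (x i))) \<in> null"
      by (rule null_mult[OF less.prems(3) polyfun_const])
    thus ?thesis using c less.prems(1) by (intro exI[of _ S]) simp
  next
    case False
    hence "degree (map_poly complex_of_real u) \<noteq> 0" by (simp add: degree_map_poly)
    then obtain z where z: "poly (map_poly complex_of_real u) z = 0"
      using alg_closed_imp_poly_has_root[of "map_poly complex_of_real u"] by auto
    show ?thesis
    proof (cases "Im z = 0")
      case True
      define a where "a = Re z"
      have "z = of_real a" using True by (simp add: a_def complex_eq_iff)
      hence "complex_of_real (poly u a) = 0" using z poly_map_poly_of_real[of u a] by simp
      then obtain v where v: "u = [:- a, 1:] * v" by (metis of_real_eq_0_iff poly_eq_0_iff_dvd dvdE)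
      have "v \<noteq> 0" using v less.prems(2) by auto
      have "degree u = Suc (degree v)" unfolding v using \<open>v \<noteq> 0\<close> by (subst degree_mult_eq) auto
      hence deg: "degree v < degree u" by simp
      show ?thesis
      proof (cases "a \<in> S")
        case True
        \<comment> \<open>The multiplier that completes the given product to a perfect
          square.\<close>
        let ?w = "\<lambda>x. (\<Prod>b\<in>S - {a}. x i - b) * poly v (x i)"
        have "(\<lambda>x. ?w x * ((\<Prod>b\<in>S. x i - b) * poly u (x i))) \<in> null"
          by (rule null_mult[OF less.prems(3) pf])
        moreover have "?w x * ((\<Prod>b\<in>S. x i - b) * poly u (x i)) = ((\<Prod>b\<in>S. x i - b) * poly v (x i))\<^sup>2" for x
          using True less.prems(1) by (simp add: v prod.remove[of S a] power2_eq_square algebra_simps)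
        ultimately have "(\<lambda>x. ((\<Prod>b\<in>S. x i - b) * poly v (x i))\<^sup>2) \<in> null" by simp
        hence "(\<lambda>x. (\<Prod>b\<in>S. x i - b) * poly v (x i)) \<in> null" by (rule null_square[OF pf])
        thus ?thesis using less.hyps[OF deg less.prems(1) \<open>v \<noteq> 0\<close>] by blast
      next
        case False
        have "(\<Prod>b\<in>S. x i - b) * poly u (x i) = (\<Prod>b\<in>insert a S. x i - b) * poly v (x i)" for x
          using False less.prems(1) by (simp add: v algebra_simps)
        hence "(\<lambda>x. (\<Prod>b\<in>insert a S. x i - b) * poly v (x i)) \<in> null" using less.prems(3) by simp
        thus ?thesis using less.hyps[OF deg _ \<open>v \<noteq> 0\<close>] less.prems(1) by blast
      qed
    next
      case False
      let ?d = "[:(Re z)\<^sup>2 + (Im z)\<^sup>2, - 2 * Re z, 1:]"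
      obtain v where v: "u = ?d * v" using complex_root_imp_quadratic_factor[OF z False] by (metis dvdE)
      have "v \<noteq> 0" using v less.prems(2) by auto
      have "degree u = Suc (Suc (degree v))" unfolding v using \<open>v \<noteq> 0\<close> by (subst degree_mult_eq) auto
      hence deg: "degree v < degree u" by simp
      \<comment> \<open>This multiplier makes the product \<open>?w x ^ 2\<close> times the
        quadratic factor, which is a sum of two squares.\<close>
      let ?w = "\<lambda>x. (\<Prod>b\<in>S. x i - b) * poly v (x i)"
      have "(\<lambda>x. ?w x * ((\<Prod>b\<in>S. x i - b) * poly u (x i))) \<in> null"
        by (rule null_mult[OF less.prems(3) pf])
      moreover have "?w x * ((\<Prod>b\<in>S. x i - b) * poly u (x i)) = (Im z * ?w x)\<^sup>2 + ((x i - Re z) * ?w x)\<^sup>2" for x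
        by (simp add: v power2_eq_square algebra_simps)
      ultimately have "(\<lambda>x. (Im z * ?w x)\<^sup>2 + ((x i - Re z) * ?w x)\<^sup>2) \<in> null" by simp
      hence "(\<lambda>x. Im z * ?w x) \<in> null"
        using i pf by (intro null_sum_of_squares[of "\<lambda>x. Im z * ?w x" "\<lambda>x. (x i - Re z) * ?w x"])
          (auto intro!: polyfun_intros polyfun_poly)
      from null_mult[OF this polyfun_const[of r "1 / Im z"]] have "?w \<in> null" using False by simp
      thus ?thesis using less.hyps[OF deg less.prems(1) \<open>v \<noteq> 0\<close>] by blast
    qed
  qed
qed

lemma univariate_null_real_rooted:
  assumes "i < r" "q \<noteq> 0" "(\<lambda>x. poly q (x i)) \<in> null"
  shows "\<exists>S. finite S \<and> (\<lambda>x. \<Prod>a\<in>S. x i - a) \<in> null"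
  using univariate_null_real_rooted_aux[of i "{}" q] assms by simp

end

text \<open>Both sides are polynomials in \<open>x\<close> of degree below \<open>card S\<close>
  that agree on \<open>S\<close>.\<close>

lemma lagrange_partition_of_unity:
  fixes S :: "real set"
  assumes "finite S" "S \<noteq> {}"
  shows "(\<Sum>a\<in>S. \<Prod>b\<in>S - {a}. (x - b) / (a - b)) = 1"
proof -
  define p where "p = (\<Sum>a\<in>S. smult (\<Prod>b\<in>S - {a}. 1 / (a - b)) (\<Prod>b\<in>S - {a}. [:- b, 1:]))"
  have p: "poly p x = (\<Sum>a\<in>S. \<Prod>b\<in>S - {a}. (x - b) / (a - b))" for x
    by (simp add: p_def poly_sum poly_prod prod.distrib[symmetric] prod_dividef)
  have "p = 1"
  proof (rule poly_eqI_degree[of S])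
    fix c assume c: "c \<in> S"
    have "(\<Prod>b\<in>S - {a}. (c - b) / (a - b)) = (if a = c then 1 else 0)" if "a \<in> S" for a
    proof (cases "a = c")
      case False
      have "c \<in> S - {a}" using c False by auto
      thus ?thesis using False assms by (auto intro!: prod_zero)
    qed auto
    thus "poly p c = poly 1 c" unfolding p using c assms by simp
  next
    have "degree p \<le> card S - 1" unfolding p_def
    proof (rule degree_sum_le)
      fix a assume "a \<in> S"
      thus "degree (smult (\<Prod>b\<in>S - {a}. 1 / (a - b)) (\<Prod>b\<in>S - {a}. [:- b, 1:])) \<le> card S - 1"
        using assms monic_prod_linear(1)[of "S - {a}" "\<lambda>b. b"] by (simp add: degree_smult_eq)
    qed (use assms in auto)
    thus "degree p < card S" using assms by (metis One_nat_def Suc_pred card_gt_0_iff le_imp_less_Suc)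
  qed (use assms in \<open>simp add: card_gt_0_iff\<close>)
  thus ?thesis using p[of x] by simp
qed

context moment_filter begin

definition eventually_nonneg :: "((nat \<Rightarrow> real) \<Rightarrow> real) set" where
  "eventually_nonneg = {F. polyfun r F \<and> (\<forall>\<^sub>F \<Lambda> in \<F>. 0 \<le> \<Lambda> F)}"

lemma eventually_nonneg_add:
  assumes "F \<in> eventually_nonneg" "H \<in> eventually_nonneg"
  shows "(\<lambda>x. F x + H x) \<in> eventually_nonneg"
proof -
  have "\<forall>\<^sub>F \<Lambda> in \<F>. 0 \<le> \<Lambda> F" "\<forall>\<^sub>F \<Lambda> in \<F>. 0 \<le> \<Lambda> H" "\<forall>\<^sub>F \<Lambda> in \<F>. \<Lambda> (\<lambda>x. F x + H x) = \<Lambda> F + \<Lambda> H"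
    using assms ev_add by (auto simp: eventually_nonneg_def)
  hence "\<forall>\<^sub>F \<Lambda> in \<F>. 0 \<le> \<Lambda> (\<lambda>x. F x + H x)" by eventually_elim simp
  thus ?thesis using assms by (auto simp: eventually_nonneg_def intro: polyfun_intros)
qed

lemma eventually_nonneg_square:
  assumes "polyfun r F" "0 \<le> c"
  shows "(\<lambda>x. c * (F x)\<^sup>2) \<in> eventually_nonneg"
proof -
  have "\<forall>\<^sub>F \<Lambda> in \<F>. \<Lambda> (\<lambda>x. c * (F x)\<^sup>2) = c * \<Lambda> (\<lambda>x. (F x)\<^sup>2)"
    by (rule ev_cmult[OF polyfun_power[OF assms(1)]])
  with ev_square[OF assms(1)] have "\<forall>\<^sub>F \<Lambda> in \<F>. 0 \<le> \<Lambda> (\<lambda>x. c * (F x)\<^sup>2)"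
    by eventually_elim (simp add: assms(2))
  thus ?thesis using assms by (auto simp: eventually_nonneg_def intro: polyfun_intros)
qed

lemma null_subset_eventually_nonneg: "null \<subseteq> eventually_nonneg"
proof
  fix F assume F: "F \<in> null"
  from ev_null[OF F] have "\<forall>\<^sub>F \<Lambda> in \<F>. 0 \<le> \<Lambda> F" by eventually_elim simp
  thus "F \<in> eventually_nonneg" using null_polyfun[OF F] by (simp add: eventually_nonneg_def)
qed

lemma eventually_nonneg_sum:
  "finite I \<Longrightarrow> (\<And>i. i \<in> I \<Longrightarrow> F i \<in> eventually_nonneg) \<Longrightarrow> (\<lambda>x. \<Sum>i\<in>I. F i x) \<in> eventually_nonneg"
proof (induction I rule: finite_induct)
  case empty
  thus ?case using null_subset_eventually_nonneg fun_idealD(2)[OF fun_ideal_null] by auto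
qed (auto intro: eventually_nonneg_add)

lemma eventually_nonneg_minus_const:
  assumes F: "polyfun r F" and "(\<lambda>x. F x - v) \<in> eventually_nonneg"
  shows "\<forall>\<^sub>F \<Lambda> in \<F>. v \<le> \<Lambda> F"
proof -
  have "\<forall>\<^sub>F \<Lambda> in \<F>. 0 \<le> \<Lambda> (\<lambda>x. F x - v)" using assms(2) by (simp add: eventually_nonneg_def)
  moreover have "\<forall>\<^sub>F \<Lambda> in \<F>. \<Lambda> (\<lambda>x. (F x - v) + v * 1) = \<Lambda> (\<lambda>x. F x - v) + \<Lambda> (\<lambda>x. v * 1)"
    using F by (intro ev_add polyfun_intros)
  moreover have "\<forall>\<^sub>F \<Lambda> in \<F>. \<Lambda> (\<lambda>x. v * 1) = v * \<Lambda> (\<lambda>x. 1)" by (rule ev_cmult[OF polyfun_const])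
  moreover note ev_one
  ultimately show ?thesis by eventually_elim simp
qed

text \<open>
  Modulo \<open>null\<close> the Lagrange polynomials \<open>\<delta> a\<close> of a finite real grid are idempotents with sum 1, and
  those belonging to grid points outside the zero set vanish.
\<close>

lemma nonneg_on_zeros_imp_eventually_nonneg:
  assumes grid: "\<And>i. i < r \<Longrightarrow> \<exists>S. finite S \<and> (\<lambda>x. \<Prod>a\<in>S. x i - a) \<in> null"
    and F: "polyfun r F" and Fv: "\<And>x. (\<And>j. j < m \<Longrightarrow> G j x = 0) \<Longrightarrow> v \<le> F x"
  shows "(\<lambda>x. F x - v) \<in> eventually_nonneg"
proof -
  obtain S where S: "\<And>i. i < r \<Longrightarrow> finite (S i)" "\<And>i. i < r \<Longrightarrow> (\<lambda>x. \<Prod>a\<in>S i. x i - a) \<in> null"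
    using grid by metis
  have Fv_poly: "polyfun r (\<lambda>x. F x - v)" using F by (intro polyfun_intros)
  show ?thesis
  proof (cases "\<exists>i<r. S i = {}")
    case True
    then obtain i where "i < r" "S i = {}" by blast
    \<comment> \<open>An empty product is 1; once 1 is null, every polynomial function is null. This
      is the situation of eventual infeasibility.\<close>
    hence "(\<lambda>x. 1) \<in> null" using S(2)[of i] by simp
    from null_mult[OF this Fv_poly] show ?thesis using null_subset_eventually_nonneg by auto
  next
    case False
    define \<G> where "\<G> = PiE {..<r} S"
    define \<delta> where "\<delta> a x = (\<Prod>i<r. \<Prod>b\<in>S i - {a i}. (x i - b) / (a i - b))" for a x :: "nat \<Rightarrow> real"
    have fin: "finite \<G>" unfolding \<G>_def using S by (intro finite_PiE) auto
    have \<delta>_poly: "polyfun r (\<delta> a)" for a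
      unfolding \<delta>_def divide_inverse by (intro polyfun_intros) auto
    have sum1: "(\<Sum>a\<in>\<G>. \<delta> a x) = 1" for x
    proof -
      have "(\<Sum>a\<in>\<G>. \<delta> a x) = (\<Prod>i<r. \<Sum>c\<in>S i. \<Prod>b\<in>S i - {c}. (x i - b) / (c - b))"
        unfolding \<G>_def \<delta>_def using S by (subst prod_sum_PiE) auto
      also have "\<dots> = 1" using False S(1) by (intro prod.neutral ballI lagrange_partition_of_unity) auto
      finally show ?thesis .
    qed
    have \<delta>_self: "\<delta> a a = 1" for a
      unfolding \<delta>_def by (intro prod.neutral ballI) auto
    have coord: "(\<lambda>x. (x i - a i) * \<delta> a x) \<in> null" if a: "a \<in> \<G>" and i: "i < r" for a i
    proof -
      define K where "K x = (\<Prod>b\<in>S i - {a i}. inverse (a i - b)) *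
        (\<Prod>k\<in>{..<r} - {i}. \<Prod>b\<in>S k - {a k}. (x k - b) / (a k - b))" for x
      have "polyfun r K" unfolding K_def divide_inverse by (intro polyfun_intros) auto
      hence "(\<lambda>x. K x * (\<Prod>b\<in>S i. x i - b)) \<in> null" by (rule null_mult[OF S(2)[OF i]])
      moreover have "K x * (\<Prod>b\<in>S i. x i - b) = (x i - a i) * \<delta> a x" for x
      proof -
        have "a i \<in> S i" using a i by (auto simp: \<G>_def)
        hence "(\<Prod>b\<in>S i. x i - b) = (x i - a i) * (\<Prod>b\<in>S i - {a i}. x i - b)"
          using S(1)[OF i] by (simp add: prod.remove)
        moreover have "\<delta> a x = (\<Prod>b\<in>S i - {a i}. (x i - b) / (a i - b)) *
          (\<Prod>k\<in>{..<r} - {i}. \<Prod>b\<in>S k - {a k}. (x k - b) / (a k - b))"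
          unfolding \<delta>_def using i by (simp add: prod.remove[of "{..<r}" i])
        ultimately show ?thesis by (simp add: K_def divide_inverse prod.distrib mult_ac)
      qed
      ultimately show ?thesis by simp
    qed
    \<comment> \<open>Modulo \<open>null\<close>, multiplying \<open>\<delta> a\<close> by a
      polynomial function amounts to multiplying it by the value at \<open>a\<close>.\<close>
    have mod: "(\<lambda>x. (P x - P a) * \<delta> a x) \<in> null" if a: "a \<in> \<G>" and P: "polyfun r P" for a P
      using P
    proof induction
      case (polyfun_const c)
      show ?case using fun_idealD(2)[OF fun_ideal_null] by simp
    next
      case (polyfun_var i)
      show ?case by (rule coord[OF a polyfun_var])
    next
      case (polyfun_add P Q)
      have "(P x - P a) * \<delta> a x + (Q x - Q a) * \<delta> a x = (P x + Q x - (P a + Q a)) * \<delta> a x" for x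
        by (simp add: algebra_simps)
      thus ?case using fun_idealD(3)[OF fun_ideal_null polyfun_add.IH] by simp
    next
      case (polyfun_mult P Q)
      have "Q x * ((P x - P a) * \<delta> a x) + P a * ((Q x - Q a) * \<delta> a x) = (P x * Q x - P a * Q a) * \<delta> a x" for x
        by (simp add: algebra_simps)
      thus ?case using fun_idealD(3)[OF fun_ideal_null null_mult[OF polyfun_mult.IH(1) polyfun_mult.hyps(2)]
          null_mult[OF polyfun_mult.IH(2) polyfun_const[of r "P a"]]] by simp
    qed
    have "(\<lambda>x. (F x - v) * \<delta> a x) \<in> eventually_nonneg" if a: "a \<in> \<G>" for a
    proof (cases "\<forall>j<m. G j a = 0")
      case True
      \<comment> \<open>Taking \<open>\<delta> a\<close> itself for \<open>P\<close> in
        \<open>mod\<close> gives idempotence; so \<open>(F x - v) * \<delta> a x\<close> agrees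
        modulo \<open>null\<close> with a nonnegative multiple of a square.\<close>
      have "(\<lambda>x. (F x - F a) * \<delta> a x - (F a - v) * ((\<delta> a x - \<delta> a a) * \<delta> a x)) \<in> null"
        by (rule fun_ideal_diff[OF fun_ideal_null mod[OF a F] null_mult[OF mod[OF a \<delta>_poly] polyfun_const]])
      moreover have "(\<lambda>x. (F a - v) * (\<delta> a x)\<^sup>2) \<in> eventually_nonneg"
        using Fv[of a] True by (intro eventually_nonneg_square \<delta>_poly) auto
      ultimately have "(\<lambda>x. ((F x - F a) * \<delta> a x - (F a - v) * ((\<delta> a x - \<delta> a a) * \<delta> a x)) + (F a - v) * (\<delta> a x)\<^sup>2)
          \<in> eventually_nonneg"
        using null_subset_eventually_nonneg by (intro eventually_nonneg_add) auto
      moreover have "((F x - F a) * \<delta> a x - (F a - v) * ((\<delta> a x - \<delta> a a) * \<delta> a x)) + (F a - v) * (\<delta> a x)\<^sup>2 =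
          (F x - v) * \<delta> a x" for x
        by (simp add: \<delta>_self power2_eq_square algebra_simps)
      ultimately show ?thesis by simp
    next
      case False
      then obtain j where j: "j < m" "G j a \<noteq> 0" by blast
      \<comment> \<open>\<open>G j\<close> is null but acts on \<open>\<delta> a\<close> as the
        nonzero number \<open>G j a\<close>; hence \<open>\<delta> a\<close> is null.\<close>
      have "(\<lambda>x. \<delta> a x * G j x - (G j x - G j a) * \<delta> a x) \<in> null"
        by (rule fun_ideal_diff[OF fun_ideal_null null_mult[OF null_G[OF j(1)] \<delta>_poly] mod[OF a polyfun_G[OF j(1)]]])
      moreover have "\<delta> a x * G j x - (G j x - G j a) * \<delta> a x = G j a * \<delta> a x" for x
        by (simp add: algebra_simps)
      ultimately have "(\<lambda>x. G j a * \<delta> a x) \<in> null" by simp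
      from null_mult[OF this polyfun_mult[OF Fv_poly polyfun_const[of r "inverse (G j a)"]]]
      have "(\<lambda>x. (F x - v) * inverse (G j a) * (G j a * \<delta> a x)) \<in> null" .
      moreover have "(F x - v) * inverse (G j a) * (G j a * \<delta> a x) = (F x - v) * \<delta> a x" for x
        using j(2) by simp
      ultimately have "(\<lambda>x. (F x - v) * \<delta> a x) \<in> null" by simp
      thus ?thesis using null_subset_eventually_nonneg by blast
    qed
    hence "(\<lambda>x. \<Sum>a\<in>\<G>. (F x - v) * \<delta> a x) \<in> eventually_nonneg" using fin by (intro eventually_nonneg_sum)
    moreover have "(\<Sum>a\<in>\<G>. (F x - v) * \<delta> a x) = F x - v" for x
      unfolding sum_distrib_left[symmetric] sum1 by simp
    ultimately show ?thesis by simp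
  qed
qed

end


section \<open>Lasserre relaxations\<close>

text \<open>The inverse of evaluation, unique by \<open>evaluate_inj\<close>. It carries functionals
  on polynomials over to polynomial functions.\<close>

definition mpoly_of :: "nat \<Rightarrow> ((nat \<Rightarrow> real) \<Rightarrow> real) \<Rightarrow> real mpoly" where
  "mpoly_of r F = (THE p. p \<in> poly_ring r \<and> (\<forall>x. evaluate p x = F x))"

lemma mpoly_of_eqI:
  assumes "p \<in> poly_ring r" "\<And>x. evaluate p x = F x"
  shows "mpoly_of r F = p"
  unfolding mpoly_of_def
proof (rule the_equality)
  fix q assume "q \<in> poly_ring r \<and> (\<forall>x. evaluate q x = F x)"
  thus "q = p" using assms by (intro evaluate_inj[of q r p]) auto
qed (use assms in auto)

lemma mpoly_of:
  assumes "polyfun r F"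
  shows "mpoly_of r F \<in> poly_ring r" "evaluate (mpoly_of r F) x = F x"
proof -
  obtain p where p: "p \<in> poly_ring r" "\<And>x. evaluate p x = F x" using polyfun_imp_evaluate[OF assms] by blast
  hence "mpoly_of r F = p" by (rule mpoly_of_eqI)
  thus "mpoly_of r F \<in> poly_ring r" "evaluate (mpoly_of r F) x = F x" using p by auto
qed

lemma mpoly_of_add:
  "polyfun r F \<Longrightarrow> polyfun r H \<Longrightarrow> mpoly_of r (\<lambda>x. F x + H x) = mpoly_of r F + mpoly_of r H"
  by (rule mpoly_of_eqI) (auto simp: mpoly_of id_hom.eval_add)

lemma mpoly_of_mult:
  "polyfun r F \<Longrightarrow> polyfun r H \<Longrightarrow> mpoly_of r (\<lambda>x. F x * H x) = mpoly_of r F * mpoly_of r H"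
  by (rule mpoly_of_eqI) (auto simp: mpoly_of id_hom.eval_mult)

lemma mpoly_of_cmult: "polyfun r F \<Longrightarrow> mpoly_of r (\<lambda>x. c * F x) = Const c * mpoly_of r F"
  by (rule mpoly_of_eqI) (auto simp: mpoly_of id_hom.eval_mult)

lemma mpoly_of_power: "polyfun r F \<Longrightarrow> mpoly_of r (\<lambda>x. F x ^ k) = mpoly_of r F ^ k"
  by (rule mpoly_of_eqI) (auto simp: mpoly_of id_hom.eval_power)

lemma mpoly_of_evaluate: "p \<in> poly_ring r \<Longrightarrow> mpoly_of r (evaluate p) = p"
  by (rule mpoly_of_eqI) auto

lemma total_degree_mono:
  assumes "Poly_Mapping.keys p \<subseteq> insert 0 (Poly_Mapping.keys q)"
  shows "total_degree p \<le> total_degree q"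
proof -
  let ?s = "\<lambda>\<alpha>. \<Sum>i\<in>Poly_Mapping.keys \<alpha>. Poly_Mapping.lookup \<alpha> i"
  have "insert 0 (?s ` Poly_Mapping.keys p) \<subseteq> insert 0 (?s ` insert 0 (Poly_Mapping.keys q))"
    using assms by blast
  also have "\<dots> = insert 0 (?s ` Poly_Mapping.keys q)" by auto
  finally show ?thesis unfolding total_degree_def by (intro Max_mono) auto
qed

lemma total_degree_Const_mult: "total_degree (Const c * p) \<le> total_degree p"
proof (rule total_degree_mono)
  have "Poly_Mapping.keys (Const c * p) \<subseteq> {a + b | a b. a \<in> Poly_Mapping.keys (Const c) \<and> b \<in> Poly_Mapping.keys p}"
    by (rule keys_mult)
  thus "Poly_Mapping.keys (Const c * p) \<subseteq> insert 0 (Poly_Mapping.keys p)"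
    by (auto simp: Const_def split: if_splits)
qed

lemma total_degree_add_Const: "total_degree (p + Const c) \<le> total_degree p"
proof (rule total_degree_mono)
  show "Poly_Mapping.keys (p + Const c) \<subseteq> insert 0 (Poly_Mapping.keys p)"
    using keys_add[of p "Const c"] by (auto simp: Const_def split: if_splits)
qed

lemma total_degree_Const [simp]: "total_degree (Const c) = 0"
  by (simp add: total_degree_def Const_def)

lemma half_deg_uminus: "half_deg (- p :: 'a::ab_group_add mpoly) = half_deg p"
proof -
  have "Poly_Mapping.keys (- p) = Poly_Mapping.keys p" by (auto simp: in_keys_iff)
  thus ?thesis by (simp add: half_deg_def total_degree_def)
qed

section \<open>Feasible functionals of a fixed level\<close>

lemma lasserre_feasibleD:
  assumes "L \<in> lasserre_feasible r Gs k"
  shows "p \<in> poly_ring r \<Longrightarrow> q \<in> poly_ring r \<Longrightarrow> total_degree p \<le> 2 * k \<Longrightarrow> total_degree q \<le> 2 * k \<Longrightarrow>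
      L (p + q) = L p + L q"
    "p \<in> poly_ring r \<Longrightarrow> total_degree p \<le> 2 * k \<Longrightarrow> L (Const c * p) = c * L p"
    "L 1 = 1"
    "p \<in> poly_ring r \<Longrightarrow> total_degree p \<le> k \<Longrightarrow> 0 \<le> L (p ^ 2)"
    "G \<in> Gs \<Longrightarrow> p \<in> poly_ring r \<Longrightarrow> total_degree p + half_deg G \<le> k \<Longrightarrow> 0 \<le> L (p ^ 2 * G)"
  using assms by (auto simp: lasserre_feasible_def poly_ring_le_def)

text \<open>The degenerate Cauchy-Schwarz inequality: the square of \<open>p + Const s\<close> has
  value \<open>2 * s * L p + s\<^sup>2\<close>, and \<open>s = - L p\<close> makes this negative
  unless \<open>L p = 0\<close>. Degree bounds on products are assumed rather than derived, because
  only large \<open>k\<close> matter.\<close>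

lemma lasserre_feasible_square_null:
  assumes L: "L \<in> lasserre_feasible r Gs k" and p: "p \<in> poly_ring r"
    and k: "total_degree p \<le> k" "total_degree (p ^ 2) \<le> 2 * k" and null: "L (p ^ 2) = 0"
  shows "L p = 0"
proof -
  have deg: "total_degree (Const s * p) \<le> 2 * k" for s
    using total_degree_Const_mult[of s p] k by linarith
  have nonneg: "0 \<le> 2 * s * L p + s\<^sup>2" for s
  proof -
    have "Const (2 * s) * p + Const (s\<^sup>2) * 1 = Const s * p + Const s * (p + Const s)"
      "(p + Const s) ^ 2 = p ^ 2 + (Const (2 * s) * p + Const (s\<^sup>2) * 1)"
    proof -
      have "Const (a + b) = Const a + (Const b :: real mpoly)" "Const (a * b) = Const a * (Const b :: real mpoly)" for a b
        by (simp_all add: Const_def single_add mult_single)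
      moreover have "Const 2 = (2 :: real mpoly)" by (simp add: Const_def)
      ultimately show "Const (2 * s) * p + Const (s\<^sup>2) * 1 = Const s * p + Const s * (p + Const s)"
        "(p + Const s) ^ 2 = p ^ 2 + (Const (2 * s) * p + Const (s\<^sup>2) * 1)"
        by (simp_all add: power2_eq_square algebra_simps mult_2)
    qed
    note eq = this
    have "total_degree (Const (2 * s) * p + Const (s\<^sup>2)) \<le> 2 * k"
      using total_degree_add_Const[of "Const (2 * s) * p" "s\<^sup>2"] deg[of "2 * s"] by linarith
    hence "L ((p + Const s) ^ 2) = L (p ^ 2) + L (Const (2 * s) * p + Const (s\<^sup>2) * 1)"
      unfolding eq(2) using p k by (intro lasserre_feasibleD(1)[OF L]) auto
    also have "L (Const (2 * s) * p + Const (s\<^sup>2) * 1) = L (Const (2 * s) * p) + L (Const (s\<^sup>2) * 1)"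
      using p deg by (intro lasserre_feasibleD(1)[OF L]) auto
    also have "L (Const (2 * s) * p) = 2 * s * L p"
      using p k by (intro lasserre_feasibleD(2)[OF L]) auto
    also have "L (Const (s\<^sup>2) * 1) = s\<^sup>2 * L 1"
      by (intro lasserre_feasibleD(2)[OF L]) (auto simp: total_degree_def)
    finally have "L ((p + Const s) ^ 2) = 2 * s * L p + s\<^sup>2"
      using null lasserre_feasibleD(3)[OF L] by simp
    moreover have "0 \<le> L ((p + Const s) ^ 2)"
      using p k total_degree_add_Const[of p s] by (intro lasserre_feasibleD(4)[OF L]) auto
    ultimately show ?thesis by simp
  qed
  have "0 \<le> 2 * (- L p) * L p + (- L p)\<^sup>2" by (rule nonneg)
  hence "L p * L p \<le> 0" by (simp add: power2_eq_square)
  hence "L p * L p = 0" using zero_le_square[of "L p"] by linarith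
  thus ?thesis by simp
qed

text \<open>The two signs of \<open>G\<close> give value 0 to \<open>p ^ 2 * G\<close>. Arbitrary
  multipliers are reached through \<open>4 * h = (h + 1) ^ 2 - (h - 1) ^ 2\<close>.\<close>

lemma lasserre_feasible_ideal:
  assumes L: "L \<in> lasserre_feasible r Gs k" and G: "G \<in> Gs" "- G \<in> Gs" "G \<in> poly_ring r"
    and h: "h \<in> poly_ring r"
    and k: "total_degree (h + 1) + half_deg G \<le> k" "total_degree (h + - 1) + half_deg G \<le> k"
      "total_degree ((h + 1) ^ 2 * G) \<le> 2 * k" "total_degree ((h + - 1) ^ 2 * G) \<le> 2 * k"
      "total_degree (h * G) \<le> 2 * k"
  shows "L (h * G) = 0"
proof -
  have null: "L (p ^ 2 * G) = 0"
    if p: "p \<in> poly_ring r" "total_degree p + half_deg G \<le> k" "total_degree (p ^ 2 * G) \<le> 2 * k" for p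
  proof -
    have "0 \<le> L (p ^ 2 * - G)"
      using p by (intro lasserre_feasibleD(5)[OF L G(2)]) (auto simp: half_deg_uminus)
    also have "p ^ 2 * - G = Const (- 1) * (p ^ 2 * G)"
      by (simp add: Const_def single_uminus)
    also have "L \<dots> = - 1 * L (p ^ 2 * G)" using p G(3) by (intro lasserre_feasibleD(2)[OF L]) auto
    finally show ?thesis using lasserre_feasibleD(5)[OF L G(1) p(1,2)] by simp
  qed
  have "(h + 1) ^ 2 * G = (h + - 1) ^ 2 * G + Const 4 * (h * G)"
  proof -
    have "Const 4 = (4 :: real mpoly)" by (simp add: Const_def)
    thus ?thesis by (simp add: power2_eq_square algebra_simps)
  qed
  hence "L ((h + 1) ^ 2 * G) = L ((h + - 1) ^ 2 * G + Const 4 * (h * G))" by simp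
  also have "\<dots> = L ((h + - 1) ^ 2 * G) + L (Const 4 * (h * G))"
    using h G(3) k total_degree_Const_mult[of 4 "h * G"]
    by (intro lasserre_feasibleD(1)[OF L] poly_ring_mult poly_ring_power poly_ring_add poly_ring_uminus) auto
  also have "L (Const 4 * (h * G)) = 4 * L (h * G)"
    using h G(3) k by (intro lasserre_feasibleD(2)[OF L]) auto
  finally show ?thesis
    using null[of "h + 1"] null[of "h + - 1"] h k by (simp del: add_uminus_conv_diff)
qed

text \<open>The basic sets collect the feasible functionals of all levels from \<open>l\<close> on,
  so that eventual statements hold for every feasible functional of every high level, not for one
  chosen sequence.\<close>

definition lasserre_filter :: "nat \<Rightarrow> real mpoly set \<Rightarrow> (((nat \<Rightarrow> real) \<Rightarrow> real) \<Rightarrow> real) filter" where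
  "lasserre_filter r Gs =
     filtermap (\<lambda>L F. L (mpoly_of r F)) (INF l. principal (\<Union>k\<in>{l..}. lasserre_feasible r Gs k))"

lemma eventually_lasserre_filter:
  "eventually P (lasserre_filter r Gs) \<longleftrightarrow>
     (\<exists>l. \<forall>k\<ge>l. \<forall>L\<in>lasserre_feasible r Gs k. P (\<lambda>F. L (mpoly_of r F)))"
proof -
  have "eventually Q (INF l. principal (\<Union>k\<in>{l..}. lasserre_feasible r Gs k)) \<longleftrightarrow>
      (\<exists>l\<in>UNIV. eventually Q (principal (\<Union>k\<in>{l..}. lasserre_feasible r Gs k)))" for Q
  proof (rule eventually_INF_base)
    fix a b :: nat
    show "\<exists>x\<in>UNIV. principal (\<Union>k\<in>{x..}. lasserre_feasible r Gs k) \<le>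
      inf (principal (\<Union>k\<in>{a..}. lasserre_feasible r Gs k)) (principal (\<Union>k\<in>{b..}. lasserre_feasible r Gs k))"
      by (intro bexI[of _ "max a b"]) auto
  qed auto
  thus ?thesis unfolding lasserre_filter_def eventually_filtermap eventually_principal
    by (simp only: Ball_def UN_iff atLeast_iff Bex_def UNIV_I simp_thms) blast
qed

text \<open>Each law involves finitely many polynomials, so it holds from the level on that
  dominates the degree expressions concerned.\<close>

lemma moment_filter_lasserre:
  assumes p: "\<And>j. j < m \<Longrightarrow> p j \<in> poly_ring r"
  shows "moment_filter r m (\<lambda>j. evaluate (p j)) (lasserre_filter r (\<Union>j<m. {p j, - p j}))"
    (is "moment_filter r m _ (lasserre_filter r ?Gs)")
proof
  fix F H :: "(nat \<Rightarrow> real) \<Rightarrow> real" assume F: "polyfun r F" and H: "polyfun r H"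
  show "\<forall>\<^sub>F \<Lambda> in lasserre_filter r ?Gs. \<Lambda> (\<lambda>x. F x + H x) = \<Lambda> F + \<Lambda> H"
    unfolding eventually_lasserre_filter mpoly_of_add[OF F H]
    by (intro exI[of _ "max (total_degree (mpoly_of r F)) (total_degree (mpoly_of r H))"] allI impI ballI
        lasserre_feasibleD(1)) (auto simp: mpoly_of(1) F H)
next
  fix F :: "(nat \<Rightarrow> real) \<Rightarrow> real" and c assume F: "polyfun r F"
  show "\<forall>\<^sub>F \<Lambda> in lasserre_filter r ?Gs. \<Lambda> (\<lambda>x. c * F x) = c * \<Lambda> F"
    unfolding eventually_lasserre_filter mpoly_of_cmult[OF F]
    by (intro exI[of _ "total_degree (mpoly_of r F)"] allI impI ballI lasserre_feasibleD(2))
      (auto simp: mpoly_of(1) F)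
next
  have "mpoly_of r (\<lambda>x. 1) = 1" by (rule mpoly_of_eqI) auto
  thus "\<forall>\<^sub>F \<Lambda> in lasserre_filter r ?Gs. \<Lambda> (\<lambda>x. 1) = 1"
    unfolding eventually_lasserre_filter by (auto intro: lasserre_feasibleD(3))
next
  fix F :: "(nat \<Rightarrow> real) \<Rightarrow> real" assume F: "polyfun r F"
  show "\<forall>\<^sub>F \<Lambda> in lasserre_filter r ?Gs. 0 \<le> \<Lambda> (\<lambda>x. (F x)\<^sup>2)"
    unfolding eventually_lasserre_filter mpoly_of_power[OF F]
    by (intro exI[of _ "total_degree (mpoly_of r F)"] allI impI ballI lasserre_feasibleD(4))
      (auto simp: mpoly_of(1) F)
  show "\<forall>\<^sub>F \<Lambda> in lasserre_filter r ?Gs. \<Lambda> (\<lambda>x. (F x)\<^sup>2) = 0 \<longrightarrow> \<Lambda> F = 0"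
    unfolding eventually_lasserre_filter mpoly_of_power[OF F]
  proof (intro exI allI impI ballI)
    fix k L
    assume k: "max (total_degree (mpoly_of r F)) (total_degree (mpoly_of r F ^ 2)) \<le> k"
      and L: "L \<in> lasserre_feasible r ?Gs k" "L (mpoly_of r F ^ 2) = 0"
    show "L (mpoly_of r F) = 0"
      by (rule lasserre_feasible_square_null[OF L(1) mpoly_of(1)[OF F] _ _ L(2)]) (use k in auto)
  qed
next
  fix j assume "j < m"
  thus "polyfun r (evaluate (p j))" using p polyfun_mpoly_eval by blast
next
  fix j and H :: "(nat \<Rightarrow> real) \<Rightarrow> real" assume j: "j < m" and H: "polyfun r H"
  let ?h = "mpoly_of r H" and ?G = "p j"
  have h: "?h \<in> poly_ring r" by (rule mpoly_of(1)[OF H])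
  have G: "?G \<in> ?Gs" "- ?G \<in> ?Gs" using j by auto
  have eq: "mpoly_of r (\<lambda>x. H x * evaluate ?G x) = ?h * ?G"
    using mpoly_of_mult[OF H polyfun_mpoly_eval[OF p[OF j]]] mpoly_of_evaluate[OF p[OF j]] by simp
  define l where "l = Max {total_degree (?h + 1) + half_deg ?G, total_degree (?h + - 1) + half_deg ?G,
    total_degree ((?h + 1) ^ 2 * ?G), total_degree ((?h + - 1) ^ 2 * ?G), total_degree (?h * ?G)}"
  have "L (?h * ?G) = 0" if "l \<le> k" and L: "L \<in> lasserre_feasible r ?Gs k" for k L
  proof (rule lasserre_feasible_ideal[OF L G p[OF j] h])
    have le: "d \<le> k" if "d \<in> {total_degree (?h + 1) + half_deg ?G, total_degree (?h + - 1) + half_deg ?G,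
      total_degree ((?h + 1) ^ 2 * ?G), total_degree ((?h + - 1) ^ 2 * ?G), total_degree (?h * ?G)}" for d
      using Max_ge[OF _ that] \<open>l \<le> k\<close> unfolding l_def by (meson finite.emptyI finite.insertI order.trans)
    have le2: "d \<le> 2 * k" if "d \<le> k" for d using that by simp
    show "total_degree (?h + 1) + half_deg ?G \<le> k" by (rule le) blast
    show "total_degree (?h + - 1) + half_deg ?G \<le> k" by (rule le) blast
    show "total_degree ((?h + 1) ^ 2 * ?G) \<le> 2 * k" by (rule le2, rule le) blast
    show "total_degree ((?h + - 1) ^ 2 * ?G) \<le> 2 * k" by (rule le2, rule le) blast
    show "total_degree (?h * ?G) \<le> 2 * k" by (rule le2, rule le) blast
  qed
  thus "\<forall>\<^sub>F \<Lambda> in lasserre_filter r ?Gs. \<Lambda> (\<lambda>x. H x * evaluate (p j) x) = 0"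
    unfolding eventually_lasserre_filter eq by blast
qed

text \<open>Point evaluation at a common zero; it bounds the relaxations from above at every
  level.\<close>

lemma evaluation_feasible:
  assumes "\<And>G. G \<in> Gs \<Longrightarrow> evaluate G t = 0"
  shows "(\<lambda>p. evaluate p t) \<in> lasserre_feasible r Gs k"
  using assms by (auto simp: lasserre_feasible_def id_hom.eval_add id_hom.eval_mult id_hom.eval_power)

lemma evaluate_uminus: "evaluate (- p :: real mpoly) x = - evaluate p x"
  using id_hom.eval_add[of x p "- p"] by simp


section \<open>Finite convergence\<close>

lemma zariski_codim_eq_nonempty:
  fixes V :: "(nat \<Rightarrow> 'a::comm_ring_1) set"
  assumes "zariski_codim n V = ereal (real m)"
  shows "V \<noteq> {}"
proof
  assume V: "V = {}"
  let ?X = "{ereal (real d) | d. \<exists>Z. (\<forall>i\<le>d. zariski_irreducible n (Z i) \<and> Z i \<subseteq> V) \<and> (\<forall>i<d. Z i \<subset> Z (Suc i))}"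
  have "?X = {}" unfolding V using zariski_irreducibleD(2) by fastforce
  hence "zariski_dim n V = -\<infinity>" unfolding zariski_dim_def by (simp only: Sup_empty bot_ereal_def)
  thus False using assms by (simp add: zariski_codim_def)
qed

lemma signed_esym_1: "signed_esym n x (Suc 0) = - power_sum n x 1"
  using newton_identity[of 0 n x] by simp

lemma signed_esym_2: "2 * signed_esym n x 2 = (power_sum n x 1)\<^sup>2 - power_sum n x 2"
  using newton_identity[of 1 n x]
  by (simp add: signed_esym_1 numeral_2_eq_2 power2_eq_square)

section \<open>The symmetric problem: upper and lower bounds\<close>

locale symmetric_problem =
  fixes f :: "real mpoly" and g :: "nat \<Rightarrow> real mpoly" and n m r :: nat
  assumes f_ring: "f \<in> poly_ring n" and f_sym: "symmetric_poly n f"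
    and f_deg: "total_degree f \<le> 2 * m"
    and g_ring: "\<And>j. j < m \<Longrightarrow> g j \<in> poly_ring n"
    and g_sym: "\<And>j. j < m \<Longrightarrow> symmetric_poly n (g j)"
    and g_deg: "\<And>j. j < m \<Longrightarrow> total_degree (g j) \<le> m"
    and codim: "zariski_codim n (complex_variety n (g ` {..<m})) = ereal (real m)"
    and r_def: "r = Max ({2, total_degree f div 2} \<union> (\<lambda>j. total_degree (g j)) ` {..<m})"
    and r_le: "r \<le> n"
begin

lemma r_ge: "2 \<le> r" "total_degree f div 2 \<le> r" "j < m \<Longrightarrow> total_degree (g j) \<le> r"
proof -
  have "d \<le> r" if "d \<in> {2, total_degree f div 2} \<union> (\<lambda>j. total_degree (g j)) ` {..<m}" for d
    unfolding r_def by (rule Max_ge[OF _ that]) simp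
  thus "2 \<le> r" "total_degree f div 2 \<le> r" "j < m \<Longrightarrow> total_degree (g j) \<le> r" by auto
qed

text \<open>The power sums are controlled only up to degree \<open>m\<close>, while \<open>r\<close>
  of them are required; the entry 2 in the maximum is what separates off
  \<open>m \<le> 1\<close>.\<close>

lemma r_le_m: "2 \<le> m \<Longrightarrow> r \<le> m"
  unfolding r_def using f_deg g_deg by (subst Max_le_iff) auto

lemma f_expressible: "esym_expressible n (total_degree f) (evaluate f)"
  by (rule symmetric_esym_expressible[OF f_ring order.refl id_hom.eval_symmetric[OF f_sym]])

lemma g_expressible: "j < m \<Longrightarrow> esym_expressible n (total_degree (g j)) (evaluate (g j))"
  by (rule symmetric_esym_expressible[OF g_ring order.refl id_hom.eval_symmetric[OF g_sym]])

lemma part_poly_ring: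
  assumes "\<omega> \<in> r_partitions r n" "p \<in> poly_ring n"
  shows "part_poly \<omega> p \<in> poly_ring r"
  unfolding part_poly_def using assms by (intro poly_ring_substitute poly_ring_Var blocks_less) auto

lemma point_of_blocks:
  assumes "\<omega> \<in> r_partitions r n"
    and zero: "\<And>j. j < m \<Longrightarrow> evaluate (part_poly \<omega> (g j)) t = 0"
  shows "\<exists>x\<in>zero_locus n (g ` {..<m}). evaluate f x = evaluate (part_poly \<omega> f) t"
proof -
  define x where "x = (\<lambda>i\<in>{..<n}. t (blocks \<omega> ! i))"
  have eval: "evaluate p x = evaluate (part_poly \<omega> p) t" if "p \<in> poly_ring n" for p
    unfolding id_hom.eval_part_poly by (rule eval_cong[OF that]) (simp add: x_def)
  have "x \<in> zero_locus n (g ` {..<m})"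
    using zero eval[OF g_ring] by (auto simp: zero_locus_def x_def affine_space_def)
  thus ?thesis using eval[OF f_ring] by blast
qed

text \<open>The half-degree principle replaces \<open>x\<close> by a point \<open>z\<close> with at
  most \<open>r\<close> distinct coordinates. The constraints have degree at most \<open>r\<close>,
  so they depend only on coefficients that are preserved, and \<open>z\<close> stays
  feasible.\<close>

lemma Q_value_upper:
  assumes x: "x \<in> zero_locus n (g ` {..<m})"
  shows "\<exists>\<omega>\<in>r_partitions r n. Q_value \<omega> f g m k \<le> ereal (evaluate f x)"
proof -
  obtain \<Phi> where \<Phi>: "weighted_poly (total_degree f) \<Phi>" "\<And>x. evaluate f x = \<Phi> (signed_esym n x)"
    using f_expressible by (auto simp: esym_expressible_def)
  \<comment> \<open>Only the rounded half of the degree enters \<open>r\<close>; an odd degree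
    accounts for the additional 1.\<close>
  have "total_degree f \<le> 2 * r + 1" using r_ge(2) by linarith
  from half_degree_principle[OF \<Phi>(1) this r_ge(1), of n x] obtain z where
    z: "\<And>j. j \<le> r \<Longrightarrow> signed_esym n z j = signed_esym n x j" "card (z ` {..<n}) \<le> r"
      "evaluate f z \<le> evaluate f x" by (auto simp: \<Phi>(2))
  obtain \<omega> t \<pi> where \<omega>: "\<omega> \<in> r_partitions r n" and \<pi>: "\<pi> permutes {..<n}"
    "\<And>i. i < n \<Longrightarrow> z (\<pi> i) = t (blocks \<omega> ! i)"
    using few_values_imp_blocks[OF z(2) r_le] by blast
  have eval: "evaluate (part_poly \<omega> p) t = evaluate p z" if "p \<in> poly_ring n" "symmetric_poly n p" for p
  proof -
    have "evaluate (part_poly \<omega> p) t = evaluate p (z \<circ> \<pi>)"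
      unfolding id_hom.eval_part_poly by (rule eval_cong[OF that(1)]) (simp add: \<pi>(2))
    thus ?thesis using id_hom.eval_symmetric[OF that(2) \<pi>(1)] by simp
  qed
  have "evaluate (part_poly \<omega> (g j)) t = 0" if j: "j < m" for j
  proof -
    obtain \<Psi> where \<Psi>: "weighted_poly (total_degree (g j)) \<Psi>" "\<And>x. evaluate (g j) x = \<Psi> (signed_esym n x)"
      using g_expressible[OF j] by (auto simp: esym_expressible_def)
    have "\<Psi> (signed_esym n z) = \<Psi> (signed_esym n x)"
      using r_ge(3)[OF j] by (intro weighted_poly_cong[OF \<Psi>(1)] z(1)) linarith
    hence "evaluate (g j) z = evaluate (g j) x" by (simp add: \<Psi>(2))
    thus ?thesis using eval[OF g_ring g_sym, OF j j] x j by (auto simp: zero_locus_def)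
  qed
  hence "evaluate G t = 0" if "G \<in> part_constraints \<omega> g m" for G
    using that by (auto simp: part_constraints_def evaluate_uminus)
  hence "(\<lambda>p. evaluate p t) \<in> lasserre_feasible (length \<omega>) (part_constraints \<omega> g m) k"
    by (rule evaluation_feasible)
  hence "Q_value \<omega> f g m k \<le> ereal (evaluate (part_poly \<omega> f) t)"
    unfolding Q_value_def lasserre_value_def by (rule INF_lower)
  also have "\<dots> \<le> ereal (evaluate f x)" using z(3) eval[OF f_ring f_sym] by simp
  finally show ?thesis using \<omega> by blast
qed

lemma finite_esym_values:
  assumes "i < m"
  shows "finite ((\<lambda>x. signed_esym n x (Suc i)) ` complex_variety n (g ` {..<m}))"
proof -
  have mn: "m \<le> n" by (rule zariski_codim_eqD(1)[OF codim])
  have "\<exists>\<Phi>. weighted_poly m \<Phi> \<and> (\<forall>x. mpoly_eval complex_of_real x (g j) = \<Phi> (signed_esym n x))" if "j < m" for j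
    using symmetric_esym_expressible[OF g_ring[OF that] g_deg[OF that], of complex_of_real]
      complex_hom.eval_symmetric[OF g_sym[OF that]] by (auto simp: esym_expressible_def)
  then obtain \<Phi> where \<Phi>: "\<And>j. j < m \<Longrightarrow> weighted_poly m (\<Phi> j)"
    "\<And>j x. j < m \<Longrightarrow> mpoly_eval complex_of_real x (g j) = \<Phi> j (signed_esym n x)" by metis
  \<comment> \<open>Reads a point of \<open>m\<close>-space as a coefficient sequence, shifted by
    one; the constraints have weight at most \<open>m\<close> and ignore the remaining
    entries.\<close>
  define e where "e y k = (if 1 \<le> k \<and> k \<le> m then y (k - 1) else 0)" for y :: "nat \<Rightarrow> complex" and k :: nat
  have e_poly: "polyfun m (\<lambda>y. e y k)" for k
    by (cases "1 \<le> k \<and> k \<le> m") (auto simp: e_def intro!: polyfun_intros)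
  have \<Phi>e: "\<Phi> j (e (esym_map n x)) = mpoly_eval complex_of_real x (g j)" if "j < m" for j x
    unfolding \<Phi>(2)[OF that] using mn
    by (intro weighted_poly_cong[OF \<Phi>(1)[OF that]]) (auto simp: e_def esym_map_def)
  show ?thesis
  proof (rule codim_imp_finite_esym[OF codim _ _ assms])
    show "complex_variety n (g ` {..<m}) = {x \<in> affine_space n. \<forall>j<m. \<Phi> j (e (esym_map n x)) = 0}"
      using \<Phi>e by (auto simp: complex_variety_def)
    show "polyfun m (\<lambda>y. \<Phi> j (e y))" if "j < m" for j
      by (rule weighted_poly_imp_polyfun[OF \<Phi>(1)[OF that] e_poly])
  qed
qed

text \<open>A power sum of degree at most \<open>m\<close> is a polynomial in coefficients that take
  only finitely many values on the variety.\<close>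

lemma bounded_power_sums:
  assumes "k \<le> m"
  shows "\<exists>C. \<forall>x\<in>complex_variety n (g ` {..<m}). norm (power_sum n x k) \<le> C"
proof -
  let ?V = "complex_variety n (g ` {..<m})"
  obtain \<Phi> where \<Phi>: "weighted_poly k \<Phi>" "\<And>x :: nat \<Rightarrow> complex. power_sum n x k = \<Phi> (signed_esym n x)"
    using esym_expressible_power_sum[of n k] by (auto simp: esym_expressible_def)
  define P where "P = PiE {1..m} (\<lambda>i. (\<lambda>x. signed_esym n x i) ` ?V)"
  have "finite P" unfolding P_def
  proof (rule finite_PiE)
    fix i assume "i \<in> {1..m}"
    hence "i - 1 < m" "Suc (i - 1) = i" by auto
    thus "finite ((\<lambda>x. signed_esym n x i) ` ?V)" using finite_esym_values[of "i - 1"] by simp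
  qed simp
  have "power_sum n x k \<in> \<Phi> ` P" if "x \<in> ?V" for x
  proof -
    have "restrict (signed_esym n x) {1..m} \<in> P" using that by (auto simp: P_def)
    moreover have "power_sum n x k = \<Phi> (restrict (signed_esym n x) {1..m})"
      unfolding \<Phi>(2) using assms by (intro weighted_poly_cong[OF \<Phi>(1)]) auto
    ultimately show ?thesis by blast
  qed
  moreover have "bounded (\<Phi> ` P)" using \<open>finite P\<close> by (intro finite_imp_bounded) auto
  then obtain C where "\<And>y. y \<in> \<Phi> ` P \<Longrightarrow> norm y \<le> C" by (auto simp: bounded_iff)
  ultimately show ?thesis by blast
qed

lemma moment_filter_problem:
  assumes "\<omega> \<in> r_partitions r n"
  shows "moment_filter r m (\<lambda>j. evaluate (part_poly \<omega> (g j))) (lasserre_filter r (part_constraints \<omega> g m))"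
  unfolding part_constraints_def using assms
  by (intro moment_filter_lasserre part_poly_ring g_ring)

lemma eventually_lower_bound:
  assumes \<omega>: "\<omega> \<in> r_partitions r n" and F: "polyfun r F" and m: "2 \<le> m"
    and Fv: "\<And>t. (\<And>j. j < m \<Longrightarrow> evaluate (part_poly \<omega> (g j)) t = 0) \<Longrightarrow> v \<le> F t"
  shows "\<forall>\<^sub>F \<Lambda> in lasserre_filter r (part_constraints \<omega> g m). v \<le> \<Lambda> F"
proof -
  interpret moment_filter r m "\<lambda>j. evaluate (part_poly \<omega> (g j))" "lasserre_filter r (part_constraints \<omega> g m)"
    by (rule moment_filter_problem[OF \<omega>])
  let ?V = "complex_variety n (g ` {..<m})"
  obtain C where C: "\<And>k x. k \<le> m \<Longrightarrow> x \<in> ?V \<Longrightarrow> norm (power_sum n x k) \<le> C k"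
    using bounded_power_sums by metis
  define D where "D = (\<Sum>k\<le>m. \<bar>C k\<bar>)"
  have D: "norm (power_sum n x k) \<le> D" if "k \<le> m" "x \<in> ?V" for k x
  proof -
    have "\<bar>C k\<bar> \<le> D" unfolding D_def using that by (intro member_le_sum) auto
    thus ?thesis using C[OF that] by linarith
  qed
  have pos: "0 < real (\<omega> ! l)" if "l < r" for l
    using \<omega> that by (auto simp: r_partitions_def)
  obtain B where B: "\<And>t :: nat \<Rightarrow> complex. (\<And>k. 1 \<le> k \<Longrightarrow> k \<le> r \<Longrightarrow>
      norm (\<Sum>l<r. of_real (real (\<omega> ! l)) * t l ^ k) \<le> D) \<Longrightarrow> (\<forall>l<r. norm (t l) \<le> B)"
    using weighted_power_sums_bounded[of r "\<lambda>l. real (\<omega> ! l)" D, OF pos] by blast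
  have grid: "\<exists>S. finite S \<and> (\<lambda>x. \<Prod>a\<in>S. x i - a) \<in> null" if i: "i < r" for i
  proof -
    have "norm (t i) \<le> B" if t: "\<forall>j<m. mpoly_eval complex_of_real t (part_poly \<omega> (g j)) = 0" for t
    proof -
      \<comment> \<open>A complex zero of the constraints of \<open>\<omega>\<close> unfolds to a
        point of \<open>?V\<close>, whose power sums are the weighted power sums of
        \<open>t\<close>.\<close>
      define x where "x = (\<lambda>i\<in>{..<n}. t (blocks \<omega> ! i))"
      have "mpoly_eval complex_of_real x (g j) = 0" if "j < m" for j
      proof -
        have "mpoly_eval complex_of_real x (g j) = mpoly_eval complex_of_real t (part_poly \<omega> (g j))"
          unfolding complex_hom.eval_part_poly by (rule eval_cong[OF g_ring[OF that]]) (simp add: x_def)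
        thus ?thesis using t that by simp
      qed
      hence "x \<in> ?V" by (auto simp: complex_variety_def x_def affine_space_def)
      moreover have "power_sum n x k = (\<Sum>l<r. of_real (real (\<omega> ! l)) * t l ^ k)" for k
        using sum_blocks[OF \<omega>, of "\<lambda>l. t l ^ k"] by (simp add: power_sum_def x_def)
      ultimately have "norm (\<Sum>l<r. of_real (real (\<omega> ! l)) * t l ^ k) \<le> D" if "k \<le> r" for k
        using D[of k x] that r_le_m[OF m] by simp
      thus ?thesis using B i by blast
    qed
    with bounded_imp_univariate_in_ideal[of m "\<lambda>j. part_poly \<omega> (g j)" r i B]
      part_poly_ring[OF \<omega> g_ring] i
    obtain q H where q: "q \<noteq> 0" "\<And>j. j < m \<Longrightarrow> polyfun r (H j)"
      "\<And>x. poly q (x i) = (\<Sum>j<m. H j x * evaluate (part_poly \<omega> (g j)) x)" by blast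
    have "(\<lambda>x. \<Sum>j<m. H j x * evaluate (part_poly \<omega> (g j)) x) \<in> null"
      using q(2) by (intro fun_ideal_sum[OF fun_ideal_null] null_mult null_G) auto
    hence "(\<lambda>x. poly q (x i)) \<in> null" by (simp add: q(3))
    thus ?thesis by (rule univariate_null_real_rooted[OF i q(1)])
  qed
  show ?thesis
    by (rule eventually_nonneg_minus_const[OF F nonneg_on_zeros_imp_eventually_nonneg[OF grid F Fv]])
qed

text \<open>
  For \<open>m = 1\<close> the problem is the minimization of a quadratic function on a line, where the
  constraint ideal is not zero-dimensional but an explicit sum of squares exists.
\<close>

lemma linear_case:
  assumes m: "m = 1"
  shows "zero_locus n (g ` {..<m}) \<noteq> {}"
    "\<lbrakk>\<omega> \<in> r_partitions r n; \<And>x. x \<in> zero_locus n (g ` {..<m}) \<Longrightarrow> v \<le> evaluate f x\<rbrakk> \<Longrightarrow>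
      \<forall>\<^sub>F \<Lambda> in lasserre_filter r (part_constraints \<omega> g m). v \<le> \<Lambda> (evaluate (part_poly \<omega> f))"
proof -
  let ?V = "complex_variety n (g ` {..<m})"
  have r2: "r = 2"
  proof -
    have "r \<le> 2" unfolding r_def using f_deg g_deg[of 0] by (auto simp: m)
    thus ?thesis using r_ge(1) by simp
  qed
  have n2: "2 \<le> n" using r_le r2 by simp
  obtain \<Phi> where \<Phi>: "weighted_poly (total_degree (g 0)) \<Phi>" "\<And>x. evaluate (g 0) x = \<Phi> (signed_esym n x)"
    using g_expressible[of 0] m by (auto simp: esym_expressible_def)
  obtain a b where ab: "\<And>e. \<Phi> e = a * e 1 + b" using weighted_poly_1[OF \<Phi>(1)] g_deg[of 0] m by auto
  have g0: "evaluate (g 0) x = b - a * power_sum n x 1" for x by (simp add: \<Phi>(2) ab signed_esym_1)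
  \<comment> \<open>Otherwise the constraint is constant, and the nonempty variety is the whole
    space. There the first elementary symmetric function takes every value, against
    \<open>finite_esym_values\<close>.\<close>
  have "a \<noteq> 0"
  proof
    assume "a = 0"
    hence "evaluate (g 0) x = evaluate (Const b) x" for x by (simp add: g0)
    hence gb: "g 0 = Const b" using g_ring[of 0] m by (intro evaluate_inj[of _ n]) auto
    have "?V \<noteq> {}" by (rule zariski_codim_eq_nonempty[OF codim])
    hence "?V = affine_space n" by (auto simp: complex_variety_def m gb)
    hence fin: "finite ((\<lambda>x :: nat \<Rightarrow> complex. signed_esym n x (Suc 0)) ` affine_space n)"
      using finite_esym_values[of 0] m by simp
    have "UNIV \<subseteq> (\<lambda>x :: nat \<Rightarrow> complex. signed_esym n x (Suc 0)) ` affine_space n"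
    proof
      fix c :: complex
      have "(\<lambda>i\<in>{..<n}. c) \<in> affine_space n" by (auto simp: affine_space_def)
      then obtain x where "x \<in> affine_space n" "esym_map n x = (\<lambda>i\<in>{..<n}. c)" using esym_map_surj by blast
      moreover from fun_cong[OF this(2), of 0] have "signed_esym n x (Suc 0) = c"
        using n2 by (simp add: esym_map_def)
      ultimately show "c \<in> (\<lambda>x. signed_esym n x (Suc 0)) ` affine_space n" by blast
    qed
    thus False using fin finite_subset infinite_UNIV_char_0 by blast
  qed
  define c where "c = b / a"
  have g0': "evaluate (g 0) x = - a * (power_sum n x 1 - c)" for x
    using \<open>a \<noteq> 0\<close> by (simp add: g0 c_def algebra_simps)
  \<comment> \<open>A line inside the zero set along which the sum of squares is unbounded;
    boundedness of \<open>f\<close> from below then forces \<open>\<beta> \<ge> 0\<close>.\<close>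
  define pt where "pt s = (\<lambda>i\<in>{..<n}. if i = 0 then s else if i = 1 then c - s else 0)" for s :: real
  have pt: "pt s \<in> zero_locus n (g ` {..<m})" "power_sum n (pt s) 2 = s\<^sup>2 + (c - s)\<^sup>2" "power_sum n (pt s) 1 = c" for s
  proof -
    have "(\<Sum>i<n. (pt s i) ^ k) = s ^ k + (c - s) ^ k" if "k > 0" for k
    proof -
      have "(\<Sum>i<n. (pt s i) ^ k) = (\<Sum>i\<in>{0, 1}. (pt s i) ^ k)"
        using n2 that by (intro sum.mono_neutral_right) (auto simp: pt_def)
      thus ?thesis using n2 by (simp add: pt_def)
    qed
    from this[of 1] this[of 2] show *: "power_sum n (pt s) 2 = s\<^sup>2 + (c - s)\<^sup>2" "power_sum n (pt s) 1 = c"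
      by (simp_all add: power_sum_def)
    show "pt s \<in> zero_locus n (g ` {..<m})" using *(2) by (simp add: zero_locus_def m g0' pt_def affine_space_def)
  qed
  show "zero_locus n (g ` {..<m}) \<noteq> {}" using pt(1) by blast
  assume \<omega>: "\<omega> \<in> r_partitions r n" and v: "\<And>x. x \<in> zero_locus n (g ` {..<m}) \<Longrightarrow> v \<le> evaluate f x"
  obtain \<Psi> where \<Psi>: "weighted_poly (total_degree f) \<Psi>" "\<And>x. evaluate f x = \<Psi> (signed_esym n x)"
    using f_expressible by (auto simp: esym_expressible_def)
  obtain \<alpha>' \<beta>' \<gamma>' \<delta> where "\<And>e. \<Psi> e = \<alpha>' * (e 1)\<^sup>2 + \<beta>' * e 2 + \<gamma>' * e 1 + \<delta>"
    using weighted_poly_2[OF \<Psi>(1)] f_deg m by auto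
  hence f0: "evaluate f x = \<alpha>' * (power_sum n x 1)\<^sup>2 + \<beta>' * (((power_sum n x 1)\<^sup>2 - power_sum n x 2) / 2)
      + \<gamma>' * (- power_sum n x 1) + \<delta>" for x
    using signed_esym_2[of n x] by (simp add: \<Psi>(2) signed_esym_1)
  define \<alpha> \<beta> \<gamma> where "\<alpha> = \<alpha>' + \<beta>' / 2" and "\<beta> = - \<beta>' / 2" and "\<gamma> = - \<gamma>'"
  have f: "evaluate f x = \<alpha> * (power_sum n x 1)\<^sup>2 + \<beta> * power_sum n x 2 + \<gamma> * power_sum n x 1 + \<delta>" for x
    by (simp add: f0 \<alpha>_def \<beta>_def \<gamma>_def field_simps)
  have "\<beta> \<ge> 0"
  proof (rule ccontr)
    assume neg: "\<not> \<beta> \<ge> 0"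
    define E where "E = \<alpha> * c\<^sup>2 + \<gamma> * c + \<delta> - v"
    have "s\<^sup>2 * (- \<beta>) \<le> E" for s
    proof -
      have "v \<le> \<alpha> * c\<^sup>2 + \<beta> * (s\<^sup>2 + (c - s)\<^sup>2) + \<gamma> * c + \<delta>" using v[OF pt(1)[of s]] unfolding f pt(2,3) .
      moreover have "\<beta> * (c - s)\<^sup>2 \<le> 0" using neg by (simp add: mult_nonpos_nonneg)
      ultimately show ?thesis by (simp add: E_def algebra_simps)
    qed
    moreover have "(sqrt ((\<bar>E\<bar> + 1) / (- \<beta>)))\<^sup>2 * (- \<beta>) = \<bar>E\<bar> + 1"
      using neg by (subst real_sqrt_pow2) (auto intro!: divide_nonneg_neg)
    ultimately have "\<bar>E\<bar> + 1 \<le> E" by metis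
    thus False by linarith
  qed
  interpret moment_filter r m "\<lambda>j. evaluate (part_poly \<omega> (g j))" "lasserre_filter r (part_constraints \<omega> g m)"
    by (rule moment_filter_problem[OF \<omega>])
  define p where "p t = (\<Sum>l<r. real (\<omega> ! l) * t l)" for t :: "nat \<Rightarrow> real"
  define w0 w1 where "w0 = real (\<omega> ! 0)" and "w1 = real (\<omega> ! 1)"
  have lt2: "{..<2::nat} = {0, 1}" by auto
  have w: "w0 + w1 = real n" "0 \<le> w0" "0 \<le> w1"
  proof -
    have "length \<omega> = 2" "sum_list \<omega> = n" using \<omega> r2 by (auto simp: r_partitions_def)
    hence "\<omega> ! 0 + \<omega> ! 1 = n" by (simp add: sum_list_sum_nth atLeast0LessThan lt2)
    thus "w0 + w1 = real n" "0 \<le> w0" "0 \<le> w1" by (auto simp: w0_def w1_def)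
  qed
  have n0: "real n > 0" using n2 by simp
  have power_sums: "power_sum n (\<lambda>i. t (blocks \<omega> ! i)) k = w0 * t 0 ^ k + w1 * t 1 ^ k" for t :: "nat \<Rightarrow> real" and k
    using sum_blocks[OF \<omega>, of "\<lambda>l. t l ^ k"] by (simp add: power_sum_def r2 lt2 w0_def w1_def)
  have p: "p t = w0 * t 0 + w1 * t 1" for t by (simp add: p_def r2 lt2 w0_def w1_def)
  define A where "A = \<alpha> + \<beta> / real n"
  \<comment> \<open>The excess of \<open>f\<close> over \<open>v\<close> at the point with all
    coordinates equal to \<open>c / real n\<close>, where the sum of squares is least for the given
    sum.\<close>
  define \<kappa> where "\<kappa> = A * c\<^sup>2 + \<gamma> * c + \<delta> - v"
  have "\<kappa> \<ge> 0"
  proof -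
    define x where "x = (\<lambda>i\<in>{..<n}. c / real n)"
    have ps: "power_sum n x 1 = c" "power_sum n x 2 = c\<^sup>2 / real n"
      using n0 by (simp_all add: x_def power_sum_def power2_eq_square)
    have "x \<in> zero_locus n (g ` {..<m})"
      using ps(1) by (simp add: zero_locus_def m g0' x_def affine_space_def)
    from v[OF this] show ?thesis unfolding f ps by (simp add: \<kappa>_def A_def algebra_simps)
  qed
  \<comment> \<open>The certificate: a nonnegative constant, a nonnegative multiple of a square and
    a multiple of the constraint. The second power sum is rewritten by Lagrange's identity for the
    two weights.\<close>
  have id: "evaluate (part_poly \<omega> f) t - v = \<kappa> * 1\<^sup>2 + \<beta> * w0 * w1 / real n * (t 0 - t 1)\<^sup>2 +
      (- 1 / a) * (A * (p t + c) + \<gamma>) * evaluate (part_poly \<omega> (g 0)) t" for t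
  proof -
    have "real n * (w0 * (t 0)\<^sup>2 + w1 * (t 1)\<^sup>2) = (p t)\<^sup>2 + w0 * w1 * (t 0 - t 1)\<^sup>2"
      unfolding w(1)[symmetric] p by (simp add: power2_eq_square algebra_simps)
    hence ps2: "w0 * (t 0)\<^sup>2 + w1 * (t 1)\<^sup>2 = ((p t)\<^sup>2 + w0 * w1 * (t 0 - t 1)\<^sup>2) / real n"
      using n0 by (simp add: field_simps)
    have "evaluate (part_poly \<omega> f) t = \<alpha> * (p t)\<^sup>2 + \<beta> * (((p t)\<^sup>2 + w0 * w1 * (t 0 - t 1)\<^sup>2) / real n) + \<gamma> * p t + \<delta>"
      unfolding id_hom.eval_part_poly f power_sums ps2[symmetric] by (simp add: p)
    also have "\<dots> = A * (p t)\<^sup>2 + \<beta> * w0 * w1 / real n * (t 0 - t 1)\<^sup>2 + \<gamma> * p t + \<delta>"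
      by (simp add: A_def add_divide_distrib algebra_simps)
    finally have 1: "evaluate (part_poly \<omega> f) t = A * (p t)\<^sup>2 + \<beta> * w0 * w1 / real n * (t 0 - t 1)\<^sup>2 + \<gamma> * p t + \<delta>" .
    have "evaluate (part_poly \<omega> (g 0)) t = - a * (p t - c)"
      unfolding id_hom.eval_part_poly g0' power_sums by (simp add: p)
    hence 2: "(- 1 / a) * (A * (p t + c) + \<gamma>) * evaluate (part_poly \<omega> (g 0)) t = (A * (p t + c) + \<gamma>) * (p t - c)"
      using \<open>a \<noteq> 0\<close> by simp
    show ?thesis unfolding 1 2 \<kappa>_def by (simp add: power2_eq_square algebra_simps)
  qed
  have p_poly: "polyfun r p" unfolding p_def by (intro polyfun_intros) auto
  have "(\<lambda>t. \<kappa> * 1\<^sup>2) \<in> eventually_nonneg"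
    using \<open>\<kappa> \<ge> 0\<close> by (intro eventually_nonneg_square polyfun_const)
  moreover have "(\<lambda>t. \<beta> * w0 * w1 / real n * (t 0 - t 1)\<^sup>2) \<in> eventually_nonneg"
    using \<open>\<beta> \<ge> 0\<close> w r2 by (intro eventually_nonneg_square polyfun_intros) auto
  moreover have "(\<lambda>t. (- 1 / a) * (A * (p t + c) + \<gamma>) * evaluate (part_poly \<omega> (g 0)) t) \<in> null"
    using m p_poly by (intro null_mult null_G polyfun_intros) auto
  hence "(\<lambda>t. (- 1 / a) * (A * (p t + c) + \<gamma>) * evaluate (part_poly \<omega> (g 0)) t) \<in> eventually_nonneg"
    using null_subset_eventually_nonneg by blast
  ultimately have "(\<lambda>t. evaluate (part_poly \<omega> f) t - v) \<in> eventually_nonneg"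
    unfolding id by (intro eventually_nonneg_add)
  thus "\<forall>\<^sub>F \<Lambda> in lasserre_filter r (part_constraints \<omega> g m). v \<le> \<Lambda> (evaluate (part_poly \<omega> f))"
    by (intro eventually_nonneg_minus_const polyfun_mpoly_eval part_poly_ring[OF \<omega> f_ring])
qed

text \<open>Here \<open>f\<close> has degree 0, so \<open>f - v\<close> is itself a nonnegative
  constant.\<close>

lemma constant_case:
  assumes m: "m = 0"
  shows "zero_locus n (g ` {..<m}) \<noteq> {}"
    "\<lbrakk>\<omega> \<in> r_partitions r n; \<And>x. x \<in> zero_locus n (g ` {..<m}) \<Longrightarrow> v \<le> evaluate f x\<rbrakk> \<Longrightarrow>
      \<forall>\<^sub>F \<Lambda> in lasserre_filter r (part_constraints \<omega> g m). v \<le> \<Lambda> (evaluate (part_poly \<omega> f))"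
proof -
  have x0: "(\<lambda>i\<in>{..<n}. 0) \<in> zero_locus n (g ` {..<m})" by (simp add: m zero_locus_def affine_space_def)
  thus "zero_locus n (g ` {..<m}) \<noteq> {}" by blast
  assume \<omega>: "\<omega> \<in> r_partitions r n" and v: "\<And>x. x \<in> zero_locus n (g ` {..<m}) \<Longrightarrow> v \<le> evaluate f x"
  interpret moment_filter r m "\<lambda>j. evaluate (part_poly \<omega> (g j))" "lasserre_filter r (part_constraints \<omega> g m)"
    by (rule moment_filter_problem[OF \<omega>])
  obtain \<Psi> where \<Psi>: "weighted_poly (total_degree f) \<Psi>" "\<And>x. evaluate f x = \<Psi> (signed_esym n x)"
    using f_expressible by (auto simp: esym_expressible_def)
  obtain c where "\<And>e. \<Psi> e = c" using weighted_poly_0[OF \<Psi>(1)] f_deg m by auto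
  hence c: "evaluate f x = c" for x by (simp add: \<Psi>(2))
  have "(\<lambda>t. (c - v) * 1\<^sup>2) \<in> eventually_nonneg"
    using v[OF x0] by (intro eventually_nonneg_square polyfun_const) (simp add: c)
  moreover have "(c - v) * 1\<^sup>2 = evaluate (part_poly \<omega> f) t - v" for t
    unfolding id_hom.eval_part_poly c by simp
  ultimately have "(\<lambda>t. evaluate (part_poly \<omega> f) t - v) \<in> eventually_nonneg" by simp
  thus "\<forall>\<^sub>F \<Lambda> in lasserre_filter r (part_constraints \<omega> g m). v \<le> \<Lambda> (evaluate (part_poly \<omega> f))"
    by (intro eventually_nonneg_minus_const polyfun_mpoly_eval part_poly_ring[OF \<omega> f_ring])
qed

lemma Q_value_lower:
  assumes \<omega>: "\<omega> \<in> r_partitions r n"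
  shows "\<exists>l. \<forall>k\<ge>l. (INF x\<in>zero_locus n (g ` {..<m}). ereal (evaluate f x)) \<le> Q_value \<omega> f g m k"
proof -
  let ?Z = "zero_locus n (g ` {..<m})" and ?\<F> = "lasserre_filter r (part_constraints \<omega> g m)"
  define I where "I = (INF x\<in>?Z. ereal (evaluate f x))"
  have len: "length \<omega> = r" using \<omega> by (simp add: r_partitions_def)
  have f_poly: "polyfun r (evaluate (part_poly \<omega> f))"
    by (rule polyfun_mpoly_eval[OF part_poly_ring[OF \<omega> f_ring]])
  consider "?Z = {}" | "?Z \<noteq> {}" "I = -\<infinity>" | v where "?Z \<noteq> {}" "I = ereal v"
  proof (cases I)
    case PInf
    have "?Z = {}"
    proof (rule ccontr)
      assume "?Z \<noteq> {}"
      then obtain x where "x \<in> ?Z" by blast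
      hence "I \<le> ereal (evaluate f x)" unfolding I_def by (rule INF_lower)
      thus False using PInf by simp
    qed
    thus ?thesis using that by blast
  qed (use that in blast)+
  hence "\<exists>l. \<forall>k\<ge>l. I \<le> Q_value \<omega> f g m k"
  proof cases
    case 1
    have m: "2 \<le> m"
    proof (rule ccontr)
      assume "\<not> 2 \<le> m"
      hence "m = 0 \<or> m = 1" by linarith
      thus False using 1 linear_case(1) constant_case(1) by blast
    qed
    \<comment> \<open>Without real zeros every lower bound holds vacuously. The bound 1 for the zero
      function shows that no functional is feasible at high levels, so the relaxation has value
      \<open>\<infinity>\<close>.\<close>
    interpret moment_filter r m "\<lambda>j. evaluate (part_poly \<omega> (g j))" ?\<F>
      by (rule moment_filter_problem[OF \<omega>])
    have "\<forall>\<^sub>F \<Lambda> in ?\<F>. 1 \<le> \<Lambda> (\<lambda>x. 0)"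
      using point_of_blocks[OF \<omega>] 1 by (intro eventually_lower_bound[OF \<omega> polyfun_const m]) blast
    moreover have "\<forall>\<^sub>F \<Lambda> in ?\<F>. \<Lambda> (\<lambda>x. 0) = 0" by (rule ev_null[OF fun_idealD(2)[OF fun_ideal_null]])
    ultimately have "\<forall>\<^sub>F \<Lambda> in ?\<F>. False" by eventually_elim simp
    then obtain l where "\<forall>k\<ge>l. lasserre_feasible r (part_constraints \<omega> g m) k = {}"
      unfolding eventually_lasserre_filter by blast
    thus ?thesis by (intro exI[of _ l]) (simp add: Q_value_def lasserre_value_def len top_ereal_def)
  next
    case 2
    thus ?thesis by simp
  next
    case (3 v)
    have v: "v \<le> evaluate f x" if "x \<in> ?Z" for x
    proof -
      have "I \<le> ereal (evaluate f x)" unfolding I_def using that by (rule INF_lower)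
      thus ?thesis using 3 by simp
    qed
    have "\<forall>\<^sub>F \<Lambda> in ?\<F>. v \<le> \<Lambda> (evaluate (part_poly \<omega> f))"
    proof (cases "2 \<le> m")
      case True
      show ?thesis
      proof (rule eventually_lower_bound[OF \<omega> f_poly True])
        fix t assume "\<And>j. j < m \<Longrightarrow> evaluate (part_poly \<omega> (g j)) t = 0"
        then obtain x where "x \<in> ?Z" "evaluate f x = evaluate (part_poly \<omega> f) t"
          using point_of_blocks[OF \<omega>] by blast
        thus "v \<le> evaluate (part_poly \<omega> f) t" using v by metis
      qed
    next
      case False
      hence "m = 0 \<or> m = 1" by linarith
      thus ?thesis using linear_case(2)[OF _ \<omega> v] constant_case(2)[OF _ \<omega> v] by blast
    qed
    then obtain l where "\<And>k L. l \<le> k \<Longrightarrow> L \<in> lasserre_feasible r (part_constraints \<omega> g m) k \<Longrightarrow>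
        v \<le> L (part_poly \<omega> f)"
      unfolding eventually_lasserre_filter mpoly_of_evaluate[OF part_poly_ring[OF \<omega> f_ring]] by blast
    thus ?thesis unfolding 3 Q_value_def lasserre_value_def len
      by (intro exI[of _ l] allI impI INF_greatest) simp
  qed
  thus ?thesis unfolding I_def .
qed

lemma finite_convergence:
  "\<exists>l. (\<forall>\<omega>\<in>r_partitions r n. Q_k0 \<omega> f g m \<le> l) \<and>
     (\<forall>k\<ge>l. (INF \<omega>\<in>r_partitions r n. Q_value \<omega> f g m k) =
             (INF x\<in>zero_locus n (g ` {..<m}). ereal (evaluate f x)))"
proof -
  let ?I = "INF x\<in>zero_locus n (g ` {..<m}). ereal (evaluate f x)"
  obtain l where l: "\<And>\<omega> k. \<omega> \<in> r_partitions r n \<Longrightarrow> l \<omega> \<le> k \<Longrightarrow> ?I \<le> Q_value \<omega> f g m k"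
    using Q_value_lower by metis
  \<comment> \<open>There are finitely many partitions, so a sum dominates all their levels; the
    summand \<open>Q_k0\<close> ensures that every relaxation is defined at that level.\<close>
  define M where "M = (\<Sum>\<omega>\<in>r_partitions r n. l \<omega> + Q_k0 \<omega> f g m)"
  have M: "l \<omega> + Q_k0 \<omega> f g m \<le> M" if "\<omega> \<in> r_partitions r n" for \<omega>
    unfolding M_def using that finite_r_partitions
    by (intro member_le_sum[of \<omega> _ "\<lambda>\<omega>. l \<omega> + Q_k0 \<omega> f g m"]) auto
  have "(INF \<omega>\<in>r_partitions r n. Q_value \<omega> f g m k) = ?I" if k: "M \<le> k" for k
  proof (rule antisym)
    show "(INF \<omega>\<in>r_partitions r n. Q_value \<omega> f g m k) \<le> ?I"
    proof (rule INF_greatest)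
      fix x assume "x \<in> zero_locus n (g ` {..<m})"
      then obtain \<omega> where "\<omega> \<in> r_partitions r n" "Q_value \<omega> f g m k \<le> ereal (evaluate f x)"
        using Q_value_upper by blast
      thus "(INF \<omega>\<in>r_partitions r n. Q_value \<omega> f g m k) \<le> ereal (evaluate f x)" by (rule INF_lower2)
    qed
    show "?I \<le> (INF \<omega>\<in>r_partitions r n. Q_value \<omega> f g m k)"
    proof (rule INF_greatest)
      fix \<omega> assume \<omega>: "\<omega> \<in> r_partitions r n"
      show "?I \<le> Q_value \<omega> f g m k" using M[OF \<omega>] k by (intro l[OF \<omega>]) linarith
    qed
  qed
  moreover have "Q_k0 \<omega> f g m \<le> M" if "\<omega> \<in> r_partitions r n" for \<omega> using M[OF that] by linarith
  ultimately show ?thesis by blast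
qed

end

theorem theorem5p4:
  fixes f :: "real mpoly" and g :: "nat \<Rightarrow> real mpoly" and n m r :: nat
  assumes "f \<in> poly_ring n" and "symmetric_poly n f" and "total_degree f \<le> 2 * m"
    and "\<And>j. j < m \<Longrightarrow> g j \<in> poly_ring n"
    and "\<And>j. j < m \<Longrightarrow> symmetric_poly n (g j)"
    and "\<And>j. j < m \<Longrightarrow> total_degree (g j) \<le> m"
    and "zariski_codim n (complex_variety n (g ` {..<m})) = ereal (real m)"
    and "r = Max ({2, total_degree f div 2} \<union> (\<lambda>j. total_degree (g j)) ` {..<m})"
    and "r \<le> n"
  shows "\<exists>l. (\<forall>\<omega>\<in>r_partitions r n. Q_k0 \<omega> f g m \<le> l) \<and>
           (\<forall>k\<ge>l. (INF \<omega>\<in>r_partitions r n. Q_value \<omega> f g m k) =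
                   (INF x\<in>zero_locus n (g ` {..<m}). ereal (evaluate f x)))"
proof -
  interpret symmetric_problem f g n m r
    using assms by (rule symmetric_problem.intro)
  show ?thesis by (rule finite_convergence)
qed

end
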